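(* Let $G$ be the graph of a sensor network in $\mathbb{R}^d$ with $m\ge d+1$ anchor points with positions $\bar P=[\bar p_1,\dots,\bar p_m]$ and $n$ sensor points with positions $P=[p_1,\dots,p_n]$, with edges given by $N_x$ and $N_a$. Suppose that $G$ is a $(d+1)$-lateration graph and that the points $(\bar P,P)$ are in general position. Then the sensor network is strongly localizable, and a rank $n$ optimal dual stress matrix can be computed exactly in strongly polynomial time, namely in $\mathcal{O}(n^3+nd^3)$ arithmetic operations, if the lateration ordering and the sensor position matrix $P$ are known.
   Context: Sensor network: there are $m$ anchors with known positions $\bar p_1,\dots,\bar p_m\in\mathbb{R}^d$, and $n$ sensors whose locations $x_1,\dots,x_n\in\mathbb{R}^d$ are to be determined. $N_a$ is the set of pairs $(k,j)$ such that the distance $\bar d_{kj}$ between anchor $k$ and sensor $j$ is specified; $N_x$ is the set of pairs $(i,j)$, $i<j$, such that the distance $d_{ij}$ between sensors $i$ and $j$ is specified. $P=[p_1,\dots,p_n]\in\mathbb{R}^{d\times n}$ is a position matrix of the sensors satisfying $\|\bar p_k-p_j\|=\bar d_{kj}$ for all $(k,j)\in N_a$ and $\|p_i-p_j\|=d_{ij}$ for all $(i,j)\in N_x$. The vertices of $G$ are the $m$ anchors and $n$ sensors; its sensor–sensor edges are given by $N_x$ and its anchor–sensor edges by $N_a$; edges between anchors (whose mutual distances are known) are also allowed. General position in $\mathbb{R}^d$: no $d+1$ of the $m+n$ points $\bar p_1,\dots,\bar p_m,p_1,\dots,p_n$ are affinely dependent. A graph on $N$ vertices is a $(d+1)$-lateration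 graph if there is a permutation $\pi$ of the vertices (the lateration ordering) such that $\pi(1),\dots,\pi(d+1)$ form a clique, and each remaining vertex $\pi(j)$, $j=d+2,\dots,N$, is adjacent to $d+1$ vertices in $\{\pi(1),\dots,\pi(j-1)\}$. Notation: $(u;v)\in\mathbb{R}^{d+n}$ is the vertical concatenation of $u\in\mathbb{R}^d$ and $v\in\mathbb{R}^n$; $e_j\in\mathbb{R}^n$ is the $j$th standard basis vector; $R\cdot Q=\mathrm{Trace}(R^TQ)$; $\succeq 0$ means symmetric positive semidefinite; $I_d$ is the identity matrix. Primal SDP: find $Z\in\mathbb{R}^{(d+n)\times(d+n)}$, $Z\succeq 0$ (maximizing $0\cdot Z$), such that the top-left $d\times d$ block of $Z$ is $I_d$, $(0;e_i-e_j)(0;e_i-e_j)^T\cdot Z=d_{ij}^2$ for all $(i,j)\in N_x$, and $(-\bar p_k;e_j)(-\bar p_k;e_j)^T\cdot Z=\bar d_{kj}^2$ for all $(k,j)\in N_a$. Dual SDP: over symmetric $V\in\mathbb{R}^{d\times d}$ and real variables $w_{ij}$ ($(i,j)\in N_x$), $\bar w_{kj}$ ($(k,j)\in N_a$), minimize $I_d\cdot V+\sum_{(i,j)\in N_x}w_{ij}d_{ij}^2+\sum_{(k,j)\in N_a}\bar w_{kj}\bar d_{kj}^2$ subject to $$S:=\begin{pmatrix}V&0\\0&0\end{pmatrix}+\sum_{(i,j)\in N_x}w_{ij}(0;e_i-e_j)(0;e_i-e_j)^T+\sum_{(k,j)\in N_a}\bar w_{kj}(-\bar p_k;e_j)(-\bar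 p_k;e_j)^T\succeq 0 .$$ The matrix $S$ of an optimal dual solution is called an optimal dual stress matrix. Let $Z=\begin{pmatrix}I_d&P\\P^T&P^TP\end{pmatrix}$. The network is strongly localizable if there is an optimal dual stress matrix $S$ such that $ZS=0$, $S\succeq 0$ and $\mathrm{rank}(S)=n$. "Computed exactly" refers to counting real arithmetic operations. *)

theory Defs
  imports "Jordan_Normal_Form.Matrix" "Jordan_Normal_Form.DL_Rank"
begin

section \<open>Sensor networks\<close>

text \<open>Anchors and sensors are numbered from 0. Values of \<open>sensor_dist\<close> and \<open>anchor_dist\<close> matter only
  on \<open>sensor_pairs\<close> and \<open>anchor_sensor_pairs\<close> respectively.\<close>

record network =
  space_dim :: nat
  num_anchors :: nat
  num_sensors :: nat
  sensor_pairs :: "(nat \<times> nat) set"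
  anchor_sensor_pairs :: "(nat \<times> nat) set"
  anchor_pairs :: "(nat \<times> nat) set"
  sensor_dist :: "nat \<Rightarrow> nat \<Rightarrow> real"
  anchor_dist :: "nat \<Rightarrow> nat \<Rightarrow> real"
  anchor_pos :: "real mat"
  sensor_pos :: "real mat"

definition eucl_norm :: "real vec \<Rightarrow> real" where
  "eucl_norm v = sqrt (v \<bullet> v)"

definition sensor_network :: "network \<Rightarrow> bool" where
  "sensor_network N \<longleftrightarrow>
     (let d = space_dim N; m = num_anchors N; n = num_sensors N in
       sensor_pairs N \<subseteq> {(i, j). i < j \<and> j < n} \<and>
       anchor_sensor_pairs N \<subseteq> {..<m} \<times> {..<n} \<and>
       anchor_pairs N \<subseteq> {(k, l). k < l \<and> l < m} \<and>
       anchor_pos N \<in> carrier_mat d m \<and>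
       sensor_pos N \<in> carrier_mat d n \<and>
       (\<forall>(k, j)\<in>anchor_sensor_pairs N.
          eucl_norm (col (anchor_pos N) k - col (sensor_pos N) j) = anchor_dist N k j) \<and>
       (\<forall>(i, j)\<in>sensor_pairs N.
          eucl_norm (col (sensor_pos N) i - col (sensor_pos N) j) = sensor_dist N i j))"

text \<open>The vertices of the graph are the numbers below \<open>num_anchors N + num_sensors N\<close>: vertex
  \<open>k < num_anchors N\<close> is anchor \<open>k\<close>, and vertex \<open>num_anchors N + j\<close> is sensor \<open>j\<close>.\<close>

abbreviation num_points :: "network \<Rightarrow> nat" where
  "num_points N \<equiv> num_anchors N + num_sensors N"

definition edges :: "network \<Rightarrow> nat set set" where
  "edges N =
     {{num_anchors N + i, num_anchors N + j} | i j. (i, j) \<in> sensor_pairs N} \<union>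
     {{k, num_anchors N + j} | k j. (k, j) \<in> anchor_sensor_pairs N} \<union>
     {{k, l} | k l. (k, l) \<in> anchor_pairs N}"

definition point :: "network \<Rightarrow> nat \<Rightarrow> real vec" where
  "point N v = (if v < num_anchors N then col (anchor_pos N) v
                else col (sensor_pos N) (v - num_anchors N))"

text \<open>Affine dependence of an indexed family, so coinciding points count as dependent.\<close>

definition affinely_dependent :: "nat \<Rightarrow> (nat \<Rightarrow> real vec) \<Rightarrow> nat set \<Rightarrow> bool" where
  "affinely_dependent d x I \<longleftrightarrow>
     (\<exists>c. (\<exists>i\<in>I. c i \<noteq> 0) \<and> (\<Sum>i\<in>I. c i) = 0 \<and> (\<forall>a<d. (\<Sum>i\<in>I. c i * x i $ a) = 0))"

definition general_position :: "network \<Rightarrow> bool" where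
  "general_position N \<longleftrightarrow>
     (\<forall>I \<subseteq> {..<num_points N}. card I = space_dim N + 1 \<longrightarrow>
        \<not> affinely_dependent (space_dim N) (point N) I)"

text \<open>Here \<open>r\<close> is the number of required neighbours, \<open>M\<close> the number of vertices and \<open>E\<close> the set of
  edges; positions in the ordering start at 0.\<close>

definition lateration_ordering :: "nat \<Rightarrow> nat \<Rightarrow> nat set set \<Rightarrow> (nat \<Rightarrow> nat) \<Rightarrow> bool" where
  "lateration_ordering r M E \<pi> \<longleftrightarrow>
     bij_betw \<pi> {..<M} {..<M} \<and>
     (\<forall>i<r. \<forall>j<r. i \<noteq> j \<longrightarrow> {\<pi> i, \<pi> j} \<in> E) \<and>
     (\<forall>j\<in>{r..<M}. r \<le> card {i. i < j \<and> {\<pi> i, \<pi> j} \<in> E})"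

definition lateration_graph :: "nat \<Rightarrow> nat \<Rightarrow> nat set set \<Rightarrow> bool" where
  "lateration_graph r M E \<longleftrightarrow> (\<exists>\<pi>. lateration_ordering r M E \<pi>)"


section \<open>The dual semidefinite program and strong localizability\<close>

definition psd :: "real mat \<Rightarrow> bool" where
  "psd A \<longleftrightarrow> square_mat A \<and> transpose_mat A = A \<and>
     (\<forall>x\<in>carrier_vec (dim_row A). 0 \<le> x \<bullet> (A *\<^sub>v x))"

definition trace_mat :: "real mat \<Rightarrow> real" where
  "trace_mat A = (\<Sum>i<dim_row A. A $$ (i, i))"

definition inner_mat :: "real mat \<Rightarrow> real mat \<Rightarrow> real" where
  "inner_mat R Q = trace_mat (transpose_mat R * Q)"

definition outer_self :: "real vec \<Rightarrow> real mat" where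
  "outer_self u = mat (dim_vec u) (dim_vec u) (\<lambda>(a, b). u $ a * u $ b)"

definition sensor_edge_vec :: "network \<Rightarrow> nat \<Rightarrow> nat \<Rightarrow> real vec" where
  "sensor_edge_vec N i j =
     0\<^sub>v (space_dim N) @\<^sub>v (unit_vec (num_sensors N) i - unit_vec (num_sensors N) j)"

definition anchor_edge_vec :: "network \<Rightarrow> nat \<Rightarrow> nat \<Rightarrow> real vec" where
  "anchor_edge_vec N k j = (- col (anchor_pos N) k) @\<^sub>v unit_vec (num_sensors N) j"

definition dual_matrix ::
  "network \<Rightarrow> real mat \<Rightarrow> (nat \<Rightarrow> nat \<Rightarrow> real) \<Rightarrow> (nat \<Rightarrow> nat \<Rightarrow> real) \<Rightarrow> real mat" where
  "dual_matrix N V w w' =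
     (let d = space_dim N; n = num_sensors N in
       mat (d + n) (d + n) (\<lambda>ab.
         four_block_mat V (0\<^sub>m d n) (0\<^sub>m n d) (0\<^sub>m n n) $$ ab +
         (\<Sum>(i, j)\<in>sensor_pairs N. w i j * outer_self (sensor_edge_vec N i j) $$ ab) +
         (\<Sum>(k, j)\<in>anchor_sensor_pairs N. w' k j * outer_self (anchor_edge_vec N k j) $$ ab)))"

definition dual_feasible ::
  "network \<Rightarrow> real mat \<Rightarrow> (nat \<Rightarrow> nat \<Rightarrow> real) \<Rightarrow> (nat \<Rightarrow> nat \<Rightarrow> real) \<Rightarrow> bool" where
  "dual_feasible N V w w' \<longleftrightarrow>
     V \<in> carrier_mat (space_dim N) (space_dim N) \<and> transpose_mat V = V \<and>
     psd (dual_matrix N V w w')"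

definition dual_objective ::
  "network \<Rightarrow> real mat \<Rightarrow> (nat \<Rightarrow> nat \<Rightarrow> real) \<Rightarrow> (nat \<Rightarrow> nat \<Rightarrow> real) \<Rightarrow> real" where
  "dual_objective N V w w' =
     inner_mat (1\<^sub>m (space_dim N)) V +
     (\<Sum>(i, j)\<in>sensor_pairs N. w i j * (sensor_dist N i j)\<^sup>2) +
     (\<Sum>(k, j)\<in>anchor_sensor_pairs N. w' k j * (anchor_dist N k j)\<^sup>2)"

definition dual_optimal ::
  "network \<Rightarrow> real mat \<Rightarrow> (nat \<Rightarrow> nat \<Rightarrow> real) \<Rightarrow> (nat \<Rightarrow> nat \<Rightarrow> real) \<Rightarrow> bool" where
  "dual_optimal N V w w' \<longleftrightarrow> dual_feasible N V w w' \<and>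
     (\<forall>V' u u'. dual_feasible N V' u u' \<longrightarrow> dual_objective N V w w' \<le> dual_objective N V' u u')"

definition optimal_dual_stress :: "network \<Rightarrow> real mat \<Rightarrow> bool" where
  "optimal_dual_stress N S \<longleftrightarrow> (\<exists>V w w'. dual_optimal N V w w' \<and> S = dual_matrix N V w w')"

definition position_gram :: "network \<Rightarrow> real mat" where
  "position_gram N =
     (let P = sensor_pos N in
       four_block_mat (1\<^sub>m (space_dim N)) P (transpose_mat P) (transpose_mat P * P))"

abbreviation stress_rank :: "network \<Rightarrow> real mat \<Rightarrow> nat" where
  "stress_rank N S \<equiv> vec_space.rank (space_dim N + num_sensors N) S"

definition strongly_localizable :: "network \<Rightarrow> bool" where
  "strongly_localizable N \<longleftrightarrow>
     (\<exists>S. optimal_dual_stress N S \<and>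
        position_gram N * S =
          0\<^sub>m (space_dim N + num_sensors N) (space_dim N + num_sensors N) \<and>
        psd S \<and> stress_rank N S = num_sensors N)"


section \<open>A real random access machine with cost counters\<close>

text \<open>
  Algorithms are programs of a deeply embedded imperative language, so that one finite program must
  serve all inputs. The memory consists of named two-dimensional arrays of natural numbers (for
  indices and combinatorial data) and of real numbers; a scalar is the cell with both indices 0.
  Information passes from the reals to the naturals only through comparisons, and real constants
  are restricted to integers. Every loop is bounded, so all programs terminate.

  Two counters are kept, which programs cannot read. The counter \<open>arith_ops\<close> counts the exact
  arithmetic operations on reals together with the comparisons of reals. The counter \<open>steps\<close>
  counts all elementary work, including index arithmetic, memory accesses, tests and loop control.

  Division by zero yields 0, which adds no power because a zero test is available anyway.
  Multiplication of naturals is left out deliberately: with additions only, a natural number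
  computed in polynomially many steps from the input has polynomially many bits.
\<close>

type_synonym name = string

record state =
  nat_mem :: "name \<Rightarrow> nat \<Rightarrow> nat \<Rightarrow> nat"
  real_mem :: "name \<Rightarrow> nat \<Rightarrow> nat \<Rightarrow> real"
  arith_ops :: nat
  steps :: nat

datatype nexp =
    NConst nat
  | NCell name nexp nexp
  | NAdd nexp nexp
  | NSub nexp nexp

datatype rexp =
    RConst int
  | RCell name nexp nexp
  | RAdd rexp rexp
  | RSub rexp rexp
  | RMul rexp rexp
  | RDiv rexp rexp

datatype com =
    Skip
  | NAssign name nexp nexp nexp
  | RAssign name nexp nexp rexp
  | Seq com com
  | IfNLess nexp nexp com com
  | IfRLess rexp rexp com com
  | For name nexp com

primrec nval :: "nexp \<Rightarrow> state \<Rightarrow> nat" where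
  "nval (NConst c) s = c"
| "nval (NCell x e f) s = nat_mem s x (nval e s) (nval f s)"
| "nval (NAdd e f) s = nval e s + nval f s"
| "nval (NSub e f) s = nval e s - nval f s"

primrec rval :: "rexp \<Rightarrow> state \<Rightarrow> real" where
  "rval (RConst c) s = of_int c"
| "rval (RCell x e f) s = real_mem s x (nval e s) (nval f s)"
| "rval (RAdd a b) s = rval a s + rval b s"
| "rval (RSub a b) s = rval a s - rval b s"
| "rval (RMul a b) s = rval a s * rval b s"
| "rval (RDiv a b) s = rval a s / rval b s"

primrec nexp_steps :: "nexp \<Rightarrow> nat" where
  "nexp_steps (NConst c) = 1"
| "nexp_steps (NCell x e f) = 1 + nexp_steps e + nexp_steps f"
| "nexp_steps (NAdd e f) = 1 + nexp_steps e + nexp_steps f"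
| "nexp_steps (NSub e f) = 1 + nexp_steps e + nexp_steps f"

primrec rexp_steps :: "rexp \<Rightarrow> nat" where
  "rexp_steps (RConst c) = 1"
| "rexp_steps (RCell x e f) = 1 + nexp_steps e + nexp_steps f"
| "rexp_steps (RAdd a b) = 1 + rexp_steps a + rexp_steps b"
| "rexp_steps (RSub a b) = 1 + rexp_steps a + rexp_steps b"
| "rexp_steps (RMul a b) = 1 + rexp_steps a + rexp_steps b"
| "rexp_steps (RDiv a b) = 1 + rexp_steps a + rexp_steps b"

primrec rexp_ops :: "rexp \<Rightarrow> nat" where
  "rexp_ops (RConst c) = 0"
| "rexp_ops (RCell x e f) = 0"
| "rexp_ops (RAdd a b) = 1 + rexp_ops a + rexp_ops b"
| "rexp_ops (RSub a b) = 1 + rexp_ops a + rexp_ops b"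
| "rexp_ops (RMul a b) = 1 + rexp_ops a + rexp_ops b"
| "rexp_ops (RDiv a b) = 1 + rexp_ops a + rexp_ops b"

definition charge :: "nat \<Rightarrow> nat \<Rightarrow> state \<Rightarrow> state" where
  "charge a t s = s\<lparr>arith_ops := arith_ops s + a, steps := steps s + t\<rparr>"

definition upd :: "(name \<Rightarrow> nat \<Rightarrow> nat \<Rightarrow> 'a) \<Rightarrow> name \<Rightarrow> nat \<Rightarrow> nat \<Rightarrow> 'a \<Rightarrow> name \<Rightarrow> nat \<Rightarrow> nat \<Rightarrow> 'a"
  where "upd M x i j v = M(x := (M x)(i := (M x i)(j := v)))"

definition set_nat :: "name \<Rightarrow> nat \<Rightarrow> nat \<Rightarrow> nat \<Rightarrow> state \<Rightarrow> state" where
  "set_nat x i j v s = s\<lparr>nat_mem := upd (nat_mem s) x i j v\<rparr>"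

definition set_real :: "name \<Rightarrow> nat \<Rightarrow> nat \<Rightarrow> real \<Rightarrow> state \<Rightarrow> state" where
  "set_real x i j v s = s\<lparr>real_mem := upd (real_mem s) x i j v\<rparr>"

text \<open>The bound of a \<open>For\<close> loop is evaluated once, before the first iteration; the loop counter is
  the scalar \<open>x\<close>.\<close>

primrec exec :: "com \<Rightarrow> state \<Rightarrow> state" where
  "exec Skip s = charge 0 1 s"
| "exec (NAssign x e f g) s =
     charge 0 (1 + nexp_steps e + nexp_steps f + nexp_steps g)
       (set_nat x (nval e s) (nval f s) (nval g s) s)"
| "exec (RAssign x e f a) s =
     charge (rexp_ops a) (1 + nexp_steps e + nexp_steps f + rexp_steps a)
       (set_real x (nval e s) (nval f s) (rval a s) s)"
| "exec (Seq c1 c2) s = exec c2 (exec c1 s)"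
| "exec (IfNLess e f c1 c2) s =
     (if nval e s < nval f s then exec c1 else exec c2)
       (charge 0 (1 + nexp_steps e + nexp_steps f) s)"
| "exec (IfRLess a b c1 c2) s =
     (if rval a s < rval b s then exec c1 else exec c2)
       (charge (1 + rexp_ops a + rexp_ops b) (1 + rexp_steps a + rexp_steps b) s)"
| "exec (For x e c) s =
     fold (\<lambda>i s'. exec c (charge 0 1 (set_nat x 0 0 i s'))) [0..<nval e s]
       (charge 0 (1 + nexp_steps e) s)"


section \<open>Input and output of the stress matrix algorithm\<close>

text \<open>The input consists of the three sizes, the adjacency matrix of the graph, the lateration
  ordering and the coordinates of the anchors and sensors; all other cells are 0. The distances are
  not supplied, since they are determined by the positions.\<close>

definition initial_state :: "network \<Rightarrow> (nat \<Rightarrow> nat) \<Rightarrow> state" where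
  "initial_state N \<pi> =
     (let d = space_dim N; m = num_anchors N; n = num_sensors N in
       \<lparr>nat_mem = (\<lambda>x i j.
          if x = ''d'' \<and> i = 0 \<and> j = 0 then d
          else if x = ''m'' \<and> i = 0 \<and> j = 0 then m
          else if x = ''n'' \<and> i = 0 \<and> j = 0 then n
          else if x = ''adj'' \<and> i < m + n \<and> j < m + n then of_bool ({i, j} \<in> edges N)
          else if x = ''ord'' \<and> i < m + n \<and> j = 0 then \<pi> i
          else 0),
        real_mem = (\<lambda>x i j.
          if x = ''Pbar'' \<and> i < d \<and> j < m then anchor_pos N $$ (i, j)
          else if x = ''P'' \<and> i < d \<and> j < n then sensor_pos N $$ (i, j)
          else 0),
        arith_ops = 0,
        steps = 0\<rparr>)"

definition output_matrix :: "network \<Rightarrow> state \<Rightarrow> real mat" where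
  "output_matrix N s =
     mat (space_dim N + num_sensors N) (space_dim N + num_sensors N) (\<lambda>(a, b). real_mem s ''S'' a b)"

end

theory Submission
  imports Defs
begin

text \<open>
  A symmetric matrix \<open>W\<close> indexed by the sensors yields the matrix \<open>S = L W L\<^sup>T\<close> with
  \<open>L = (-P; I)\<close>. It has the form required in the dual problem as soon as \<open>W\<close> vanishes at pairs of
  distinct non-adjacent sensors and, for every sensor \<open>j\<close>, the sum over \<open>i\<close> of \<open>W i j\<close> times the
  extended point \<open>(p_i; 1)\<close> is a linear combination of the extended positions of anchors adjacent
  to \<open>j\<close>: the coefficients serve as weights of the anchor edges, and \<open>V\<close> absorbs what is left in the
  upper left block (\<open>stress_mat_dual\<close>). Since \<open>[I P] L = 0\<close>, we get \<open>Z S = 0\<close>. The dual objective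
  of a feasible matrix is the sum of its quadratic form over the rows of \<open>[I P]\<close>, hence
  nonnegative, and it is zero for \<open>S\<close> (\<open>weak_duality\<close>, \<open>stress_mat_optimal\<close>). If \<open>W\<close> is positive
  definite, then \<open>S\<close> is positive semidefinite of rank \<open>n\<close> (\<open>stress_mat_rank\<close>). What remains is to find
  a positive definite \<open>W\<close> of this kind.

  The basis consists of the first \<open>d + 1\<close> anchors in the lateration ordering, and the active vertices
  \<open>act 0, ..., act (n + d)\<close> are the sensors and the basis, in this ordering. The first
  \<open>d + 1\<close> of them form a clique. For \<open>l = n + d, ..., d + 1\<close>, in this order, a vector \<open>s_l\<close> is
  computed that is an affine dependency of the points of the active vertices up to \<open>act l\<close> and has
  the value 1 at \<open>act l\<close>. Its value at an earlier non-neighbour \<open>u\<close> is chosen to cancel the entry at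
  \<open>(u, act l)\<close> of the sum of the products \<open>s_k s_k\<^sup>T\<close> over \<open>k > l\<close>, and its values at \<open>d + 1\<close> earlier
  neighbours then follow from a linear system, which is nonsingular by general position. The vectors
  that come afterwards vanish at \<open>act l\<close>, so the cancellation is final, and the sensor block
  \<open>W\<close> of the sum of all \<open>s_l s_l\<^sup>T\<close> vanishes at distinct non-adjacent sensors. A neighbour that is
  not active is an anchor; it is replaced by its affine representation in the basis. This respects
  the triangular support, because the whole basis precedes such an anchor, and it does no harm to
  the condition on anchors, because only the total effect of the anchors on a sensor matters
  (\<open>step_data_stress_step\<close>, \<open>stress_anchor_weights\<close>).

  To see that \<open>W\<close> is definite, let \<open>x\<close> be a vector on the sensors that is orthogonal to all \<open>s_l\<close>
  when extended by 0 to the basis. By triangularity the extension is the restriction of an affine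
  function, which vanishes at the \<open>d + 1\<close> basis points and is therefore zero (\<open>affine_zero\<close>).

  There are \<open>n\<close> vectors, and each costs \<open>O((n + d)\<^sup>2 + d\<^sup>3)\<close> arithmetic operations, independently of the
  number of anchors, because inactive anchors never enter the sum of the products. The linear systems
  are solved by successive projections (\<open>projector_step\<close>), which needs no search for pivots. All
  loops of the program run up to expressions in the input sizes, so both cost counters are bounded
  by recursion on the program text (\<open>counters_bounded\<close>).
\<close>

section \<open>Memory, frames and loops\<close>

declare exec.simps(7) [simp del]

lemma mem_charge [simp]:
  "nat_mem (charge a t s) = nat_mem s" "real_mem (charge a t s) = real_mem s"
  "arith_ops (charge a t s) = arith_ops s + a" "steps (charge a t s) = steps s + t"
  by (simp_all add: charge_def)

lemma mem_set_nat [simp]: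
  "nat_mem (set_nat x i j v s) = upd (nat_mem s) x i j v" "real_mem (set_nat x i j v s) = real_mem s"
  "arith_ops (set_nat x i j v s) = arith_ops s" "steps (set_nat x i j v s) = steps s"
  by (simp_all add: set_nat_def)

lemma mem_set_real [simp]:
  "real_mem (set_real x i j v s) = upd (real_mem s) x i j v" "nat_mem (set_real x i j v s) = nat_mem s"
  "arith_ops (set_real x i j v s) = arith_ops s" "steps (set_real x i j v s) = steps s"
  by (simp_all add: set_real_def)

lemma upd_apply [simp]: "upd M x i j v y k l = (if y = x \<and> k = i \<and> l = j then v else M y k l)"
  by (auto simp: upd_def)

lemma upd_other [simp]: "y \<noteq> x \<Longrightarrow> upd M x i j v y = M y"
  by (auto simp: upd_def)

lemma upd_id: "upd M x i j (M x i j) = M"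
  by (auto simp: upd_def)

lemma upd_upd: "upd (upd M x i j v) x i j w = upd M x i j w"
  by (auto simp: upd_def)

text \<open>
  What a program leaves untouched is read off its text: side conditions become statements that two
  array names differ, which the simplifier decides.
\<close>

primrec nat_writes :: "com \<Rightarrow> name set" where
  "nat_writes Skip = {}"
| "nat_writes (NAssign x e f g) = {x}"
| "nat_writes (RAssign x e f a) = {}"
| "nat_writes (Seq c1 c2) = nat_writes c1 \<union> nat_writes c2"
| "nat_writes (IfNLess e f c1 c2) = nat_writes c1 \<union> nat_writes c2"
| "nat_writes (IfRLess a b c1 c2) = nat_writes c1 \<union> nat_writes c2"
| "nat_writes (For x e c) = insert x (nat_writes c)"

primrec real_writes :: "com \<Rightarrow> name set" where
  "real_writes Skip = {}"
| "real_writes (NAssign x e f g) = {}"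
| "real_writes (RAssign x e f a) = {x}"
| "real_writes (Seq c1 c2) = real_writes c1 \<union> real_writes c2"
| "real_writes (IfNLess e f c1 c2) = real_writes c1 \<union> real_writes c2"
| "real_writes (IfRLess a b c1 c2) = real_writes c1 \<union> real_writes c2"
| "real_writes (For x e c) = real_writes c"

abbreviation frame :: "name set \<Rightarrow> name set \<Rightarrow> state \<Rightarrow> state \<Rightarrow> bool" where
  "frame A B s t \<equiv> (\<forall>y. y \<notin> A \<longrightarrow> nat_mem t y = nat_mem s y) \<and>
                   (\<forall>y. y \<notin> B \<longrightarrow> real_mem t y = real_mem s y)"

text \<open>A variant of the fold in the semantics of loops from which the last pass can be split off.\<close>

definition iterate :: "name \<Rightarrow> com \<Rightarrow> nat \<Rightarrow> state \<Rightarrow> state" where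
  "iterate x c k = fold (\<lambda>i s. exec c (charge 0 1 (set_nat x 0 0 i s))) [0..<k]"

lemma iterate_0 [simp]: "iterate x c 0 s = s"
  and iterate_Suc: "iterate x c (Suc k) s =
    exec c (charge 0 1 (set_nat x 0 0 k (iterate x c k s)))"
  by (simp_all add: iterate_def)

lemma exec_For: "exec (For x e c) s = iterate x c (nval e s) (charge 0 (1 + nexp_steps e) s)"
  by (simp add: iterate_def exec.simps(7))

lemma iterate_rule:
  assumes "I 0 s"
    and "\<And>i t. i < k \<Longrightarrow> I i t \<Longrightarrow> I (Suc i) (exec c (charge 0 1 (set_nat x 0 0 i t)))"
  shows "I k (iterate x c k s)"
proof -
  have "I j (iterate x c j s)" if "j \<le> k" for j
    using that by (induction j) (auto simp: iterate_Suc simp del: One_nat_def intro!: assms)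
  then show ?thesis by simp
qed

lemma exec_frame: "frame (nat_writes c) (real_writes c) s (exec c s)"
proof (induction c arbitrary: s)
  case (For x e c)
  show ?case unfolding exec_For
    by (rule iterate_rule[where I = "\<lambda>_. frame (nat_writes (For x e c)) (real_writes (For x e c)) s"])
      (use For in \<open>auto\<close>)
qed auto

lemma nat_mem_exec: "y \<notin> nat_writes c \<Longrightarrow> nat_mem (exec c s) y = nat_mem s y"
  and real_mem_exec: "y \<notin> real_writes c \<Longrightarrow> real_mem (exec c s) y = real_mem s y"
  using exec_frame by blast+

text \<open>
  The invariant speaks about the memories only, so the cost counters need not be mentioned. It
  must not depend on the loop counter, which is overwritten before each pass. The frame tells a
  pass everything about the arrays that the loop does not assign.
\<close>

lemma For_rule:
  assumes init: "I 0 (nat_mem s) (real_mem s)"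
    and indep: "\<And>i v M R. I i M R \<Longrightarrow> I i (upd M x 0 0 v) R"
    and step: "\<And>i t. \<lbrakk>i < nval e s; I i (nat_mem t) (real_mem t); nat_mem t x 0 0 = i;
        frame (nat_writes (For x e c)) (real_writes c) s t\<rbrakk>
       \<Longrightarrow> I (Suc i) (nat_mem (exec c t)) (real_mem (exec c t))"
  shows "I (nval e s) (nat_mem (exec (For x e c) s)) (real_mem (exec (For x e c) s))"
proof -
  let ?F = "frame (nat_writes (For x e c)) (real_writes c) s"
  have "I (nval e s) (nat_mem (iterate x c (nval e s) (charge 0 (1 + nexp_steps e) s)))
          (real_mem (iterate x c (nval e s) (charge 0 (1 + nexp_steps e) s)))
        \<and> ?F (iterate x c (nval e s) (charge 0 (1 + nexp_steps e) s))"
  proof (rule iterate_rule[where I = "\<lambda>i t. I i (nat_mem t) (real_mem t) \<and> ?F t"])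
    fix i and t :: state assume i: "i < nval e s" and t: "I i (nat_mem t) (real_mem t) \<and> ?F t"
    let ?t = "charge 0 1 (set_nat x 0 0 i t)"
    have f: "?F ?t" using t by auto
    have "I (Suc i) (nat_mem (exec c ?t)) (real_mem (exec c ?t))"
      by (rule step) (use i t f indep in auto)
    moreover have "?F (exec c ?t)"
      using f exec_frame[of c ?t] by auto
    ultimately show "I (Suc i) (nat_mem (exec c ?t)) (real_mem (exec c ?t)) \<and> ?F (exec c ?t)"
      by blast
  qed (use init in auto)
  then show ?thesis unfolding exec_For by blast
qed

lemma For_rule_real:
  assumes "I 0 (real_mem s)"
    and "\<And>i t. \<lbrakk>i < nval e s; I i (real_mem t); nat_mem t x 0 0 = i;
        frame (nat_writes (For x e c)) (real_writes c) s t\<rbrakk> \<Longrightarrow> I (Suc i) (real_mem (exec c t))"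
  shows "I (nval e s) (real_mem (exec (For x e c) s))"
proof (rule For_rule[where I = "\<lambda>i _ R. I i R"])
  show "I 0 (real_mem s)" by (rule assms(1))
next
  fix i and t :: state
  assume "i < nval e s" "I i (real_mem t)" "nat_mem t x 0 0 = i"
    "frame (nat_writes (For x e c)) (real_writes c) s t"
  then show "I (Suc i) (real_mem (exec c t))" by (rule assms(2))
qed

section \<open>Accumulation loops\<close>

primrec nexp_reads :: "nexp \<Rightarrow> name set" where
  "nexp_reads (NConst c) = {}"
| "nexp_reads (NCell x e f) = {x} \<union> nexp_reads e \<union> nexp_reads f"
| "nexp_reads (NAdd e f) = nexp_reads e \<union> nexp_reads f"
| "nexp_reads (NSub e f) = nexp_reads e \<union> nexp_reads f"

primrec rexp_reads :: "rexp \<Rightarrow> name set" where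
  "rexp_reads (RConst c) = {}"
| "rexp_reads (RCell x e f) = {x}"
| "rexp_reads (RAdd a b) = rexp_reads a \<union> rexp_reads b"
| "rexp_reads (RSub a b) = rexp_reads a \<union> rexp_reads b"
| "rexp_reads (RMul a b) = rexp_reads a \<union> rexp_reads b"
| "rexp_reads (RDiv a b) = rexp_reads a \<union> rexp_reads b"

lemma nval_cong: "(\<And>y. y \<in> nexp_reads e \<Longrightarrow> nat_mem s y = nat_mem t y) \<Longrightarrow> nval e s = nval e t"
  by (induction e) auto

lemma rval_cong:
  "nat_mem s = nat_mem t \<Longrightarrow> (\<And>y. y \<in> rexp_reads a \<Longrightarrow> real_mem s y = real_mem t y)
   \<Longrightarrow> rval a s = rval a t"
proof (induction a)
  case (RCell x e f)
  then show ?case using nval_cong[of e s t] nval_cong[of f s t] by auto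
qed auto

text \<open>
  An accumulation loop has a closed form: the summand does not read the accumulator, so each pass
  may as well evaluate it in the state before the loop, with the counter set.
\<close>

lemma exec_sum:
  assumes "x \<notin> nexp_reads e" "x \<notin> nexp_reads f" "y \<notin> rexp_reads a"
  shows "real_mem (exec (For x b (RAssign y e f (RAdd (RCell y e f) a))) s) =
    upd (real_mem s) y (nval e s) (nval f s)
      (real_mem s y (nval e s) (nval f s) + (\<Sum>i<nval b s. rval a (set_nat x 0 0 i s)))"
proof -
  let ?c = "RAssign y e f (RAdd (RCell y e f) a)"
  let ?R = "\<lambda>i. upd (real_mem s) y (nval e s) (nval f s)
      (real_mem s y (nval e s) (nval f s) + (\<Sum>i<i. rval a (set_nat x 0 0 i s)))"
  have "real_mem (exec (For x b ?c) s) = ?R (nval b s) \<and>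
     (\<exists>v. nat_mem (exec (For x b ?c) s) = upd (nat_mem s) x 0 0 v)"
  proof (rule For_rule[where I = "\<lambda>i M R. R = ?R i \<and> (\<exists>v. M = upd (nat_mem s) x 0 0 v)"])
    fix i and t :: state assume i: "i < nval b s" and
      t: "real_mem t = ?R i \<and> (\<exists>v. nat_mem t = upd (nat_mem s) x 0 0 v)"
      "nat_mem t x 0 0 = i"
    then have n: "nat_mem t = upd (nat_mem s) x 0 0 i" by auto
    have e: "nval e t = nval e s" "nval f t = nval f s"
      by (rule nval_cong, use n assms in force)+
    have a: "rval a t = rval a (set_nat x 0 0 i s)"
    proof (rule rval_cong)
      fix z assume "z \<in> rexp_reads a"
      then have "z \<noteq> y" using assms by auto
      then show "real_mem t z = real_mem (set_nat x 0 0 i s) z" using t by simp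
    qed (simp add: n)
    show "real_mem (exec ?c t) = ?R (Suc i) \<and> (\<exists>v. nat_mem (exec ?c t) = upd (nat_mem s) x 0 0 v)"
      using t n by (auto simp: e a upd_def algebra_simps)
  next
    show "real_mem s = ?R 0 \<and> (\<exists>v. nat_mem s = upd (nat_mem s) x 0 0 v)"
      using upd_id[of "nat_mem s" x 0 0] upd_id[of "real_mem s"] by (metis lessThan_0 sum.empty add_0_right)
  next
    fix i v M R
    assume "R = ?R i \<and> (\<exists>v. M = upd (nat_mem s) x 0 0 v)"
    then show "R = ?R i \<and> (\<exists>w. upd M x 0 0 v = upd (nat_mem s) x 0 0 w)"
      by (auto simp: upd_upd)
  qed
  then show ?thesis by blast
qed

section \<open>Cost of programs with static loop bounds\<close>

primrec static_bound :: "nexp \<Rightarrow> bool" where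
  "static_bound (NConst c) = True"
| "static_bound (NCell x e f) = (x \<in> {''d'', ''m'', ''n''} \<and> e = NConst 0 \<and> f = NConst 0)"
| "static_bound (NAdd e f) = (static_bound e \<and> static_bound f)"
| "static_bound (NSub e f) = (static_bound e \<and> static_bound f)"

text \<open>
  The input sizes are never assigned and every loop runs up to an expression in them, so the number
  of passes of a loop is the same wherever and whenever it is executed.
\<close>

primrec static :: "com \<Rightarrow> bool" where
  "static Skip = True"
| "static (NAssign x e f g) = (x \<notin> {''d'', ''m'', ''n''})"
| "static (RAssign x e f a) = True"
| "static (Seq c1 c2) = (static c1 \<and> static c2)"
| "static (IfNLess e f c1 c2) = (static c1 \<and> static c2)"
| "static (IfRLess a b c1 c2) = (static c1 \<and> static c2)"
| "static (For x e c) = (x \<notin> {''d'', ''m'', ''n''} \<and> static_bound e \<and> static c)"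

text \<open>Both branches of a test are charged; this costs a constant factor at most and avoids maxima.\<close>

primrec ops_bound :: "com \<Rightarrow> state \<Rightarrow> nat" where
  "ops_bound Skip s = 0"
| "ops_bound (NAssign x e f g) s = 0"
| "ops_bound (RAssign x e f a) s = rexp_ops a"
| "ops_bound (Seq c1 c2) s = ops_bound c1 s + ops_bound c2 s"
| "ops_bound (IfNLess e f c1 c2) s = ops_bound c1 s + ops_bound c2 s"
| "ops_bound (IfRLess a b c1 c2) s =
     1 + rexp_ops a + rexp_ops b + ops_bound c1 s + ops_bound c2 s"
| "ops_bound (For x e c) s = nval e s * ops_bound c s"

primrec steps_bound :: "com \<Rightarrow> state \<Rightarrow> nat" where
  "steps_bound Skip s = 1"
| "steps_bound (NAssign x e f g) s = 1 + nexp_steps e + nexp_steps f + nexp_steps g"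
| "steps_bound (RAssign x e f a) s = 1 + nexp_steps e + nexp_steps f + rexp_steps a"
| "steps_bound (Seq c1 c2) s = steps_bound c1 s + steps_bound c2 s"
| "steps_bound (IfNLess e f c1 c2) s =
     1 + nexp_steps e + nexp_steps f + steps_bound c1 s + steps_bound c2 s"
| "steps_bound (IfRLess a b c1 c2) s =
     1 + rexp_steps a + rexp_steps b + steps_bound c1 s + steps_bound c2 s"
| "steps_bound (For x e c) s = 1 + nexp_steps e + nval e s * (1 + steps_bound c s)"

definition same_sizes :: "state \<Rightarrow> state \<Rightarrow> bool" where
  "same_sizes s t \<longleftrightarrow> (\<forall>x\<in>{''d'', ''m'', ''n''}. nat_mem t x = nat_mem s x)"

lemma static_writes: "static c \<Longrightarrow> x \<in> {''d'', ''m'', ''n''} \<Longrightarrow> x \<notin> nat_writes c"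
  by (induction c) auto

lemma same_sizes_exec: "static c \<Longrightarrow> same_sizes s t \<Longrightarrow> same_sizes s (exec c t)"
  using static_writes[of c] nat_mem_exec[of _ c t] by (auto simp: same_sizes_def)

lemma nval_same_sizes: "static_bound e \<Longrightarrow> same_sizes s t \<Longrightarrow> nval e t = nval e s"
  by (induction e) (auto simp: same_sizes_def)

lemma bounds_same_sizes:
  "static c \<Longrightarrow> same_sizes s t \<Longrightarrow> ops_bound c t = ops_bound c s"
  "static c \<Longrightarrow> same_sizes s t \<Longrightarrow> steps_bound c t = steps_bound c s"
  by (induction c) (auto simp: nval_same_sizes)

lemma counters_bounded:
  "static c \<Longrightarrow> arith_ops (exec c s) \<le> arith_ops s + ops_bound c s \<and>
     steps (exec c s) \<le> steps s + steps_bound c s"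
proof (induction c arbitrary: s)
  case (Seq c1 c2)
  have "same_sizes s (exec c1 s)"
    using Seq.prems by (intro same_sizes_exec) (auto simp: same_sizes_def)
  then show ?case
    using Seq.IH(1)[of s] Seq.IH(2)[of "exec c1 s"] Seq.prems by (simp add: bounds_same_sizes)
next
  case (IfNLess e f c1 c2)
  let ?s = "charge 0 (1 + nexp_steps e + nexp_steps f) s"
  have "same_sizes s ?s" by (simp add: same_sizes_def)
  then show ?case
    using IfNLess.IH(1)[of ?s] IfNLess.IH(2)[of ?s] IfNLess.prems by (simp add: bounds_same_sizes)
next
  case (IfRLess a b c1 c2)
  let ?s = "charge (1 + rexp_ops a + rexp_ops b) (1 + rexp_steps a + rexp_steps b) s"
  have "same_sizes s ?s" by (simp add: same_sizes_def)
  then show ?case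
    using IfRLess.IH(1)[of ?s] IfRLess.IH(2)[of ?s] IfRLess.prems by (simp add: bounds_same_sizes)
next
  case (For x e c)
  let ?q = "1 + nexp_steps e"
  let ?I = "\<lambda>i t. same_sizes s t \<and> arith_ops t \<le> arith_ops s + i * ops_bound c s \<and>
    steps t \<le> steps s + ?q + i * (1 + steps_bound c s)"
  have "?I (nval e s) (iterate x c (nval e s) (charge 0 ?q s))"
  proof (rule iterate_rule[where I = ?I])
    fix i and t :: state assume t: "?I i t"
    let ?t = "charge 0 1 (set_nat x 0 0 i t)"
    have f: "same_sizes s ?t" using t For.prems by (auto simp: same_sizes_def)
    then have "same_sizes s (exec c ?t)" using For.prems by (intro same_sizes_exec) auto
    moreover have "arith_ops (exec c ?t) \<le> arith_ops ?t + ops_bound c s \<and>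
        steps (exec c ?t) \<le> steps ?t + steps_bound c s"
      using For.IH[of ?t] For.prems f by (simp add: bounds_same_sizes)
    ultimately show "?I (Suc i) (exec c ?t)" using t by simp
  qed (auto simp: same_sizes_def)
  then show ?case unfolding exec_For by simp
qed auto

definition input_size :: "state \<Rightarrow> nat" where
  "input_size s = nat_mem s ''m'' 0 0 + nat_mem s ''n'' 0 0 + nat_mem s ''d'' 0 0 + 1"

definition polynomial :: "(state \<Rightarrow> nat) \<Rightarrow> bool" where
  "polynomial f \<longleftrightarrow> (\<exists>K k. \<forall>s. f s \<le> K * input_size s ^ k)"

lemma polynomialI: "(\<And>s. f s \<le> K * input_size s ^ k) \<Longrightarrow> polynomial f"
  unfolding polynomial_def by blast

lemma polynomial_const: "polynomial (\<lambda>s. c)"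
  by (rule polynomialI[of _ c 0]) simp

lemma polynomial_add:
  assumes "polynomial f" "polynomial g"
  shows "polynomial (\<lambda>s. f s + g s)"
proof -
  obtain K k L l where f: "\<And>s. f s \<le> K * input_size s ^ k" and g: "\<And>s. g s \<le> L * input_size s ^ l"
    using assms unfolding polynomial_def by blast
  have "f s + g s \<le> (K + L) * input_size s ^ (k + l)" for s
  proof -
    have "f s + g s \<le> K * input_size s ^ k + L * input_size s ^ l" by (intro add_mono f g)
    also have "\<dots> \<le> K * input_size s ^ (k + l) + L * input_size s ^ (k + l)"
      by (intro add_mono mult_left_mono power_increasing) (auto simp: input_size_def)
    finally show ?thesis by (simp add: algebra_simps)
  qed
  then show ?thesis by (rule polynomialI)
qed

lemma polynomial_mult:
  assumes "polynomial f" "polynomial g"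
  shows "polynomial (\<lambda>s. f s * g s)"
proof -
  obtain K k L l where f: "\<And>s. f s \<le> K * input_size s ^ k" and g: "\<And>s. g s \<le> L * input_size s ^ l"
    using assms unfolding polynomial_def by blast
  have "f s * g s \<le> (K * L) * input_size s ^ (k + l)" for s
    using mult_mono[OF f[of s] g[of s]] by (simp add: power_add algebra_simps)
  then show ?thesis by (rule polynomialI)
qed

lemma polynomial_nval: "static_bound e \<Longrightarrow> polynomial (\<lambda>s. nval e s)"
proof (induction e)
  case (NCell x e f)
  then show ?case by (intro polynomialI[of _ 1 1]) (auto simp: input_size_def)
next
  case (NSub e f)
  then obtain K k where "\<And>s. nval e s \<le> K * input_size s ^ k" unfolding polynomial_def by auto
  then show ?case by (intro polynomialI[of _ K k]) (auto intro: order_trans[OF diff_le_self])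
next
  case (NConst c)
  show ?case by (rule polynomialI[of _ c 0]) simp
next
  case (NAdd e f)
  then have "polynomial (\<lambda>s. nval e s + nval f s)" by (intro polynomial_add) auto
  then show ?case by (simp add: polynomial_def)
qed

lemma steps_bound_fun:
  "steps_bound Skip = (\<lambda>s. 1)"
  "steps_bound (NAssign x e f g) = (\<lambda>s. 1 + nexp_steps e + nexp_steps f + nexp_steps g)"
  "steps_bound (RAssign x e f a) = (\<lambda>s. 1 + nexp_steps e + nexp_steps f + rexp_steps a)"
  "steps_bound (Seq c1 c2) = (\<lambda>s. steps_bound c1 s + steps_bound c2 s)"
  "steps_bound (IfNLess e f c1 c2) =
     (\<lambda>s. 1 + nexp_steps e + nexp_steps f + steps_bound c1 s + steps_bound c2 s)"
  "steps_bound (IfRLess a b c1 c2) =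
     (\<lambda>s. 1 + rexp_steps a + rexp_steps b + steps_bound c1 s + steps_bound c2 s)"
  "steps_bound (For x e c) = (\<lambda>s. 1 + nexp_steps e + nval e s * (1 + steps_bound c s))"
  by (simp_all add: fun_eq_iff)

lemma polynomial_steps_bound: "static c \<Longrightarrow> polynomial (steps_bound c)"
proof (induction c)
  case (Seq c1 c2)
  then show ?case unfolding steps_bound_fun by (intro polynomial_add) auto
next
  case (IfNLess e f c1 c2)
  then show ?case unfolding steps_bound_fun by (intro polynomial_add polynomial_const) auto
next
  case (IfRLess a b c1 c2)
  then show ?case unfolding steps_bound_fun by (intro polynomial_add polynomial_const) auto
next
  case (For x e c)
  then show ?case
    unfolding steps_bound_fun
    by (intro polynomial_add polynomial_mult polynomial_const polynomial_nval) auto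
qed (simp_all only: steps_bound_fun polynomial_const)

lemma steps_polynomial:
  assumes "static c"
  shows "\<exists>K k. \<forall>s. steps (exec c s) \<le> steps s + K * input_size s ^ k"
proof -
  obtain K k where K: "\<forall>s. steps_bound c s \<le> K * input_size s ^ k"
    using polynomial_steps_bound[OF assms] unfolding polynomial_def by (elim exE)
  have "steps (exec c s) \<le> steps s + K * input_size s ^ k" for s
    using counters_bounded[OF assms, of s] K[rule_format, of s] by linarith
  then show ?thesis by (intro exI[of _ K] exI[of _ k] allI)
qed

section \<open>Linear systems by successive projections\<close>

text \<open>Vectors are functions of which only the values below \<open>r\<close> matter, as in the memory of a program.\<close>

definition independent :: "nat \<Rightarrow> (nat \<Rightarrow> nat \<Rightarrow> real) \<Rightarrow> bool" where
  "independent r v \<longleftrightarrow>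
     (\<forall>x. (\<forall>a<r. (\<Sum>c<r. x c * v c a) = 0) \<longrightarrow> (\<forall>c<r. x c = 0))"

lemma independentD:
  "independent r v \<Longrightarrow> (\<And>a. a < r \<Longrightarrow> (\<Sum>c<r. x c * v c a) = 0) \<Longrightarrow> c < r \<Longrightarrow> x c = 0"
  unfolding independent_def by blast

text \<open>
  A square matrix with a left kernel vector has a right one too, since transposition preserves the
  determinant.
\<close>

lemma independent_transpose:
  assumes "independent r v"
  shows "independent r (\<lambda>a c. v c a)"
  unfolding independent_def
proof (intro allI impI)
  fix y :: "nat \<Rightarrow> real" and a
  assume y: "\<forall>a<r. (\<Sum>c<r. y c * v a c) = 0" and a: "a < r"
  define A where "A = mat r r (\<lambda>(a, c). v c a)"
  have A: "A \<in> carrier_mat r r" by (simp add: A_def)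
  have "det A \<noteq> 0"
  proof
    assume "det A = 0"
    then obtain x where x: "x \<in> carrier_vec r" "x \<noteq> 0\<^sub>v r" "A *\<^sub>v x = 0\<^sub>v r"
      using det_0_iff_vec_prod_zero[OF A] by auto
    have "(\<Sum>c<r. x $ c * v c a) = 0" if "a < r" for a
      using arg_cong[OF x(3), of "\<lambda>z. z $ a"] that x(1)
      by (simp add: A_def scalar_prod_def atLeast0LessThan mult.commute)
    then have "\<forall>c<r. x $ c = 0"
      using independentD[OF assms, of "\<lambda>c. x $ c"] by blast
    then show False using x(1,2) by auto
  qed
  then have "det (transpose_mat A) \<noteq> 0" using det_transpose[OF A] by simp
  moreover have "transpose_mat A *\<^sub>v vec r y = 0\<^sub>v r"
    using y by (intro eq_vecI) (auto simp: A_def scalar_prod_def atLeast0LessThan mult.commute)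
  moreover have "transpose_mat A \<in> carrier_mat r r" using A by simp
  ultimately have "vec r y = 0\<^sub>v r"
    using det_0_iff_vec_prod_zero[of "transpose_mat A" r] vec_carrier[of r y] by blast
  then have "vec r y $ a = 0\<^sub>v r $ a" by simp
  then show "y a = 0" using a by simp
qed

text \<open>
  \<open>H\<close> is the orthogonal projector onto the complement of the rows \<open>A 0, ..., A (k - 1)\<close>. The last
  clause, that \<open>H\<close> changes a vector only by a combination of these rows, keeps the next pivot from
  being zero.
\<close>

definition projector :: "nat \<Rightarrow> nat \<Rightarrow> (nat \<Rightarrow> nat \<Rightarrow> real) \<Rightarrow> (nat \<Rightarrow> nat \<Rightarrow> real) \<Rightarrow> bool" where
  "projector r k A H \<longleftrightarrow>
     (\<forall>c<r. \<forall>e<r. H c e = H e c) \<and>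
     (\<forall>c<r. \<forall>f<r. (\<Sum>e<r. H c e * H e f) = H c f) \<and>
     (\<forall>j<k. \<forall>c<r. (\<Sum>e<r. H c e * A j e) = 0) \<and>
     (\<forall>z. \<exists>l. \<forall>c<r. z c - (\<Sum>e<r. H c e * z e) = (\<Sum>j<k. l j * A j c))"

lemma projector_identity:
  assumes "\<And>c e. c < r \<Longrightarrow> e < r \<Longrightarrow> H c e = (if c = e then 1 else 0)"
  shows "projector r 0 A H"
proof -
  have *: "(\<Sum>e<r. H c e * z e) = z c" if "c < r" for c and z :: "nat \<Rightarrow> real"
  proof -
    have "(\<Sum>e<r. H c e * z e) = (\<Sum>e<r. if e = c then z e else 0)"
      by (rule sum.cong) (use assms that in auto)
    then show ?thesis using that by simp
  qed
  have "\<exists>l. \<forall>c<r. z c - (\<Sum>e<r. H c e * z e) = (\<Sum>j<0. l j * A j c)" for z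
    by (simp add: *)
  then show ?thesis unfolding projector_def using *[of _ "\<lambda>e. H e _"] assms by auto
qed

text \<open>
  The new row \<open>a\<close> is projected to \<open>g = H a\<close>, and the direction \<open>g\<close> is removed from \<open>H\<close>. The pivot is
  \<open>\<delta> = a g = g g\<close>. It is nonzero, since \<open>g = 0\<close> would make \<open>a\<close> a combination of the earlier rows; so no
  pivot has to be searched for, and one row costs quadratically many operations.
\<close>

lemma projector_step:
  assumes P: "projector r k A H" and k: "k < r" and ind: "independent r A"
    and g: "\<And>c. c < r \<Longrightarrow> g c = (\<Sum>e<r. H c e * A k e)"
    and \<delta>: "\<delta> = (\<Sum>c<r. A k c * g c)"
    and H': "\<And>c e. c < r \<Longrightarrow> e < r \<Longrightarrow> H' c e = H c e - g c * g e / \<delta>"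
  shows "\<delta> \<noteq> 0" and "\<And>j. j < k \<Longrightarrow> (\<Sum>c<r. A j c * g c) = 0" and "projector r (Suc k) A H'"
proof -
  have sym: "H c e = H e c" if "c < r" "e < r" for c e
    using P that unfolding projector_def by blast
  have idem: "(\<Sum>e<r. H c e * H e f) = H c f" if "c < r" "f < r" for c f
    using P that unfolding projector_def by blast
  have ann: "(\<Sum>e<r. H c e * A j e) = 0" if "j < k" "c < r" for c j
    using P that unfolding projector_def by blast
  have span: "\<exists>l. \<forall>c<r. z c - (\<Sum>e<r. H c e * z e) = (\<Sum>j<k. l j * A j c)" for z
    using P unfolding projector_def by blast
  have Hg: "(\<Sum>e<r. H c e * g e) = g c" if c: "c < r" for c
  proof -
    have "(\<Sum>e<r. H c e * g e) = (\<Sum>e<r. \<Sum>f<r. H c e * H e f * A k f)"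
      by (rule sum.cong) (auto simp: g sum_distrib_left mult.assoc)
    also have "\<dots> = (\<Sum>f<r. (\<Sum>e<r. H c e * H e f) * A k f)"
      by (subst sum.swap) (simp add: sum_distrib_right)
    also have "\<dots> = g c" using c by (simp add: idem g)
    finally show ?thesis .
  qed
  have self: "(\<Sum>c<r. z c * g c) = (\<Sum>e<r. A k e * (\<Sum>c<r. H e c * z c))" for z
  proof -
    have "(\<Sum>c<r. z c * g c) = (\<Sum>c<r. \<Sum>e<r. z c * H c e * A k e)"
      by (rule sum.cong) (auto simp: g sum_distrib_left mult.assoc)
    also have "\<dots> = (\<Sum>e<r. \<Sum>c<r. z c * H c e * A k e)" by (rule sum.swap)
    also have "\<dots> = (\<Sum>e<r. A k e * (\<Sum>c<r. H e c * z c))"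
      unfolding sum_distrib_left by (intro sum.cong refl) (auto simp: sym)
    finally show ?thesis .
  qed
  have gg: "(\<Sum>c<r. g c * g c) = \<delta>"
    unfolding self[of g] \<delta> by (rule sum.cong) (auto simp: Hg)
  show orth: "(\<Sum>c<r. A j c * g c) = 0" if "j < k" for j
    unfolding self by (rule sum.neutral) (simp add: ann that)
  show \<delta>0: "\<delta> \<noteq> 0"
  proof
    assume "\<delta> = 0"
    then have g0: "g c = 0" if "c < r" for c
      using gg that sum_nonneg_eq_0_iff[of "{..<r}" "\<lambda>c. g c * g c"] by auto
    obtain l where l0: "\<forall>c<r. A k c - (\<Sum>e<r. H c e * A k e) = (\<Sum>j<k. l j * A j c)"
      using span[of "A k"] by blast
    have l: "(\<Sum>j<k. l j * A j c) = A k c" if "c < r" for c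
      using g0[OF that] g[OF that] l0[rule_format, OF that] by linarith
    (* The relation that expresses row k by the earlier rows. *)
    define y where "y j = (if j < k then l j else if j = k then -1 else 0)" for j
    have "(\<Sum>j<r. y j * A j c) = 0" if c: "c < r" for c
    proof -
      have "(\<Sum>j<r. y j * A j c) = (\<Sum>j<Suc k. y j * A j c)"
        using k by (intro sum.mono_neutral_right) (auto simp: y_def)
      also have "\<dots> = 0" by (simp add: y_def l c)
      finally show ?thesis .
    qed
    then have "y k = 0" using independentD[OF ind] k by blast
    then show False by (simp add: y_def)
  qed
  have H'z: "(\<Sum>e<r. H' c e * z e) = (\<Sum>e<r. H c e * z e) - g c * (\<Sum>e<r. g e * z e) / \<delta>"
    if "c < r" for c z
  proof -
    have "(\<Sum>e<r. H' c e * z e) = (\<Sum>e<r. H c e * z e - g c / \<delta> * (g e * z e))"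
      by (rule sum.cong) (use that in \<open>auto simp: H' algebra_simps\<close>)
    also have "\<dots> = (\<Sum>e<r. H c e * z e) - g c / \<delta> * (\<Sum>e<r. g e * z e)"
      by (simp add: sum_subtractf sum_distrib_left)
    finally show ?thesis by simp
  qed
  show "projector r (Suc k) A H'"
    unfolding projector_def
  proof (intro conjI allI impI)
    fix c e assume "c < r" "e < r"
    then show "H' c e = H' e c" by (simp add: H' sym mult.commute)
  next
    fix c f assume c: "c < r" and f: "f < r"
    have 1: "(\<Sum>e<r. H c e * H' e f) = H c f - g c * g f / \<delta>"
    proof -
      have "(\<Sum>e<r. H c e * H' e f) = (\<Sum>e<r. H c e * H e f - g f / \<delta> * (H c e * g e))"
        by (rule sum.cong) (use f in \<open>auto simp: H' algebra_simps\<close>)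
      also have "\<dots> = H c f - g f / \<delta> * g c"
        by (simp only: sum_subtractf sum_distrib_left[symmetric] idem[OF c f] Hg[OF c])
      finally show ?thesis by simp
    qed
    have 2: "(\<Sum>e<r. g e * H' e f) = 0"
    proof -
      have "(\<Sum>e<r. g e * H' e f) = (\<Sum>e<r. H f e * g e - g f / \<delta> * (g e * g e))"
        by (rule sum.cong) (use f sym in \<open>auto simp: H' algebra_simps\<close>)
      also have "\<dots> = g f - g f / \<delta> * \<delta>"
        by (simp only: sum_subtractf sum_distrib_left[symmetric] Hg[OF f] gg)
      finally show ?thesis using \<delta>0 by simp
    qed
    show "(\<Sum>e<r. H' c e * H' e f) = H' c f"
      unfolding H'z[OF c] 1 2 by (simp add: H'[OF c f])
  next
    fix j c assume j: "j < Suc k" and c: "c < r"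
    show "(\<Sum>e<r. H' c e * A j e) = 0"
    proof (cases "j = k")
      case True
      have "(\<Sum>e<r. g e * A k e) = \<delta>" by (simp add: \<delta> mult.commute)
      then show ?thesis using True c \<delta>0 by (simp add: H'z g)
    next
      case False
      then have "(\<Sum>e<r. g e * A j e) = 0" using orth[of j] j by (simp add: mult.commute)
      then show ?thesis using False j c by (simp add: H'z ann)
    qed
  next
    fix z
    obtain l where "\<forall>c<r. z c - (\<Sum>e<r. H c e * z e) = (\<Sum>j<k. l j * A j c)"
      using span[of z] by blast
    then have l: "z c - (\<Sum>e<r. H c e * z e) = (\<Sum>j<k. l j * A j c)" if "c < r" for c
      using that by blast
    obtain l' where "\<forall>c<r. A k c - (\<Sum>e<r. H c e * A k e) = (\<Sum>j<k. l' j * A j c)"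
      using span[of "A k"] by blast
    then have l': "A k c - g c = (\<Sum>j<k. l' j * A j c)" if "c < r" for c
      using that g by simp
    define t where "t = (\<Sum>e<r. g e * z e) / \<delta>"
    have "z c - (\<Sum>e<r. H' c e * z e) =
        (\<Sum>j<Suc k. (if j = k then t else l j - t * l' j) * A j c)" if c: "c < r" for c
    proof -
      have "(\<Sum>j<Suc k. (if j = k then t else l j - t * l' j) * A j c) =
          (\<Sum>j<k. l j * A j c - t * (l' j * A j c)) + t * A k c"
        by (simp add: algebra_simps)
      also have "\<dots> = (z c - (\<Sum>e<r. H c e * z e)) - t * (A k c - g c) + t * A k c"
        by (simp only: sum_subtractf sum_distrib_left[symmetric] l[OF c] l'[OF c])
      finally show ?thesis unfolding H'z[OF c] by (simp add: g[OF c] t_def right_diff_distrib)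
    qed
    then show "\<exists>l. \<forall>c<r. z c - (\<Sum>e<r. H' c e * z e) = (\<Sum>j<Suc k. l j * A j c)"
      by (intro exI[of _ "\<lambda>j. if j = k then t else l j - t * l' j"] allI impI)
  qed
qed

text \<open>
  A move along \<open>g\<close> does not affect the earlier equations, because \<open>g\<close> is orthogonal to their rows; the
  length of the move is chosen to satisfy the new one.
\<close>

lemma solution_step:
  assumes P: "projector r k A H" and k: "k < r" and ind: "independent r A"
    and g: "\<And>c. c < r \<Longrightarrow> g c = (\<Sum>e<r. H c e * A k e)"
    and \<delta>: "\<delta> = (\<Sum>c<r. A k c * g c)"
    and sol: "\<And>j. j < k \<Longrightarrow> (\<Sum>c<r. A j c * x c) = b j"
    and x': "\<And>c. c < r \<Longrightarrow> x' c = x c + (b k - (\<Sum>c<r. A k c * x c)) / \<delta> * g c"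
    and j: "j < Suc k"
  shows "(\<Sum>c<r. A j c * x' c) = b j"
proof -
  note step = projector_step(1,2)[OF P k ind g \<delta>, of "\<lambda>c e. H c e - g c * g e / \<delta>"]
  let ?t = "(b k - (\<Sum>c<r. A k c * x c)) / \<delta>"
  have "(\<Sum>c<r. A j c * x' c) = (\<Sum>c<r. A j c * x c + ?t * (A j c * g c))"
    by (rule sum.cong) (auto simp: x' algebra_simps)
  also have "\<dots> = (\<Sum>c<r. A j c * x c) + ?t * (\<Sum>c<r. A j c * g c)"
    by (simp only: sum.distrib sum_distrib_left)
  also have "\<dots> = b j"
  proof (cases "j = k")
    case True
    then show ?thesis using step(1) \<delta> by simp
  next
    case False
    then show ?thesis using j step(2)[of j] sol[of j] by simp
  qed
  finally show ?thesis .
qed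

lemma independent_solvable:
  assumes "independent r A"
  shows "\<exists>x. \<forall>j<r. (\<Sum>c<r. A j c * x c) = b j"
proof -
  have *: "\<exists>H x. projector r k A H \<and> (\<forall>j<k. (\<Sum>c<r. A j c * x c) = b j)" if "k \<le> r" for k
    using that
  proof (induction k)
    case 0
    show ?case using projector_identity[of r "\<lambda>c e. if c = e then 1 else 0"] by auto
  next
    case (Suc k)
    have k: "k < r" using Suc.prems by simp
    then have "\<exists>H x. projector r k A H \<and> (\<forall>j<k. (\<Sum>c<r. A j c * x c) = b j)"
      using Suc.IH by simp
    then obtain H x where H: "projector r k A H" and x: "\<forall>j<k. (\<Sum>c<r. A j c * x c) = b j"
      by (elim exE conjE)
    define g where "g c = (\<Sum>e<r. H c e * A k e)" for c
    define \<delta> where "\<delta> = (\<Sum>c<r. A k c * g c)"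
    define H' where "H' c e = H c e - g c * g e / \<delta>" for c e
    define x' where "x' c = x c + (b k - (\<Sum>c<r. A k c * x c)) / \<delta> * g c" for c
    have 1: "projector r (Suc k) A H'"
      using projector_step(3)[OF H k assms, of g \<delta> H'] g_def \<delta>_def H'_def by blast
    have 2: "\<forall>j<Suc k. (\<Sum>c<r. A j c * x' c) = b j"
    proof (intro allI impI)
      fix j assume j: "j < Suc k"
      show "(\<Sum>c<r. A j c * x' c) = b j"
        by (rule solution_step[OF H k assms, where g = g and \<delta> = \<delta> and x = x])
          (simp_all only: g_def \<delta>_def x[rule_format] x'_def j)
    qed
    show ?case by (rule exI[of _ H'], rule exI[of _ x'], rule conjI[OF 1 2])
  qed
  obtain H x where "projector r r A H" and "\<forall>j<r. (\<Sum>c<r. A j c * x c) = b j"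
    using *[OF order_refl] by (elim exE conjE)
  then show ?thesis by (intro exI)
qed

section \<open>A program for nonsingular linear systems\<close>

declare nat_mem_exec [simp] real_mem_exec [simp]

abbreviation "n0 \<equiv> NConst 0"
abbreviation "nvar x \<equiv> NCell x n0 n0"
abbreviation "nvec x e \<equiv> NCell x e n0"
abbreviation "rvar x \<equiv> RCell x n0 n0"
abbreviation "rvec x e \<equiv> RCell x e n0"
abbreviation "dim_exp \<equiv> nvar ''d''"
abbreviation "basis_exp \<equiv> NAdd (nvar ''d'') (NConst 1)"
abbreviation "active_exp \<equiv> NAdd (nvar ''n'') (NAdd (nvar ''d'') (NConst 1))"
abbreviation "points_exp \<equiv> NAdd (nvar ''m'') (nvar ''n'')"

definition reset :: com where
  "reset = For ''c'' basis_exp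
     (Seq (RAssign ''x'' (nvar ''c'') n0 (RConst 0))
     (Seq (For ''e'' basis_exp (RAssign ''H'' (nvar ''c'') (nvar ''e'') (RConst 0)))
          (RAssign ''H'' (nvar ''c'') (nvar ''c'') (RConst 1))))"

definition project :: "name \<Rightarrow> com" where
  "project ix = For ''c'' basis_exp
     (Seq (RAssign ''g'' (nvar ''c'') n0 (RConst 0))
          (For ''e'' basis_exp (RAssign ''g'' (nvar ''c'') n0
             (RAdd (RCell ''g'' (nvar ''c'') n0)
                (RMul (RCell ''H'' (nvar ''c'') (nvar ''e'')) (RCell ''X'' (nvec ix (nvar ''e'')) (nvar ''a'')))))))"

definition eliminate :: "name \<Rightarrow> com" where
  "eliminate ix =
     Seq (project ix)
    (Seq (RAssign ''del'' n0 n0 (RConst 0))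
    (Seq (For ''c'' basis_exp (RAssign ''del'' n0 n0
            (RAdd (rvar ''del'') (RMul (RCell ''X'' (nvec ix (nvar ''c'')) (nvar ''a'')) (rvec ''g'' (nvar ''c''))))))
    (Seq (RAssign ''res'' n0 n0 (RConst 0))
    (Seq (For ''c'' basis_exp (RAssign ''res'' n0 n0
            (RAdd (rvar ''res'') (RMul (RCell ''X'' (nvec ix (nvar ''c'')) (nvar ''a'')) (rvec ''x'' (nvar ''c''))))))
    (Seq (RAssign ''tau'' n0 n0 (RDiv (RSub (rvec ''b'' (nvar ''a'')) (rvar ''res'')) (rvar ''del'')))
    (Seq (For ''c'' basis_exp (RAssign ''x'' (nvar ''c'') n0
            (RAdd (rvec ''x'' (nvar ''c'')) (RMul (rvar ''tau'') (rvec ''g'' (nvar ''c''))))))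
         (For ''c'' basis_exp (For ''e'' basis_exp (RAssign ''H'' (nvar ''c'') (nvar ''e'')
            (RSub (RCell ''H'' (nvar ''c'') (nvar ''e''))
               (RDiv (RMul (rvec ''g'' (nvar ''c'')) (rvec ''g'' (nvar ''e''))) (rvar ''del''))))))))))))"

text \<open>
  The vectors are addressed through the index array \<open>ix\<close>, so that one program serves both for the
  neighbours of a vertex and for the basis.
\<close>

definition solve :: "name \<Rightarrow> com" where
  "solve ix = Seq reset (For ''a'' basis_exp (eliminate ix))"

lemma writes_reset [simp]:
  "nat_writes reset = {''c'', ''e''}" "real_writes reset = {''x'', ''H''}"
  by (auto simp: reset_def)

lemma writes_project [simp]:
  "nat_writes (project ix) = {''c'', ''e''}" "real_writes (project ix) = {''g''}"
  by (auto simp: project_def)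

lemma writes_eliminate [simp]:
  "nat_writes (eliminate ix) = {''c'', ''e''}"
  "real_writes (eliminate ix) = {''g'', ''del'', ''res'', ''tau'', ''x'', ''H''}"
  by (auto simp: eliminate_def)

lemma writes_solve [simp]:
  "nat_writes (solve ix) = {''a'', ''c'', ''e''}"
  "real_writes (solve ix) = {''g'', ''del'', ''res'', ''tau'', ''x'', ''H''}"
  by (auto simp: solve_def)

lemma exec_reset:
  assumes "nat_mem s ''d'' 0 0 = d"
  shows "\<forall>c<Suc d. real_mem (exec reset s) ''x'' c 0 = 0 \<and>
    (\<forall>e<Suc d. real_mem (exec reset s) ''H'' c e = (if c = e then 1 else 0))"
proof -
  let ?I = "\<lambda>k R. \<forall>c<k. R ''x'' c 0 = (0::real) \<and>
    (\<forall>e<Suc d. R ''H'' c e = (if c = e then 1 else 0))"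
  let ?c = "Seq (RAssign ''x'' (nvar ''c'') n0 (RConst 0))
     (Seq (For ''e'' basis_exp (RAssign ''H'' (nvar ''c'') (nvar ''e'') (RConst 0)))
          (RAssign ''H'' (nvar ''c'') (nvar ''c'') (RConst 1)))"
  have "?I (nval basis_exp s) (real_mem (exec (For ''c'' basis_exp ?c) s))"
  proof (rule For_rule_real[where I = ?I], goal_cases)
    case (2 c t)
    let ?t = "exec (RAssign ''x'' (nvar ''c'') n0 (RConst 0)) t"
    let ?J = "\<lambda>k R. (\<forall>e<k. R ''H'' c e = (0::real)) \<and> (\<forall>c'. c' \<noteq> c \<longrightarrow> R ''H'' c' = real_mem t ''H'' c')"
    have "?J (nval basis_exp ?t)
       (real_mem (exec (For ''e'' basis_exp (RAssign ''H'' (nvar ''c'') (nvar ''e'') (RConst 0))) ?t))"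
    proof (rule For_rule_real[where I = ?J], goal_cases)
      case (2 e u)
      then show ?case using \<open>nat_mem t ''c'' 0 0 = c\<close> by (auto simp: less_Suc_eq upd_def)
    qed auto
    then show ?case using 2 assms by (auto simp: less_Suc_eq)
  qed auto
  then show ?thesis using assms by (simp add: reset_def)
qed

lemma exec_project:
  assumes "nat_mem s ''d'' 0 0 = d" and ix: "ix \<notin> {''a'', ''c'', ''e''}"
  shows "\<forall>c<Suc d. real_mem (exec (project ix) s) ''g'' c 0 =
    (\<Sum>e<Suc d. real_mem s ''H'' c e * real_mem s ''X'' (nat_mem s ix e 0) (nat_mem s ''a'' 0 0))"
proof -
  let ?v = "\<lambda>c. \<Sum>e<Suc d. real_mem s ''H'' c e * real_mem s ''X'' (nat_mem s ix e 0) (nat_mem s ''a'' 0 0)"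
  have "\<forall>c<nval basis_exp s. real_mem (exec (project ix) s) ''g'' c 0 = ?v c"
    unfolding project_def
  proof (rule For_rule_real[where I = "\<lambda>k R. \<forall>c<k. R ''g'' c 0 = ?v c"], goal_cases)
    case (2 c t)
    then show ?case using assms by (auto simp: exec_sum less_Suc_eq simp del: sum.lessThan_Suc)
  qed auto
  then show ?thesis using assms by simp
qed

lemma exec_eliminate:
  assumes d: "nat_mem s ''d'' 0 0 = d" and ix: "ix \<notin> {''a'', ''c'', ''e''}"
    and k: "nat_mem s ''a'' 0 0 = k"
  defines "t \<equiv> exec (eliminate ix) s"
    and "A \<equiv> \<lambda>a c. real_mem s ''X'' (nat_mem s ix c 0) a"
  shows "\<exists>g \<delta>. (\<forall>c<Suc d. g c = (\<Sum>e<Suc d. real_mem s ''H'' c e * A k e)) \<and>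
     \<delta> = (\<Sum>c<Suc d. A k c * g c) \<and>
     (\<forall>c<Suc d. real_mem t ''x'' c 0 = real_mem s ''x'' c 0 +
        (real_mem s ''b'' k 0 - (\<Sum>c<Suc d. A k c * real_mem s ''x'' c 0)) / \<delta> * g c) \<and>
     (\<forall>c<Suc d. \<forall>e<Suc d. real_mem t ''H'' c e = real_mem s ''H'' c e - g c * g e / \<delta>)"
proof -
  define s1 where "s1 = exec (project ix) s"
  define g where "g c = real_mem s1 ''g'' c 0" for c
  define s2 where "s2 = exec (For ''c'' basis_exp (RAssign ''del'' n0 n0
            (RAdd (rvar ''del'') (RMul (RCell ''X'' (nvec ix (nvar ''c'')) (nvar ''a'')) (rvec ''g'' (nvar ''c''))))))
            (exec (RAssign ''del'' n0 n0 (RConst 0)) s1)"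
  define \<delta> where "\<delta> = real_mem s2 ''del'' 0 0"
  define s3 where "s3 = exec (For ''c'' basis_exp (RAssign ''res'' n0 n0
            (RAdd (rvar ''res'') (RMul (RCell ''X'' (nvec ix (nvar ''c'')) (nvar ''a'')) (rvec ''x'' (nvar ''c''))))))
            (exec (RAssign ''res'' n0 n0 (RConst 0)) s2)"
  define s4 where "s4 = exec (RAssign ''tau'' n0 n0 (RDiv (RSub (rvec ''b'' (nvar ''a'')) (rvar ''res'')) (rvar ''del''))) s3"
  define s5 where "s5 = exec (For ''c'' basis_exp (RAssign ''x'' (nvar ''c'') n0
            (RAdd (rvec ''x'' (nvar ''c'')) (RMul (rvar ''tau'') (rvec ''g'' (nvar ''c'')))))) s4"
  have t: "t = exec (For ''c'' basis_exp (For ''e'' basis_exp (RAssign ''H'' (nvar ''c'') (nvar ''e'')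
            (RSub (RCell ''H'' (nvar ''c'') (nvar ''e''))
               (RDiv (RMul (rvec ''g'' (nvar ''c'')) (rvec ''g'' (nvar ''e''))) (rvar ''del'')))))) s5"
    unfolding t_def eliminate_def s5_def s4_def s3_def s2_def s1_def by simp
  have ix': "ix \<noteq> ''a''" "ix \<noteq> ''c''" "ix \<noteq> ''e''" using ix by auto
  have n1: "nat_mem s1 y = nat_mem s y" if "y \<noteq> ''c''" "y \<noteq> ''e''" for y
    using that by (simp add: s1_def)
  have r1: "real_mem s1 y = real_mem s y" if "y \<noteq> ''g''" for y
    using that by (simp add: s1_def)
  have n2: "nat_mem s2 y = nat_mem s y" if "y \<noteq> ''c''" "y \<noteq> ''e''" for y
    using that n1 by (simp add: s2_def)
  have r2: "real_mem s2 y = real_mem s1 y" if "y \<noteq> ''del''" for y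
    using that by (simp add: s2_def)
  have n3: "nat_mem s3 y = nat_mem s y" if "y \<noteq> ''c''" "y \<noteq> ''e''" for y
    using that n2 by (simp add: s3_def)
  have r3: "real_mem s3 y = real_mem s2 y" if "y \<noteq> ''res''" for y
    using that by (simp add: s3_def)
  have n4: "nat_mem s4 y = nat_mem s y" if "y \<noteq> ''c''" "y \<noteq> ''e''" for y
    using that n3 by (simp add: s4_def)
  have r4: "real_mem s4 y = real_mem s3 y" if "y \<noteq> ''tau''" for y
    using that by (simp add: s4_def)
  have n5: "nat_mem s5 y = nat_mem s y" if "y \<noteq> ''c''" "y \<noteq> ''e''" for y
    using that n4 by (simp add: s5_def)
  have r5: "real_mem s5 y = real_mem s4 y" if "y \<noteq> ''x''" for y
    using that by (simp add: s5_def)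
  have g: "g c = (\<Sum>e<Suc d. real_mem s ''H'' c e * A k e)" if "c < Suc d" for c
    using exec_project[OF d ix] that k unfolding g_def s1_def A_def by simp
  have \<delta>: "\<delta> = (\<Sum>c<Suc d. A k c * g c)"
    unfolding \<delta>_def s2_def using ix' d k
    by (simp add: exec_sum n1 r1 g_def A_def del: sum.lessThan_Suc)
  have res: "real_mem s3 ''res'' 0 0 = (\<Sum>c<Suc d. A k c * real_mem s ''x'' c 0)"
    unfolding s3_def using ix' d k
    by (simp add: exec_sum n2 n1 r2 r1 A_def del: sum.lessThan_Suc)
  have tau: "real_mem s4 ''tau'' 0 0 =
      (real_mem s ''b'' k 0 - (\<Sum>c<Suc d. A k c * real_mem s ''x'' c 0)) / \<delta>"
    unfolding s4_def using d k
    by (simp add: n3 n2 n1 r3 r2 r1 res \<delta>_def del: sum.lessThan_Suc)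
  have x: "real_mem s5 ''x'' c 0 = real_mem s ''x'' c 0 + real_mem s4 ''tau'' 0 0 * g c"
    if c: "c < Suc d" for c
  proof -
    let ?I = "\<lambda>k R. \<forall>c. R ''x'' c 0 = real_mem s4 ''x'' c 0 +
      (if c < k then real_mem s4 ''tau'' 0 0 * real_mem s4 ''g'' c 0 else 0)"
    have "?I (nval basis_exp s4) (real_mem s5)"
      unfolding s5_def
    proof (rule For_rule_real[where I = ?I], goal_cases)
      case 1
      show ?case by simp
    next
      case (2 c u)
      then have "real_mem u ''tau'' = real_mem s4 ''tau''" "real_mem u ''g'' = real_mem s4 ''g''" by simp_all
      then show ?case using 2(2,3) by (simp add: less_Suc_eq)
    qed
    then show ?thesis using c d by (simp add: n4 r4 r3 r2 r1 g_def)
  qed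
  let ?I = "\<lambda>k R. \<forall>c<Suc d. \<forall>e<Suc d. R ''H'' c e = (if c < k then
      real_mem s ''H'' c e - g c * g e / \<delta> else real_mem s ''H'' c e)"
  let ?body = "For ''e'' basis_exp (RAssign ''H'' (nvar ''c'') (nvar ''e'')
            (RSub (RCell ''H'' (nvar ''c'') (nvar ''e''))
               (RDiv (RMul (rvec ''g'' (nvar ''c'')) (rvec ''g'' (nvar ''e''))) (rvar ''del''))))"
  have "?I (nval basis_exp s5) (real_mem (exec (For ''c'' basis_exp ?body) s5))"
  proof (rule For_rule_real[where I = ?I], goal_cases)
    case 1
    show ?case by (simp add: r5 r4 r3 r2 r1)
  next
    case (2 c t)
    have c: "c < Suc d" using 2(1) d by (simp add: n5)
    have gt: "real_mem t ''g'' c 0 = g c" for c using 2(4) by (simp add: r5 r4 r3 r2 g_def)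
    have dt: "real_mem t ''del'' 0 0 = \<delta>" using 2(4) by (simp add: r5 r4 r3 \<delta>_def)
    let ?J = "\<lambda>k R. (\<forall>e<Suc d. R ''H'' c e = (if e < k then
      real_mem s ''H'' c e - g c * g e / \<delta> else real_mem s ''H'' c e)) \<and>
      (\<forall>c'. c' \<noteq> c \<longrightarrow> R ''H'' c' = real_mem t ''H'' c')"
    have "?J (nval basis_exp t) (real_mem (exec ?body t))"
    proof (rule For_rule_real[where I = ?J], goal_cases)
      case 1
      show ?case using 2(2) c by auto
    next
      case (2 e u)
      have u: "real_mem u ''g'' = real_mem t ''g''" "real_mem u ''del'' = real_mem t ''del''"
        "nat_mem u ''c'' 0 0 = c"
        using 2(4) \<open>nat_mem t ''c'' 0 0 = c\<close> by simp_all
      have e: "e < Suc d" using 2(1) \<open>frame _ _ s5 t\<close> d by (simp add: n5)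
      show ?case using 2(2,3) u e by (auto simp: gt dt less_Suc_eq upd_def)
    qed
    moreover have "nval basis_exp t = Suc d" using 2(4) d by (simp add: n5)
    ultimately show ?case using 2(2) by (auto simp: less_Suc_eq)
  qed
  moreover have "nval basis_exp s5 = Suc d" using d by (simp add: n5)
  ultimately have H: "real_mem t ''H'' c e = real_mem s ''H'' c e - g c * g e / \<delta>"
    if "c < Suc d" "e < Suc d" for c e unfolding t using that by simp
  have x': "real_mem t ''x'' c 0 = real_mem s5 ''x'' c 0" for c
    unfolding t by simp
  show ?thesis
    using g \<delta> H x x' tau by (intro exI[of _ g] exI[of _ \<delta>] conjI allI impI) simp_all
qed

text \<open>
  General position speaks about the points, which are the columns of the system, whereas the
  projections treat its rows, one for each coordinate; hence the passage to the transpose.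
\<close>

lemma exec_solve:
  assumes d: "nat_mem s ''d'' 0 0 = d" and ix: "ix \<notin> {''a'', ''c'', ''e''}"
    and ind: "independent (Suc d) (\<lambda>c. real_mem s ''X'' (nat_mem s ix c 0))"
    and a: "a < Suc d"
  shows "(\<Sum>c<Suc d. real_mem (exec (solve ix) s) ''x'' c 0 * real_mem s ''X'' (nat_mem s ix c 0) a)
    = real_mem s ''b'' a 0"
proof -
  let ?A = "\<lambda>a c. real_mem s ''X'' (nat_mem s ix c 0) a"
  let ?b = "\<lambda>a. real_mem s ''b'' a 0"
  have ind': "independent (Suc d) ?A" using independent_transpose[OF ind] .
  let ?s = "exec reset s"
  let ?I = "\<lambda>k R. projector (Suc d) k ?A (R ''H'') \<and>
     (\<forall>j<k. (\<Sum>c<Suc d. ?A j c * R ''x'' c 0) = ?b j)"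
  have ix': "ix \<noteq> ''a''" "ix \<noteq> ''c''" "ix \<noteq> ''e''" using ix by auto
  have "?I (nval basis_exp ?s) (real_mem (exec (For ''a'' basis_exp (eliminate ix)) ?s))"
  proof (rule For_rule_real[where I = ?I], goal_cases)
    case 1
    have "projector (Suc d) 0 ?A (real_mem ?s ''H'')"
      by (rule projector_identity) (use exec_reset[OF d] in blast)
    then show ?case by simp
  next
    case (2 k t)
    have td: "nat_mem t ''d'' 0 0 = d" and tix: "nat_mem t ix = nat_mem s ix"
      and tX: "real_mem t ''X'' = real_mem s ''X''" and tb: "real_mem t ''b'' = real_mem s ''b''"
      using 2(4) d ix' by simp_all
    have k: "k < Suc d" using 2(1) d by simp
    from exec_eliminate[OF td ix 2(3), unfolded tix tX tb]
    obtain g \<delta> where g: "\<And>c. c < Suc d \<Longrightarrow> g c = (\<Sum>e<Suc d. real_mem t ''H'' c e * ?A k e)"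
      and \<delta>: "\<delta> = (\<Sum>c<Suc d. ?A k c * g c)"
      and x: "\<And>c. c < Suc d \<Longrightarrow> real_mem (exec (eliminate ix) t) ''x'' c 0 = real_mem t ''x'' c 0 +
        (?b k - (\<Sum>c<Suc d. ?A k c * real_mem t ''x'' c 0)) / \<delta> * g c"
      and H: "\<And>c e. c < Suc d \<Longrightarrow> e < Suc d \<Longrightarrow>
        real_mem (exec (eliminate ix) t) ''H'' c e = real_mem t ''H'' c e - g c * g e / \<delta>"
      by (elim exE conjE) (rule that, simp_all del: sum.lessThan_Suc)
    have P: "projector (Suc d) k ?A (real_mem t ''H'')"
      and sol: "\<And>j. j < k \<Longrightarrow> (\<Sum>c<Suc d. ?A j c * real_mem t ''x'' c 0) = ?b j"
      using 2(2) by (simp_all del: sum.lessThan_Suc)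
    show ?case
    proof (intro conjI allI impI)
      show "projector (Suc d) (Suc k) ?A (real_mem (exec (eliminate ix) t) ''H'')"
        by (rule projector_step(3)[OF P k ind', of g \<delta>]) (fact g \<delta> H)+
      fix j assume j: "j < Suc k"
      show "(\<Sum>c<Suc d. ?A j c * real_mem (exec (eliminate ix) t) ''x'' c 0) = ?b j"
        by (rule solution_step[OF P k ind', where g = g and \<delta> = \<delta> and
              x = "\<lambda>c. real_mem t ''x'' c 0" and b = ?b]) (fact g \<delta> sol x j)+
    qed
  qed
  then have "(\<Sum>c<Suc d. ?A a c * real_mem (exec (solve ix) s) ''x'' c 0) = ?b a"
    using a d by (simp add: solve_def del: sum.lessThan_Suc)
  then show ?thesis by (simp add: mult.commute del: sum.lessThan_Suc)
qed

section \<open>The active vertices\<close>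

definition coordinates :: com where
  "coordinates = For ''v'' points_exp (For ''a'' basis_exp
     (IfNLess (nvar ''a'') dim_exp
        (IfNLess (nvar ''v'') (nvar ''m'')
           (RAssign ''X'' (nvar ''v'') (nvar ''a'') (RCell ''Pbar'' (nvar ''a'') (nvar ''v'')))
           (RAssign ''X'' (nvar ''v'') (nvar ''a'')
              (RCell ''P'' (nvar ''a'') (NSub (nvar ''v'') (nvar ''m'')))))
        (RAssign ''X'' (nvar ''v'') (nvar ''a'') (RConst 1))))"

lemma writes_coordinates [simp]:
  "nat_writes coordinates = {''v'', ''a''}" "real_writes coordinates = {''X''}"
  by (auto simp: coordinates_def)

definition activate :: com where
  "activate =
     Seq (NAssign ''act'' (nvar ''na'') n0 (nvar ''v''))
    (Seq (NAssign ''pos'' (nvar ''na'') n0 (nvar ''p''))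
    (Seq (NAssign ''isact'' (nvar ''v'') n0 (NConst 1))
         (NAssign ''na'' n0 n0 (NAdd (nvar ''na'') (NConst 1)))))"

text \<open>
  All sensors are kept, but only the first \<open>d + 1\<close> anchors in the ordering: this makes the number
  of arithmetic operations independent of the number of anchors.
\<close>

definition select_body :: com where
  "select_body =
     Seq (NAssign ''v'' n0 n0 (nvec ''ord'' (nvar ''p'')))
       (IfNLess (nvar ''v'') (nvar ''m'')
          (IfNLess (nvar ''ca'') basis_exp
             (Seq (NAssign ''bas'' (nvar ''ca'') n0 (nvar ''v''))
             (Seq (NAssign ''ca'' n0 n0 (NAdd (nvar ''ca'') (NConst 1))) activate))
             Skip)
          activate)"

definition select :: com where
  "select = For ''p'' points_exp select_body"

lemma writes_select_body [simp]:
  "nat_writes select_body = {''v'', ''ca'', ''na'', ''bas'', ''act'', ''pos'', ''isact''}"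
  "real_writes select_body = {}"
  by (auto simp: select_body_def activate_def)

lemma writes_select [simp]:
  "nat_writes select = {''p'', ''v'', ''ca'', ''na'', ''bas'', ''act'', ''pos'', ''isact''}"
  "real_writes select = {}"
  by (auto simp: select_def)

lemma exec_coordinates:
  assumes "nat_mem s ''d'' 0 0 = d" "nat_mem s ''m'' 0 0 = m" "nat_mem s ''n'' 0 0 = n"
  shows "\<forall>v<m + n. \<forall>a<Suc d. real_mem (exec coordinates s) ''X'' v a =
    (if a < d then if v < m then real_mem s ''Pbar'' a v else real_mem s ''P'' a (v - m) else 1)"
proof -
  let ?v = "\<lambda>v a. if a < d then if v < m then real_mem s ''Pbar'' a v else real_mem s ''P'' a (v - m) else 1"
  let ?I = "\<lambda>k R. \<forall>v<k. \<forall>a<Suc d. R ''X'' v a = ?v v a"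
  have "?I (nval points_exp s) (real_mem (exec coordinates s))"
    unfolding coordinates_def
  proof (rule For_rule_real[where I = ?I], goal_cases)
    case 1
    show ?case by simp
  next
    case (2 v t)
    let ?J = "\<lambda>k R. (\<forall>a<k. R ''X'' v a = ?v v a) \<and> (\<forall>w. w \<noteq> v \<longrightarrow> R ''X'' w = real_mem t ''X'' w)"
    let ?body = "For ''a'' basis_exp
     (IfNLess (nvar ''a'') dim_exp
        (IfNLess (nvar ''v'') (nvar ''m'')
           (RAssign ''X'' (nvar ''v'') (nvar ''a'') (RCell ''Pbar'' (nvar ''a'') (nvar ''v'')))
           (RAssign ''X'' (nvar ''v'') (nvar ''a'')
              (RCell ''P'' (nvar ''a'') (NSub (nvar ''v'') (nvar ''m'')))))
        (RAssign ''X'' (nvar ''v'') (nvar ''a'') (RConst 1)))"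
    have "?J (nval basis_exp t) (real_mem (exec ?body t))"
    proof (rule For_rule_real[where I = ?J], goal_cases)
      case 1
      show ?case by simp
    next
      case (2 a u)
      have *: "nat_mem u ''d'' 0 0 = d" "nat_mem u ''m'' 0 0 = m" "nat_mem u ''v'' 0 0 = v"
        "real_mem u ''P'' = real_mem s ''P''" "real_mem u ''Pbar'' = real_mem s ''Pbar''"
        using 2(4) \<open>nat_mem t ''v'' 0 0 = v\<close> \<open>frame _ _ s t\<close> assms by simp_all
      show ?case using 2(2,3) * by (auto simp: less_Suc_eq upd_def)
    qed
    moreover have "nval basis_exp t = Suc d" using 2(4) assms by simp
    ultimately show ?case using 2(2) by (auto simp: less_Suc_eq)
  qed
  then show ?thesis using assms by simp
qed

text \<open>
  The tables after a scan of the first \<open>p\<close> positions. The last clause is the reason why anchors may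
  be dropped: the whole basis comes before a dropped anchor, which can therefore be represented by
  it.
\<close>

definition selected :: "nat \<Rightarrow> nat \<Rightarrow> (nat \<Rightarrow> nat) \<Rightarrow> nat \<Rightarrow> nat \<Rightarrow> nat \<Rightarrow>
    (nat \<Rightarrow> nat) \<Rightarrow> (nat \<Rightarrow> nat) \<Rightarrow> (nat \<Rightarrow> nat) \<Rightarrow> (nat \<Rightarrow> nat) \<Rightarrow> bool" where
  "selected d m \<pi> p ca na bas act pos isact \<longleftrightarrow>
     ca \<le> Suc d \<and> inj_on bas {..<ca} \<and> bas ` {..<ca} \<subseteq> {..<m} \<inter> \<pi> ` {..<p} \<and>
     act ` {..<na} = {v \<in> \<pi> ` {..<p}. m \<le> v} \<union> bas ` {..<ca} \<and>
     (\<forall>i<na. pos i < p \<and> act i = \<pi> (pos i)) \<and> (\<forall>i<na. \<forall>j<i. pos j < pos i) \<and>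
     (\<forall>v. isact v = of_bool (v \<in> act ` {..<na})) \<and>
     (\<forall>q<p. \<pi> q \<notin> act ` {..<na} \<longrightarrow> ca = Suc d \<and> bas ` {..<Suc d} \<subseteq> \<pi> ` {..<q})"

lemma selectedD:
  assumes "selected d m \<pi> p ca na bas act pos isact"
  shows "ca \<le> Suc d" and "inj_on bas {..<ca}" and "bas ` {..<ca} \<subseteq> {..<m} \<inter> \<pi> ` {..<p}"
    and "act ` {..<na} = {v \<in> \<pi> ` {..<p}. m \<le> v} \<union> bas ` {..<ca}"
    and "\<forall>i<na. pos i < p \<and> act i = \<pi> (pos i)" and "\<forall>i<na. \<forall>j<i. pos j < pos i"
    and "\<forall>v. isact v = of_bool (v \<in> act ` {..<na})"
    and "\<forall>q<p. \<pi> q \<notin> act ` {..<na} \<longrightarrow> ca = Suc d \<and> bas ` {..<Suc d} \<subseteq> \<pi> ` {..<q}"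
  using assms unfolding selected_def by - (elim conjE, assumption)+

lemma image_fun_upd_new: "(f(k := v)) ` {..<Suc k} = insert v (f ` {..<k})"
  by (auto simp: lessThan_Suc)

lemma inj_on_fun_upd_new:
  assumes "inj_on f {..<k::nat}" "v \<notin> f ` {..<k}"
  shows "inj_on (f(k := v)) {..<Suc k}"
proof -
  have "inj_on (f(k := v)) {..<k}" using assms(1) by (subst inj_on_cong[of _ _ f]) simp_all
  moreover have "(f(k := v)) ` {..<k} = f ` {..<k}" by (rule image_cong) simp_all
  ultimately show ?thesis using assms(2) unfolding lessThan_Suc inj_on_insert by simp
qed

lemma selected_activate:
  assumes S: "selected d m \<pi> p ca na bas act pos isact"
    and ca': "ca \<le> ca'" "ca' \<le> Suc d" and inj: "inj_on bas' {..<ca'}"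
    and bas': "bas' ` {..<ca'} \<subseteq> {..<m} \<inter> \<pi> ` {..<Suc p}"
    and im: "insert (\<pi> p) ({v \<in> \<pi> ` {..<p}. m \<le> v} \<union> bas ` {..<ca}) =
      {v \<in> \<pi> ` {..<Suc p}. m \<le> v} \<union> bas' ` {..<ca'}"
    and full: "ca = Suc d \<Longrightarrow> bas' = bas"
  shows "selected d m \<pi> (Suc p) ca' (Suc na) bas' (act(na := \<pi> p)) (pos(na := p)) (isact(\<pi> p := 1))"
proof -
  have im': "(act(na := \<pi> p)) ` {..<Suc na} = insert (\<pi> p) (act ` {..<na})"
    by (rule image_fun_upd_new)
  have act: "act ` {..<na} = {v \<in> \<pi> ` {..<p}. m \<le> v} \<union> bas ` {..<ca}"
    and pos: "\<forall>i<na. pos i < p \<and> act i = \<pi> (pos i)" and mono: "\<forall>i<na. \<forall>j<i. pos j < pos i"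
    and isact: "\<forall>v. isact v = of_bool (v \<in> act ` {..<na})"
    and late: "\<forall>q<p. \<pi> q \<notin> act ` {..<na} \<longrightarrow> ca = Suc d \<and> bas ` {..<Suc d} \<subseteq> \<pi> ` {..<q}"
    by (rule selectedD[OF S])+
  have 1: "\<forall>i<Suc na. (pos(na := p)) i < Suc p \<and> (act(na := \<pi> p)) i = \<pi> ((pos(na := p)) i)"
    using pos by (simp add: less_Suc_eq)
  have 2: "\<forall>i<Suc na. \<forall>j<i. (pos(na := p)) j < (pos(na := p)) i"
    using pos mono by (simp add: less_Suc_eq)
  have 3: "\<forall>v. (isact(\<pi> p := 1)) v = of_bool (v \<in> insert (\<pi> p) (act ` {..<na}))"
    using isact by simp
  have 4: "\<forall>q<Suc p. \<pi> q \<notin> insert (\<pi> p) (act ` {..<na}) \<longrightarrow>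
      ca' = Suc d \<and> bas' ` {..<Suc d} \<subseteq> \<pi> ` {..<q}"
  proof (intro allI impI)
    fix q assume q: "q < Suc p" "\<pi> q \<notin> insert (\<pi> p) (act ` {..<na})"
    then have "q \<noteq> p" "\<pi> q \<notin> act ` {..<na}" by blast+
    moreover have "q < p" using q(1) \<open>q \<noteq> p\<close> by simp
    ultimately have "ca = Suc d \<and> bas ` {..<Suc d} \<subseteq> \<pi> ` {..<q}" using late by blast
    then show "ca' = Suc d \<and> bas' ` {..<Suc d} \<subseteq> \<pi> ` {..<q}" using full ca' by simp
  qed
  show ?thesis unfolding selected_def im'
    using ca'(2) inj bas' im[folded act] 1 2 3 4 by (intro conjI)
qed

lemma selected_sensor:
  assumes S: "selected d m \<pi> p ca na bas act pos isact" and v: "\<not> \<pi> p < m"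
  shows "selected d m \<pi> (Suc p) ca (Suc na) bas (act(na := \<pi> p)) (pos(na := p)) (isact(\<pi> p := 1))"
proof (rule selected_activate[OF S order_refl])
  show "ca \<le> Suc d" "inj_on bas {..<ca}" by (rule selectedD[OF S])+
  have "bas ` {..<ca} \<subseteq> {..<m} \<inter> \<pi> ` {..<p}" by (rule selectedD[OF S])
  then show "bas ` {..<ca} \<subseteq> {..<m} \<inter> \<pi> ` {..<Suc p}" by (auto simp: lessThan_Suc)
  show "insert (\<pi> p) ({v \<in> \<pi> ` {..<p}. m \<le> v} \<union> bas ` {..<ca}) =
      {v \<in> \<pi> ` {..<Suc p}. m \<le> v} \<union> bas ` {..<ca}"
    using v by (auto simp: lessThan_Suc)
qed simp

lemma selected_basis:
  assumes S: "selected d m \<pi> p ca na bas act pos isact" and v: "\<pi> p < m" and ca: "ca < Suc d"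
    and new: "\<pi> p \<notin> \<pi> ` {..<p}"
  shows "selected d m \<pi> (Suc p) (Suc ca) (Suc na) (bas(ca := \<pi> p)) (act(na := \<pi> p))
     (pos(na := p)) (isact(\<pi> p := 1))"
proof (rule selected_activate[OF S])
  have im: "(bas(ca := \<pi> p)) ` {..<Suc ca} = insert (\<pi> p) (bas ` {..<ca})"
    by (rule image_fun_upd_new)
  have b: "inj_on bas {..<ca}" "bas ` {..<ca} \<subseteq> {..<m} \<inter> \<pi> ` {..<p}"
    by (rule selectedD[OF S])+
  then have "\<pi> p \<notin> bas ` {..<ca}" using new by blast
  then show "inj_on (bas(ca := \<pi> p)) {..<Suc ca}"
    using b(1) by (intro inj_on_fun_upd_new)
  show "(bas(ca := \<pi> p)) ` {..<Suc ca} \<subseteq> {..<m} \<inter> \<pi> ` {..<Suc p}"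
    unfolding im using b(2) v by (auto simp: lessThan_Suc)
  show "insert (\<pi> p) ({v \<in> \<pi> ` {..<p}. m \<le> v} \<union> bas ` {..<ca}) =
      {v \<in> \<pi> ` {..<Suc p}. m \<le> v} \<union> (bas(ca := \<pi> p)) ` {..<Suc ca}"
    unfolding im using v by (auto simp: lessThan_Suc)
qed (use ca in simp_all)

lemma selected_skip:
  assumes S: "selected d m \<pi> p ca na bas act pos isact" and v: "\<pi> p < m" and ca: "\<not> ca < Suc d"
  shows "selected d m \<pi> (Suc p) ca na bas act pos isact"
proof -
  have "ca \<le> Suc d" and inj: "inj_on bas {..<ca}" and bas: "bas ` {..<ca} \<subseteq> {..<m} \<inter> \<pi> ` {..<p}"
    and act: "act ` {..<na} = {v \<in> \<pi> ` {..<p}. m \<le> v} \<union> bas ` {..<ca}"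
    and pos: "\<forall>i<na. pos i < p \<and> act i = \<pi> (pos i)" and mono: "\<forall>i<na. \<forall>j<i. pos j < pos i"
    and isact: "\<forall>v. isact v = of_bool (v \<in> act ` {..<na})"
    and late: "\<forall>q<p. \<pi> q \<notin> act ` {..<na} \<longrightarrow> ca = Suc d \<and> bas ` {..<Suc d} \<subseteq> \<pi> ` {..<q}"
    by (rule selectedD[OF S])+
  then have c: "ca = Suc d" using ca by simp
  have eq: "{v \<in> \<pi> ` {..<Suc p}. m \<le> v} = {v \<in> \<pi> ` {..<p}. m \<le> v}"
    using v by (auto simp: lessThan_Suc)
  have "bas ` {..<ca} \<subseteq> {..<m} \<inter> \<pi> ` {..<Suc p}" using bas by (auto simp: lessThan_Suc)
  moreover have "\<forall>i<na. pos i < Suc p \<and> act i = \<pi> (pos i)" using pos by (simp add: less_SucI)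
  moreover have "\<forall>q<Suc p. \<pi> q \<notin> act ` {..<na} \<longrightarrow> ca = Suc d \<and> bas ` {..<Suc d} \<subseteq> \<pi> ` {..<q}"
    using late bas c by (auto simp: less_Suc_eq)
  ultimately show ?thesis unfolding selected_def eq
    using \<open>ca \<le> Suc d\<close> inj act mono isact by (intro conjI)
qed

abbreviation "sel_state d m \<pi> p M \<equiv> selected d m \<pi> p (M ''ca'' 0 0) (M ''na'' 0 0)
  (\<lambda>i. M ''bas'' i 0) (\<lambda>i. M ''act'' i 0) (\<lambda>i. M ''pos'' i 0) (\<lambda>i. M ''isact'' i 0)"

lemma exec_select:
  assumes sz: "nat_mem s ''d'' 0 0 = d" "nat_mem s ''m'' 0 0 = m" "nat_mem s ''n'' 0 0 = n"
    and ord: "\<And>p. p < m + n \<Longrightarrow> nat_mem s ''ord'' p 0 = \<pi> p" and inj: "inj_on \<pi> {..<m + n}"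
    and z: "nat_mem s ''ca'' 0 0 = 0" "nat_mem s ''na'' 0 0 = 0" "\<And>v. nat_mem s ''isact'' v 0 = 0"
  shows "sel_state d m \<pi> (m + n) (nat_mem (exec select s))"
proof -
  have "sel_state d m \<pi> (nval points_exp s) (nat_mem (exec select s))"
    unfolding select_def
  proof (rule For_rule[where I = "\<lambda>p M R. sel_state d m \<pi> p M"], goal_cases)
    case 1
    show ?case by (simp add: selected_def z)
  next
    case (2 i v M R)
    then show ?case by simp
  next
    case (3 p t)
    have p: "p < m + n" using 3(1) sz by simp
    have t: "nat_mem t ''d'' 0 0 = d" "nat_mem t ''m'' 0 0 = m" "nat_mem t ''ord'' p 0 = \<pi> p"
      using 3(4) sz ord[OF p] by simp_all
    have new: "\<pi> p \<notin> \<pi> ` {..<p}" using inj_onD[OF inj, of p] p by fastforce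
    have upd1: "(\<lambda>i. if i = k then v else f i) = f(k := v)" for f :: "nat \<Rightarrow> nat" and k v by auto
    show ?case
    proof (cases "\<pi> p < m")
      case False
      show ?thesis using selected_sensor[OF 3(2) False] False t 3(3)
        by (simp add: select_body_def activate_def upd1)
    next
      case True
      show ?thesis
      proof (cases "nat_mem t ''ca'' 0 0 < Suc d")
        case c: True
        show ?thesis using selected_basis[OF 3(2) True c new] True c t 3(3)
          by (simp add: select_body_def activate_def upd1)
      next
        case c: False
        show ?thesis using selected_skip[OF 3(2) True c] True c t 3(3)
          by (simp add: select_body_def)
      qed
    qed
  qed
  then show ?thesis using sz by simp
qed

section \<open>Computing one vector\<close>

text \<open>
  The counter \<open>t\<close> increases from 0, but the vertices are treated from the last active one down to
  \<open>act (d + 1)\<close>.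
\<close>

definition pick :: com where
  "pick = Seq (NAssign ''i'' n0 n0 (NSub (NAdd (nvar ''n'') (nvar ''d'')) (nvar ''t'')))
         (Seq (NAssign ''v'' n0 n0 (nvec ''act'' (nvar ''i'')))
              (NAssign ''cnt'' n0 n0 n0))"

definition visit :: com where
  "visit = IfNLess (nvar ''q'') (nvec ''pos'' (nvar ''i''))
       (IfNLess n0 (NCell ''adj'' (nvec ''ord'' (nvar ''q'')) (nvar ''v''))
         (IfNLess (nvar ''cnt'') basis_exp
           (Seq (NAssign ''nb'' (nvar ''cnt'') n0 (nvec ''ord'' (nvar ''q'')))
                (NAssign ''cnt'' n0 n0 (NAdd (nvar ''cnt'') (NConst 1))))
           Skip) Skip) Skip"

definition neighbours :: com where
  "neighbours = For ''q'' points_exp visit"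

text \<open>
  The values that are not solved for. The value at an earlier non-neighbour makes the corresponding
  entry of the updated matrix zero.
\<close>

definition start :: com where
  "start = Seq (For ''j'' active_exp
      (IfNLess (nvar ''j'') (nvar ''i'')
        (IfNLess n0 (NCell ''adj'' (nvec ''act'' (nvar ''j'')) (nvar ''v''))
          (RAssign ''s'' (nvec ''act'' (nvar ''j'')) n0 (RConst 0))
          (RAssign ''s'' (nvec ''act'' (nvar ''j'')) n0
            (RSub (RConst 0) (RCell ''Om'' (nvec ''act'' (nvar ''j'')) (nvar ''v'')))))
        (RAssign ''s'' (nvec ''act'' (nvar ''j'')) n0 (RConst 0))))
      (RAssign ''s'' (nvar ''v'') n0 (RConst 1))"

definition defect :: com where
  "defect = For ''a'' basis_exp (Seq (RAssign ''b'' (nvar ''a'') n0 (RConst 0))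
     (For ''j'' active_exp (RAssign ''b'' (nvar ''a'') n0 (RAdd (rvec ''b'' (nvar ''a''))
        (RSub (RConst 0) (RMul (rvec ''s'' (nvec ''act'' (nvar ''j'')))
           (RCell ''X'' (nvec ''act'' (nvar ''j'')) (nvar ''a''))))))))"

text \<open>
  The weights of active neighbours are added to the vector; those of the other neighbours stay in
  \<open>x\<close>, to be moved to the basis.
\<close>

definition keep_active :: com where
  "keep_active = For ''c'' basis_exp
     (IfNLess n0 (nvec ''isact'' (nvec ''nb'' (nvar ''c'')))
       (Seq (RAssign ''s'' (nvec ''nb'' (nvar ''c'')) n0
              (RAdd (rvec ''s'' (nvec ''nb'' (nvar ''c''))) (rvec ''x'' (nvar ''c''))))
            (RAssign ''x'' (nvar ''c'') n0 (RConst 0)))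
       Skip)"

definition leftover :: com where
  "leftover = For ''a'' basis_exp (Seq (RAssign ''b'' (nvar ''a'') n0 (RConst 0))
     (For ''c'' basis_exp (RAssign ''b'' (nvar ''a'') n0 (RAdd (rvec ''b'' (nvar ''a''))
        (RMul (rvec ''x'' (nvar ''c'')) (RCell ''X'' (nvec ''nb'' (nvar ''c'')) (nvar ''a'')))))))"

definition add_basis :: com where
  "add_basis = For ''c'' basis_exp (RAssign ''s'' (nvec ''bas'' (nvar ''c'')) n0
     (RAdd (rvec ''s'' (nvec ''bas'' (nvar ''c''))) (rvec ''x'' (nvar ''c''))))"

definition update_cell :: com where
  "update_cell = RAssign ''Om'' (nvec ''act'' (nvar ''j'')) (nvec ''act'' (nvar ''k''))
       (RAdd (RCell ''Om'' (nvec ''act'' (nvar ''j'')) (nvec ''act'' (nvar ''k'')))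
         (RMul (rvec ''s'' (nvec ''act'' (nvar ''j''))) (rvec ''s'' (nvec ''act'' (nvar ''k'')))))"

definition update :: com where
  "update = For ''j'' active_exp (For ''k'' active_exp update_cell)"

lemma writes_step [simp]:
  "nat_writes visit = {''nb'', ''cnt''}" "real_writes visit = {}"
  "nat_writes update_cell = {}" "real_writes update_cell = {''Om''}"
  "nat_writes pick = {''i'', ''v'', ''cnt''}" "real_writes pick = {}"
  "nat_writes neighbours = {''q'', ''nb'', ''cnt''}" "real_writes neighbours = {}"
  "nat_writes start = {''j''}" "real_writes start = {''s''}"
  "nat_writes defect = {''a'', ''j''}" "real_writes defect = {''b''}"
  "nat_writes keep_active = {''c''}" "real_writes keep_active = {''s'', ''x''}"
  "nat_writes leftover = {''a'', ''c''}" "real_writes leftover = {''b''}"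
  "nat_writes add_basis = {''c''}" "real_writes add_basis = {''s''}"
  "nat_writes update = {''j'', ''k''}" "real_writes update = {''Om''}"
  by (auto simp: pick_def neighbours_def visit_def start_def defect_def keep_active_def leftover_def
      add_basis_def update_def update_cell_def)

lemma exec_neighbours:
  assumes sz: "nat_mem s ''d'' 0 0 = d" "nat_mem s ''m'' 0 0 = m" "nat_mem s ''n'' 0 0 = n"
    and ord: "\<And>p. p < m + n \<Longrightarrow> nat_mem s ''ord'' p 0 = \<pi> p" and inj: "inj_on \<pi> {..<m + n}"
    and adj: "\<And>p. p < m + n \<Longrightarrow> 0 < nat_mem s ''adj'' (\<pi> p) (nat_mem s ''v'' 0 0) \<longleftrightarrow> E p"
    and z: "nat_mem s ''cnt'' 0 0 = 0"
    and pos: "nat_mem s ''pos'' (nat_mem s ''i'' 0 0) 0 = l" "l \<le> m + n"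
    and many: "Suc d \<le> card {p. p < l \<and> E p}"
  defines "nb \<equiv> \<lambda>c. nat_mem (exec neighbours s) ''nb'' c 0"
  shows "inj_on nb {..<Suc d} \<and> nb ` {..<Suc d} \<subseteq> \<pi> ` {p. p < l \<and> E p}"
proof -
  let ?I = "\<lambda>q M R. M ''cnt'' 0 0 = min (Suc d) (card {p. p < q \<and> p < l \<and> E p}) \<and>
      inj_on (\<lambda>c. M ''nb'' c 0) {..<M ''cnt'' 0 0} \<and>
      (\<lambda>c. M ''nb'' c 0) ` {..<M ''cnt'' 0 0} \<subseteq> \<pi> ` {p. p < q \<and> p < l \<and> E p}"
  have "?I (nval points_exp s) (nat_mem (exec neighbours s)) (real_mem (exec neighbours s))"
    unfolding neighbours_def
  proof (rule For_rule[where I = ?I], goal_cases)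
    case 1
    show ?case by (simp add: z)
  next
    case (2 i v M R)
    have e: "upd M ''q'' 0 0 v ''cnt'' = M ''cnt''" "upd M ''q'' 0 0 v ''nb'' = M ''nb''"
      by simp_all
    show ?case unfolding e by (rule 2)
  next
    case (3 q t)
    have q: "q < m + n" using 3(1) sz by simp
    have t: "nat_mem t ''d'' 0 0 = d" "nat_mem t ''ord'' q 0 = \<pi> q"
      "nat_mem t ''pos'' (nat_mem t ''i'' 0 0) 0 = l"
      "0 < nat_mem t ''adj'' (\<pi> q) (nat_mem t ''v'' 0 0) \<longleftrightarrow> E q"
      using 3(4) sz ord[OF q] pos adj[OF q] by simp_all
    note q3 = 3(3)
    let ?G = "\<lambda>q. {p. p < q \<and> p < l \<and> E p}"
    have G: "?G (Suc q) = (if q < l \<and> E q then insert q (?G q) else ?G q)"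
      by (auto simp: less_Suc_eq)
    have card: "card (?G (Suc q)) = (if q < l \<and> E q then Suc (card (?G q)) else card (?G q))"
      unfolding G by simp
    have upd1: "(\<lambda>i. if i = k then v else f i) = f(k := v)" for f :: "nat \<Rightarrow> nat" and k v by auto
    show ?case
    proof (cases "q < l \<and> E q \<and> nat_mem t ''cnt'' 0 0 < Suc d")
      case True
      define k where "k = nat_mem t ''cnt'' 0 0"
      define f where "f c = nat_mem t ''nb'' c 0" for c
      have k: "k = min (Suc d) (card (?G q))" and f: "inj_on f {..<k}" and sub: "f ` {..<k} \<subseteq> \<pi> ` ?G q"
        using 3(2) unfolding k_def f_def by - (elim conjE, assumption)+
      have kd: "k < Suc d" using True by (simp add: k_def)
      have "\<pi> q \<notin> \<pi> ` {..<q}" using inj_onD[OF inj, of q] q by fastforce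
      moreover have "\<pi> ` ?G q \<subseteq> \<pi> ` {..<q}" by auto
      ultimately have new: "\<pi> q \<notin> f ` {..<k}" using sub by blast
      have 1: "Suc k = min (Suc d) (card (?G (Suc q)))"
        using k kd True unfolding card by simp
      have 2: "inj_on (f(k := \<pi> q)) {..<Suc k}" by (rule inj_on_fun_upd_new[OF f new])
      have 3: "(f(k := \<pi> q)) ` {..<Suc k} \<subseteq> \<pi> ` ?G (Suc q)"
        unfolding image_fun_upd_new using sub True unfolding G by auto
      have e: "nat_mem (exec visit t) ''cnt'' 0 0 = Suc k"
        "(\<lambda>c. nat_mem (exec visit t) ''nb'' c 0) = f(k := \<pi> q)"
        using True t q3 by (auto simp: visit_def k_def f_def fun_eq_iff)
      show ?thesis unfolding e using 1 2 3 by (intro conjI)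
    next
      case False
      have e: "nat_mem (exec visit t) = nat_mem t"
        using False t 3(3) by (auto simp: visit_def)
      have sub: "\<pi> ` ?G q \<subseteq> \<pi> ` ?G (Suc q)" by auto
      have cnt: "nat_mem t ''cnt'' 0 0 = min (Suc d) (card (?G q))" using 3(2) by (rule conjunct1)
      have m: "min (Suc d) (card (?G (Suc q))) = min (Suc d) (card (?G q))"
        using False unfolding card cnt by auto
      show ?thesis unfolding e m
        using 3(2) sub by (intro conjI) (elim conjE, assumption | elim conjE, rule order_trans, assumption+)+
    qed
  qed
  note main = this
  have S: "{p. p < m + n \<and> p < l \<and> E p} = {p. p < l \<and> E p}" using pos(2) by auto
  have nv: "nval points_exp s = m + n" using sz by simp
  have mn: "min (Suc d) (card {p. p < l \<and> E p}) = Suc d" using many by simp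
  have *: "nat_mem (exec neighbours s) ''cnt'' 0 0 = Suc d \<and>
      inj_on nb {..<nat_mem (exec neighbours s) ''cnt'' 0 0} \<and>
      nb ` {..<nat_mem (exec neighbours s) ''cnt'' 0 0} \<subseteq> \<pi> ` {p. p < l \<and> E p}"
    using main unfolding nb_def nv S mn .
  then have "nat_mem (exec neighbours s) ''cnt'' 0 0 = Suc d" by (rule conjunct1)
  from *[unfolded this] show ?thesis by (rule conjunct2)
qed

lemma exec_start:
  assumes sz: "nat_mem s ''d'' 0 0 = d" "nat_mem s ''n'' 0 0 = n"
    and act: "\<And>j. nat_mem s ''act'' j 0 = act j" and inj: "inj_on act {..<n + Suc d}"
    and i: "nat_mem s ''i'' 0 0 = i" "nat_mem s ''v'' 0 0 = act i" "i < n + Suc d"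
    and j: "j < n + Suc d"
  shows "real_mem (exec start s) ''s'' (act j) 0 = (if j = i then 1
    else if j < i \<and> nat_mem s ''adj'' (act j) (act i) = 0 then - real_mem s ''Om'' (act j) (act i)
    else 0)"
proof -
  let ?v = "\<lambda>j. if j < i \<and> nat_mem s ''adj'' (act j) (act i) = 0 then - real_mem s ''Om'' (act j) (act i)
    else 0"
  let ?I = "\<lambda>k R. \<forall>j<k. R ''s'' (act j) 0 = ?v j"
  let ?loop = "For ''j'' active_exp
      (IfNLess (nvar ''j'') (nvar ''i'')
        (IfNLess n0 (NCell ''adj'' (nvec ''act'' (nvar ''j'')) (nvar ''v''))
          (RAssign ''s'' (nvec ''act'' (nvar ''j'')) n0 (RConst 0))
          (RAssign ''s'' (nvec ''act'' (nvar ''j'')) n0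
            (RSub (RConst 0) (RCell ''Om'' (nvec ''act'' (nvar ''j'')) (nvar ''v'')))))
        (RAssign ''s'' (nvec ''act'' (nvar ''j'')) n0 (RConst 0)))"
  have "?I (nval active_exp s) (real_mem (exec ?loop s))"
  proof (rule For_rule_real[where I = ?I], goal_cases)
    case 1
    show ?case by simp
  next
    case (2 j t)
    have j: "j < n + Suc d" using 2(1) sz by simp
    have t: "nat_mem t ''act'' j 0 = act j" "nat_mem t ''i'' 0 0 = i" "nat_mem t ''v'' 0 0 = act i"
      "nat_mem t ''adj'' = nat_mem s ''adj''" "real_mem t ''Om'' = real_mem s ''Om''"
      using 2(4) act i by simp_all
    have "act k \<noteq> act j" if "k < j" for k
      using inj_on_eq_iff[OF inj, of k j] that j by simp
    then show ?case using 2(2,3) t by (auto simp: less_Suc_eq)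
  qed
  moreover have "act j = act i \<longleftrightarrow> j = i" using inj_on_eq_iff[OF inj] i j by simp
  ultimately show ?thesis using sz i j by (auto simp: start_def)
qed

lemma exec_defect:
  assumes sz: "nat_mem s ''d'' 0 0 = d" "nat_mem s ''n'' 0 0 = n"
  shows "\<forall>a<Suc d. real_mem (exec defect s) ''b'' a 0 = - (\<Sum>j<n + Suc d.
     real_mem s ''s'' (nat_mem s ''act'' j 0) 0 * real_mem s ''X'' (nat_mem s ''act'' j 0) a)"
proof -
  let ?v = "\<lambda>a. - (\<Sum>j<n + Suc d.
     real_mem s ''s'' (nat_mem s ''act'' j 0) 0 * real_mem s ''X'' (nat_mem s ''act'' j 0) a)"
  have "\<forall>a<nval basis_exp s. real_mem (exec defect s) ''b'' a 0 = ?v a"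
    unfolding defect_def
  proof (rule For_rule_real[where I = "\<lambda>k R. \<forall>a<k. R ''b'' a 0 = ?v a"], goal_cases)
    case (2 a t)
    then show ?case using assms
      by (auto simp: exec_sum less_Suc_eq sum_negf simp del: sum.lessThan_Suc)
  qed auto
  then show ?thesis using assms by simp
qed

lemma exec_leftover:
  assumes sz: "nat_mem s ''d'' 0 0 = d"
  shows "\<forall>a<Suc d. real_mem (exec leftover s) ''b'' a 0 = (\<Sum>c<Suc d.
     real_mem s ''x'' c 0 * real_mem s ''X'' (nat_mem s ''nb'' c 0) a)"
proof -
  let ?v = "\<lambda>a. \<Sum>c<Suc d. real_mem s ''x'' c 0 * real_mem s ''X'' (nat_mem s ''nb'' c 0) a"
  have "\<forall>a<nval basis_exp s. real_mem (exec leftover s) ''b'' a 0 = ?v a"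
    unfolding leftover_def
  proof (rule For_rule_real[where I = "\<lambda>k R. \<forall>a<k. R ''b'' a 0 = ?v a"], goal_cases)
    case (2 a t)
    then show ?case using assms
      by (auto simp: exec_sum less_Suc_eq simp del: sum.lessThan_Suc)
  qed auto
  then show ?thesis using assms by simp
qed

lemma exec_keep_active:
  assumes sz: "nat_mem s ''d'' 0 0 = d"
  defines "A \<equiv> \<lambda>c. 0 < nat_mem s ''isact'' (nat_mem s ''nb'' c 0) 0"
  shows "(\<forall>u. real_mem (exec keep_active s) ''s'' u 0 = real_mem s ''s'' u 0 +
      (\<Sum>c<Suc d. if A c \<and> nat_mem s ''nb'' c 0 = u then real_mem s ''x'' c 0 else 0)) \<and>
     (\<forall>c<Suc d. real_mem (exec keep_active s) ''x'' c 0 = (if A c then 0 else real_mem s ''x'' c 0))"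
proof -
  let ?I = "\<lambda>k R. (\<forall>u. R ''s'' u 0 = real_mem s ''s'' u 0 +
      (\<Sum>c<k. if A c \<and> nat_mem s ''nb'' c 0 = u then real_mem s ''x'' c 0 else 0)) \<and>
     (\<forall>c. R ''x'' c 0 = (if c < k \<and> A c then 0 else real_mem s ''x'' c 0))"
  have "?I (nval basis_exp s) (real_mem (exec keep_active s))"
    unfolding keep_active_def
  proof (rule For_rule_real[where I = ?I], goal_cases)
    case 1
    show ?case by simp
  next
    case (2 c t)
    have t: "nat_mem t ''nb'' = nat_mem s ''nb''"
      "nat_mem t ''isact'' = nat_mem s ''isact''" using 2(4) by simp_all
    have x: "real_mem t ''x'' c 0 = real_mem s ''x'' c 0" using 2(2) by simp
    show ?case
    proof (cases "A c")
      case True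
      then have "0 < nat_mem s ''isact'' (nat_mem s ''nb'' c 0) 0" by (simp add: A_def)
      then show ?thesis using 2(2,3) t x True by (auto simp: less_Suc_eq)
    next
      case False
      then have "nat_mem s ''isact'' (nat_mem s ''nb'' c 0) 0 = 0" by (simp add: A_def)
      then show ?thesis using 2(2,3) t x False by (auto simp: less_Suc_eq)
    qed
  qed
  then show ?thesis using assms(1) by simp
qed

lemma exec_add_basis:
  assumes sz: "nat_mem s ''d'' 0 0 = d"
  shows "real_mem (exec add_basis s) ''s'' u 0 = real_mem s ''s'' u 0 +
      (\<Sum>c<Suc d. if nat_mem s ''bas'' c 0 = u then real_mem s ''x'' c 0 else 0)"
proof -
  let ?I = "\<lambda>k R. \<forall>u. R ''s'' u 0 = real_mem s ''s'' u 0 +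
      (\<Sum>c<k. if nat_mem s ''bas'' c 0 = u then real_mem s ''x'' c 0 else 0)"
  have "?I (nval basis_exp s) (real_mem (exec add_basis s))"
    unfolding add_basis_def
  proof (rule For_rule_real[where I = ?I], goal_cases)
    case 1
    show ?case by simp
  next
    case (2 c t)
    have "nat_mem t ''bas'' = nat_mem s ''bas''" "real_mem t ''x'' = real_mem s ''x''"
      using 2(4) by simp_all
    then show ?case using 2(2,3) by auto
  qed
  then show ?thesis using sz by simp
qed

text \<open>The active vertices are distinct, so no entry is changed twice.\<close>

lemma exec_update:
  assumes sz: "nat_mem s ''d'' 0 0 = d" "nat_mem s ''n'' 0 0 = n"
    and act: "\<And>j. nat_mem s ''act'' j 0 = act j" and inj: "inj_on act {..<n + Suc d}"
    and jk: "j < n + Suc d" "k < n + Suc d"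
  shows "real_mem (exec update s) ''Om'' (act j) (act k) =
    real_mem s ''Om'' (act j) (act k) + real_mem s ''s'' (act j) 0 * real_mem s ''s'' (act k) 0"
proof -
  let ?old = "\<lambda>j k. real_mem s ''Om'' (act j) (act k)"
  let ?new = "\<lambda>j k. ?old j k + real_mem s ''s'' (act j) 0 * real_mem s ''s'' (act k) 0"
  have ne: "act j = act k \<longleftrightarrow> j = k" if "j < n + Suc d" "k < n + Suc d" for j k
    using inj_on_eq_iff[OF inj] that by simp
  let ?I = "\<lambda>l R. \<forall>j<n + Suc d. \<forall>k<n + Suc d. R ''Om'' (act j) (act k) =
      (if j < l then ?new j k else ?old j k)"
  have "?I (nval active_exp s) (real_mem (exec update s))"
    unfolding update_def
  proof (rule For_rule_real[where I = ?I], goal_cases)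
    case 1
    show ?case by simp
  next
    case (2 l t)
    have l: "l < n + Suc d" using 2(1) sz by simp
    let ?J = "\<lambda>q R. \<forall>j<n + Suc d. \<forall>k<n + Suc d. R ''Om'' (act j) (act k) =
      (if j < l \<or> j = l \<and> k < q then ?new j k else ?old j k)"
    let ?loop = "For ''k'' active_exp update_cell"
    have "?J (nval active_exp t) (real_mem (exec ?loop t))"
    proof (rule For_rule_real[where I = ?J], goal_cases)
      case 1
      show ?case using 2(2) by simp
    next
      case (2 q u)
      have q: "q < n + Suc d" using 2(1) \<open>frame _ _ s t\<close> sz by simp
      have u: "nat_mem u ''j'' 0 0 = l" "\<And>j. nat_mem u ''act'' j 0 = act j"
        "real_mem u ''s'' = real_mem s ''s''"
        using 2(4) \<open>frame _ _ s t\<close> \<open>nat_mem t ''j'' 0 0 = l\<close> act by simp_all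
      have "real_mem u ''Om'' (act l) (act q) = ?old l q" using 2(2) l q by simp
      then have e: "real_mem (exec update_cell u) = upd (real_mem u) ''Om'' (act l) (act q) (?new l q)"
        using 2(3) u by (simp add: update_cell_def)
      show ?case unfolding e
      proof (intro allI impI)
        fix j k assume jk: "j < n + Suc d" "k < n + Suc d"
        show "upd (real_mem u) ''Om'' (act l) (act q) (?new l q) ''Om'' (act j) (act k) =
          (if j < l \<or> j = l \<and> k < Suc q then ?new j k else ?old j k)"
        proof (cases "j = l \<and> k = q")
          case True
          then show ?thesis by simp
        next
          case False
          then have "\<not> (act j = act l \<and> act k = act q)" using ne jk l q by blast
          then have "upd (real_mem u) ''Om'' (act l) (act q) (?new l q) ''Om'' (act j) (act k) =
            real_mem u ''Om'' (act j) (act k)" by auto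
          also have "\<dots> = (if j < l \<or> j = l \<and> k < q then ?new j k else ?old j k)"
            using 2(2) jk by blast
          also have "(j < l \<or> j = l \<and> k < q) = (j < l \<or> j = l \<and> k < Suc q)" using False by auto
          finally show ?thesis .
        qed
      qed
    qed
    moreover have "nval active_exp t = n + Suc d" using 2(4) sz by simp
    ultimately have J: "?J (n + Suc d) (real_mem (exec ?loop t))" by (simp only:)
    show ?case
    proof (intro allI impI)
      fix j k assume jk: "j < n + Suc d" "k < n + Suc d"
      then have "j < l \<or> j = l \<and> k < n + Suc d \<longleftrightarrow> j < Suc l" by auto
      then show "real_mem (exec ?loop t) ''Om'' (act j) (act k) =
          (if j < Suc l then ?new j k else ?old j k)"
        using J jk by presburger
    qed
  qed
  then show ?thesis using sz jk by simp
qed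

section \<open>Assembling the stress matrix\<close>

definition sensor_row :: com where
  "sensor_row = For ''j'' (nvar ''n'')
     (RAssign ''S'' (NAdd dim_exp (nvar ''i'')) (NAdd dim_exp (nvar ''j''))
        (RCell ''Om'' (NAdd (nvar ''m'') (nvar ''i'')) (NAdd (nvar ''m'') (nvar ''j''))))"

definition mixed_sum :: com where
  "mixed_sum = Seq (RAssign ''T'' (nvar ''a'') (nvar ''j'') (RConst 0))
     (For ''i'' (nvar ''n'') (RAssign ''T'' (nvar ''a'') (nvar ''j'')
       (RAdd (RCell ''T'' (nvar ''a'') (nvar ''j''))
         (RSub (RConst 0) (RMul (RCell ''P'' (nvar ''a'') (nvar ''i''))
           (RCell ''Om'' (NAdd (nvar ''m'') (nvar ''i'')) (NAdd (nvar ''m'') (nvar ''j''))))))))"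

definition mixed_entry :: com where
  "mixed_entry = Seq mixed_sum
     (Seq (RAssign ''S'' (nvar ''a'') (NAdd dim_exp (nvar ''j'')) (RCell ''T'' (nvar ''a'') (nvar ''j'')))
          (RAssign ''S'' (NAdd dim_exp (nvar ''j'')) (nvar ''a'') (RCell ''T'' (nvar ''a'') (nvar ''j''))))"

definition corner_entry :: com where
  "corner_entry = Seq (RAssign ''S'' (nvar ''a'') (nvar ''k'') (RConst 0))
     (For ''j'' (nvar ''n'') (RAssign ''S'' (nvar ''a'') (nvar ''k'')
       (RAdd (RCell ''S'' (nvar ''a'') (nvar ''k''))
         (RSub (RConst 0) (RMul (RCell ''T'' (nvar ''a'') (nvar ''j''))
           (RCell ''P'' (nvar ''k'') (nvar ''j'')))))))"

text \<open>
  The blocks of \<open>L W L\<^sup>T\<close> for \<open>L = (-P; I)\<close>. The upper left block reuses \<open>T = -P W\<close>, which keeps the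
  cost at \<open>O(n\<^sup>2 d + n d\<^sup>2)\<close>.
\<close>

definition write_output :: com where
  "write_output = Seq (For ''i'' (nvar ''n'') sensor_row)
     (Seq (For ''a'' dim_exp (For ''j'' (nvar ''n'') mixed_entry))
          (For ''a'' dim_exp (For ''k'' dim_exp corner_entry)))"

lemma writes_output [simp]:
  "nat_writes sensor_row = {''j''}" "real_writes sensor_row = {''S''}"
  "nat_writes mixed_sum = {''i''}" "real_writes mixed_sum = {''T''}"
  "nat_writes mixed_entry = {''i''}" "real_writes mixed_entry = {''S'', ''T''}"
  "nat_writes corner_entry = {''j''}" "real_writes corner_entry = {''S''}"
  by (auto simp: sensor_row_def mixed_sum_def mixed_entry_def corner_entry_def)

lemma exec_write_output:
  assumes sz: "nat_mem s ''d'' 0 0 = d" "nat_mem s ''m'' 0 0 = m" "nat_mem s ''n'' 0 0 = n"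
  defines "W \<equiv> \<lambda>i j. real_mem s ''Om'' (m + i) (m + j)" and "P \<equiv> real_mem s ''P''"
  defines "T \<equiv> \<lambda>a j. - (\<Sum>i<n. P a i * W i j)"
  defines "S \<equiv> real_mem (exec write_output s) ''S''"
  shows "(\<forall>i<n. \<forall>j<n. S (d + i) (d + j) = W i j) \<and>
    (\<forall>a<d. \<forall>j<n. S a (d + j) = T a j \<and> S (d + j) a = T a j) \<and>
    (\<forall>a<d. \<forall>k<d. S a k = - (\<Sum>j<n. T a j * P k j))"
proof -
  let ?c1 = "For ''i'' (nvar ''n'') sensor_row"
  let ?c2 = "For ''a'' dim_exp (For ''j'' (nvar ''n'') mixed_entry)"
  let ?c3 = "For ''a'' dim_exp (For ''k'' dim_exp corner_entry)"
  define s1 where "s1 = exec ?c1 s"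
  define s2 where "s2 = exec ?c2 s1"
  have out: "exec write_output s = exec ?c3 s2" by (simp add: write_output_def s1_def s2_def)
  have n1: "nat_mem s1 y = nat_mem s y" if "y \<notin> {''i'', ''j''}" for y using that by (simp add: s1_def)
  have r1: "real_mem s1 y = real_mem s y" if "y \<noteq> ''S''" for y using that by (simp add: s1_def)
  have n2: "nat_mem s2 y = nat_mem s y" if "y \<notin> {''i'', ''j'', ''a''}" for y
    using that n1 by (simp add: s2_def)
  have r2: "real_mem s2 y = real_mem s y" if "y \<notin> {''S'', ''T''}" for y
    using that r1 by (simp add: s2_def)
  have S1: "\<forall>i<n. \<forall>j<n. real_mem s1 ''S'' (d + i) (d + j) = W i j"
  proof -
    have "\<forall>i<nval (nvar ''n'') s. \<forall>j<n. real_mem s1 ''S'' (d + i) (d + j) = W i j"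
      unfolding s1_def
    proof (rule For_rule_real[where I = "\<lambda>k R. \<forall>i<k. \<forall>j<n. R ''S'' (d + i) (d + j) = W i j"], goal_cases)
      case 1
      show ?case by simp
    next
      case (2 i t)
      let ?J = "\<lambda>k R. (\<forall>j<k. R ''S'' (d + i) (d + j) = W i j) \<and>
         (\<forall>i'. i' \<noteq> d + i \<longrightarrow> R ''S'' i' = real_mem t ''S'' i')"
      have "?J (nval (nvar ''n'') t) (real_mem (exec sensor_row t))"
        unfolding sensor_row_def
      proof (rule For_rule_real[where I = ?J], goal_cases)
        case 1
        show ?case by simp
      next
        case (2 j u)
        have "nat_mem u ''d'' 0 0 = d" "nat_mem u ''m'' 0 0 = m" "nat_mem u ''i'' 0 0 = i"
          "real_mem u ''Om'' = real_mem s ''Om''"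
          using 2(4) \<open>nat_mem t ''i'' 0 0 = i\<close> \<open>frame _ _ s t\<close> sz by simp_all
        then show ?case using 2(2,3) by (auto simp: less_Suc_eq upd_def W_def)
      qed
      moreover have "nval (nvar ''n'') t = n" using 2(4) sz by simp
      ultimately show ?case using 2(2) by (auto simp: less_Suc_eq)
    qed
    then show ?thesis using sz by simp
  qed
  let ?I2 = "\<lambda>k R. (\<forall>a<k. \<forall>j<n. R ''T'' a j = T a j \<and> R ''S'' a (d + j) = T a j \<and> R ''S'' (d + j) a = T a j) \<and>
     (\<forall>i j. R ''S'' (d + i) (d + j) = real_mem s1 ''S'' (d + i) (d + j))"
  have "?I2 (nval dim_exp s1) (real_mem s2)"
    unfolding s2_def
  proof (rule For_rule_real[where I = ?I2], goal_cases)
    case 1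
    show ?case by simp
  next
    case (2 a t)
    have a: "a < d" using 2(1) n1 sz by simp
    let ?J = "\<lambda>k R. (\<forall>j<n. \<forall>a'\<le>a. a' < a \<or> j < k \<longrightarrow>
           R ''T'' a' j = T a' j \<and> R ''S'' a' (d + j) = T a' j \<and> R ''S'' (d + j) a' = T a' j) \<and>
       (\<forall>i j. R ''S'' (d + i) (d + j) = real_mem s1 ''S'' (d + i) (d + j))"
    have "?J (nval (nvar ''n'') t) (real_mem (exec (For ''j'' (nvar ''n'') mixed_entry) t))"
    proof (rule For_rule_real[where I = ?J], goal_cases)
      case 1
      show ?case using 2(2) by auto
    next
      case (2 j u)
      have u: "nat_mem u ''d'' 0 0 = d" "nat_mem u ''m'' 0 0 = m" "nat_mem u ''n'' 0 0 = n"
        "nat_mem u ''a'' 0 0 = a" "nat_mem u ''j'' 0 0 = j"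
        "real_mem u ''Om'' = real_mem s ''Om''" "real_mem u ''P'' = P"
        using 2(3,4) \<open>nat_mem t ''a'' 0 0 = a\<close> \<open>frame _ _ s1 t\<close> sz by (simp_all add: n1 r1 P_def)
      have "real_mem (exec mixed_sum u) = upd (real_mem u) ''T'' a j (T a j)"
        using u by (simp add: mixed_sum_def exec_sum upd_upd T_def W_def sum_negf)
      then have e: "real_mem (exec mixed_entry u) = upd (upd (upd (real_mem u) ''T'' a j (T a j))
          ''S'' a (d + j) (T a j)) ''S'' (d + j) a (T a j)"
        using u by (simp add: mixed_entry_def)
      show ?case unfolding e using 2(2) a by (auto simp: less_Suc_eq le_less)
    qed
    moreover have "nval (nvar ''n'') t = n" using 2(4) n1 sz by simp
    ultimately show ?case by (auto simp: less_Suc_eq)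
  qed
  then have S2: "\<forall>a<d. \<forall>j<n. real_mem s2 ''T'' a j = T a j \<and> real_mem s2 ''S'' a (d + j) = T a j \<and>
      real_mem s2 ''S'' (d + j) a = T a j"
    "\<forall>i<n. \<forall>j<n. real_mem s2 ''S'' (d + i) (d + j) = W i j"
    using S1 n1 sz by simp_all
  let ?v = "\<lambda>a k. - (\<Sum>j<n. T a j * P k j)"
  let ?I3 = "\<lambda>l R. (\<forall>a<l. \<forall>k<d. R ''S'' a k = ?v a k) \<and>
     (\<forall>i j. d \<le> i \<or> d \<le> j \<longrightarrow> R ''S'' i j = real_mem s2 ''S'' i j)"
  have "?I3 (nval dim_exp s2) (real_mem (exec ?c3 s2))"
  proof (rule For_rule_real[where I = ?I3], goal_cases)
    case 1
    show ?case by simp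
  next
    case (2 a t)
    have a: "a < d" using 2(1) n2 sz by simp
    let ?J = "\<lambda>l R. (\<forall>a'\<le>a. \<forall>k<d. a' < a \<or> k < l \<longrightarrow> R ''S'' a' k = ?v a' k) \<and>
     (\<forall>i j. d \<le> i \<or> d \<le> j \<longrightarrow> R ''S'' i j = real_mem s2 ''S'' i j)"
    have "?J (nval dim_exp t) (real_mem (exec (For ''k'' dim_exp corner_entry) t))"
    proof (rule For_rule_real[where I = ?J], goal_cases)
      case 1
      show ?case using 2(2) by auto
    next
      case (2 k u)
      have k: "k < d" using 2(1) \<open>frame _ _ s2 t\<close> n2 sz by simp
      have u: "nat_mem u ''n'' 0 0 = n"
        "nat_mem u ''a'' 0 0 = a" "nat_mem u ''k'' 0 0 = k"
        "real_mem u ''T'' = real_mem s2 ''T''" "real_mem u ''P'' = P"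
        using 2(3,4) \<open>nat_mem t ''a'' 0 0 = a\<close> \<open>frame _ _ s2 t\<close> sz by (simp_all add: n2 r2 P_def)
      have "real_mem (exec corner_entry u) = upd (real_mem u) ''S'' a k (\<Sum>j<n. - (real_mem s2 ''T'' a j * P k j))"
        using u by (simp add: corner_entry_def exec_sum upd_upd)
      also have "(\<Sum>j<n. - (real_mem s2 ''T'' a j * P k j)) = ?v a k"
        using S2 a by (simp add: sum_negf)
      finally have e: "real_mem (exec corner_entry u) = upd (real_mem u) ''S'' a k (?v a k)" .
      show ?case unfolding e using 2(2) a k by (auto simp: less_Suc_eq le_less)
    qed
    moreover have "nval dim_exp t = d" using 2(4) n2 sz by simp
    ultimately show ?case by (auto simp: less_Suc_eq)
  qed
  then show ?thesis using S2 n2 sz by (simp add: S_def out)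
qed

section \<open>From a stress on the sensors to an optimal dual stress matrix\<close>

(* Sums against an indicator are to be evaluated at its point instead. *)
declare sum_of_bool_eq [simp del] sum_mult_of_bool_eq [simp del] sum_of_bool_mult_eq [simp del]

lemma sum_lessThan_add:
  fixes f :: "nat \<Rightarrow> real"
  shows "(\<Sum>x<d + n. f x) = (\<Sum>a<d. f a) + (\<Sum>j<n. f (d + j))"
  by (induction n) simp_all

text \<open>The extra coordinate 1 turns affine dependence of points into linear dependence.\<close>

definition homogeneous :: "network \<Rightarrow> nat \<Rightarrow> nat \<Rightarrow> real" where
  "homogeneous N v a = (if a < space_dim N
     then if v < num_anchors N then anchor_pos N $$ (a, v) else sensor_pos N $$ (a, v - num_anchors N)
     else 1)"

text \<open>The rank is subadditive, and each product contributes at most 1.\<close>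

lemma rank_sum_products:
  fixes F G :: "nat \<Rightarrow> nat \<Rightarrow> real"
  shows "vec_space.rank M (mat M M (\<lambda>(u, v). \<Sum>i<k. F u i * G i v)) \<le> k"
proof (induction k)
  case 0
  have eq: "mat M M (\<lambda>(u, v). \<Sum>i<0. F u i * G i v) = 0\<^sub>m M M" by (intro eq_matI) auto
  show ?case unfolding eq vec_space.rank_0I ..
next
  case (Suc k)
  let ?A = "mat M M (\<lambda>(u, v). \<Sum>i<k. F u i * G i v)"
  let ?B = "mat M M (\<lambda>(u, v). F u k * G k v)"
  have eq: "mat M M (\<lambda>(u, v). \<Sum>i<Suc k. F u i * G i v) = ?A + ?B"
    by (intro eq_matI) auto
  have "vec_space.rank M (?A + ?B) \<le> vec_space.rank M ?A + vec_space.rank M ?B"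
    by (rule vec_space.rank_subadditive[where nc = M]) simp_all
  moreover have "vec_space.rank M ?B \<le> 1"
    by (rule vec_space.rank_le_1_product_entries[where nc = M and f = "\<lambda>u. F u k" and g = "G k"])
      simp_all
  ultimately show ?case using Suc unfolding eq by simp
qed

lemma outer_form:
  fixes v Y :: "nat \<Rightarrow> real"
  shows "(\<Sum>x<K. \<Sum>y<K. Y x * (v x * v y) * Y y) = (\<Sum>x<K. Y x * v x)\<^sup>2"
  unfolding power2_eq_square sum_product by (intro sum.cong refl) (simp add: algebra_simps)

text \<open>
  What makes a matrix on the sensors the lower right block of an optimal dual stress matrix of rank
  \<open>n\<close>. The condition with anchors says that the weighted extended positions of the sensors, taken
  from the column of sensor \<open>j\<close>, can be balanced by weights on the anchors adjacent to \<open>j\<close>.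
\<close>

locale stressed_network =
  fixes N :: network and W :: "nat \<Rightarrow> nat \<Rightarrow> real"
  assumes net: "sensor_network N"
    and W_sym: "\<And>i j. W i j = W j i"
    and W_zero: "\<And>i j. i < num_sensors N \<Longrightarrow> j < num_sensors N \<Longrightarrow> i \<noteq> j \<Longrightarrow>
        {num_anchors N + i, num_anchors N + j} \<notin> edges N \<Longrightarrow> W i j = 0"
    and W_anchored: "\<And>j. j < num_sensors N \<Longrightarrow>
        \<exists>w. (\<forall>u. w u \<noteq> 0 \<longrightarrow> {u, num_anchors N + j} \<in> edges N) \<and>
          (\<forall>a<Suc (space_dim N). (\<Sum>i<num_sensors N. W i j * homogeneous N (num_anchors N + i) a) =
             (\<Sum>u<num_anchors N. w u * homogeneous N u a))"
    and W_nonneg: "\<And>x. 0 \<le> (\<Sum>i<num_sensors N. \<Sum>j<num_sensors N. x i * W i j * x j)"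
    and W_definite: "\<And>x i. (\<Sum>i<num_sensors N. \<Sum>j<num_sensors N. x i * W i j * x j) = 0 \<Longrightarrow>
        i < num_sensors N \<Longrightarrow> x i = 0"
begin

abbreviation "d \<equiv> space_dim N"
abbreviation "m \<equiv> num_anchors N"
abbreviation "n \<equiv> num_sensors N"
abbreviation P :: "nat \<Rightarrow> nat \<Rightarrow> real" where "P a i \<equiv> sensor_pos N $$ (a, i)"
abbreviation Q :: "nat \<Rightarrow> nat \<Rightarrow> real" where "Q a k \<equiv> anchor_pos N $$ (a, k)"

text \<open>The matrix \<open>L = (-P; I)\<close>.\<close>

definition lift :: "nat \<Rightarrow> nat \<Rightarrow> real" where
  "lift x i = (if x < d then - P x i else of_bool (x - d = i))"

lemma lift_sensor: "lift (d + j) i = of_bool (j = i)"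
  by (simp add: lift_def)

definition entry :: "nat \<Rightarrow> nat \<Rightarrow> real" where
  "entry x y = (\<Sum>i<n. lift x i * (\<Sum>j<n. W i j * lift y j))"

definition stress_mat :: "real mat" where
  "stress_mat = mat (d + n) (d + n) (\<lambda>(x, y). entry x y)"

lemma dims: "sensor_pairs N \<subseteq> {(i, j). i < j \<and> j < n}"
    "anchor_sensor_pairs N \<subseteq> {..<m} \<times> {..<n}" "anchor_pairs N \<subseteq> {(k, l). k < l \<and> l < m}"
    "anchor_pos N \<in> carrier_mat d m" "sensor_pos N \<in> carrier_mat d n"
  using net unfolding sensor_network_def Let_def by - (elim conjE, assumption)+

lemma pair_less: "(i, j) \<in> sensor_pairs N \<Longrightarrow> i < n" "(i, j) \<in> sensor_pairs N \<Longrightarrow> j < n"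
    "(k, j) \<in> anchor_sensor_pairs N \<Longrightarrow> k < m" "(k, j) \<in> anchor_sensor_pairs N \<Longrightarrow> j < n"
  using dims(1,2) by fastforce+

lemma pair_order: "(i, j) \<in> sensor_pairs N \<Longrightarrow> i < j"
  using dims(1) by auto

lemma pair_asym: "(i, j) \<in> sensor_pairs N \<Longrightarrow> (j, i) \<notin> sensor_pairs N"
  using pair_order[of i j] pair_order[of j i] by auto

lemma sum_delta_left:
  assumes "i < n"
  shows "(\<Sum>j<n. f j * of_bool (j = i)) = (f i :: real)"
proof -
  have "(\<Sum>j<n. f j * of_bool (j = i)) = (\<Sum>j<n. if j = i then f j else 0)"
    by (rule sum.cong) auto
  then show ?thesis using assms by simp
qed

lemma sum_delta_right:
  assumes "i < n"
  shows "(\<Sum>j<n. f j * of_bool (i = j)) = (f i :: real)"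
  unfolding eq_commute[of i] by (rule sum_delta_left[OF assms])

lemma entry_sensor: "i < n \<Longrightarrow> j < n \<Longrightarrow> entry (d + i) (d + j) = W i j"
proof -
  assume ij: "i < n" "j < n"
  have "entry (d + i) (d + j) = (\<Sum>i'<n. (\<Sum>j'<n. W i' j' * of_bool (j = j')) * of_bool (i = i'))"
    unfolding entry_def lift_def by (simp add: mult.commute)
  then show ?thesis using ij by (simp add: sum_delta_right)
qed

lemma entry_mixed: "j < n \<Longrightarrow> a < d \<Longrightarrow> entry a (d + j) = - (\<Sum>i<n. P a i * W i j)"
proof -
  assume *: "j < n" "a < d"
  have "entry a (d + j) = (\<Sum>i<n. - P a i * (\<Sum>j'<n. W i j' * of_bool (j = j')))"
    unfolding entry_def lift_def using * by simp
  then show ?thesis using * by (simp add: sum_delta_right sum_negf)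
qed

lemma entry_sym: "entry x y = entry y x"
proof -
  have "entry x y = (\<Sum>i<n. \<Sum>j<n. lift x i * (W i j * lift y j))"
    unfolding entry_def sum_distrib_left ..
  also have "\<dots> = (\<Sum>j<n. \<Sum>i<n. lift x i * (W i j * lift y j))" by (rule sum.swap)
  also have "\<dots> = entry y x"
    unfolding entry_def sum_distrib_left
  proof (intro sum.cong refl)
    fix i j
    show "lift x i * (W i j * lift y j) = lift y j * (W j i * lift x i)"
      using W_sym[of i j] by (simp add: algebra_simps)
  qed
  finally show ?thesis .
qed

lemma entry_dim: "a < d \<Longrightarrow> k < d \<Longrightarrow> entry a k = - (\<Sum>j<n. - (\<Sum>i<n. P a i * W i j) * P k j)"
proof -
  assume ak: "a < d" "k < d"
  have "entry a k = (\<Sum>i<n. \<Sum>j<n. P a i * (W i j * P k j))"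
    unfolding entry_def lift_def sum_distrib_left using ak by simp
  also have "\<dots> = (\<Sum>j<n. \<Sum>i<n. P a i * (W i j * P k j))" by (rule sum.swap)
  also have "\<dots> = - (\<Sum>j<n. - (\<Sum>i<n. P a i * W i j) * P k j)"
    by (simp add: sum_negf sum_distrib_right mult.assoc)
  finally show ?thesis .
qed

lemma entry_form:
  "(\<Sum>x<d + n. \<Sum>y<d + n. f x * entry x y * f y) =
     (\<Sum>i<n. \<Sum>j<n. (\<Sum>x<d + n. f x * lift x i) * W i j * (\<Sum>x<d + n. f x * lift x j))"
proof -
  have 1: "(\<Sum>y<d + n. entry x y * f y) = (\<Sum>i<n. lift x i * (\<Sum>j<n. W i j * (\<Sum>y<d + n. f y * lift y j)))" for x
  proof -
    have "(\<Sum>y<d + n. entry x y * f y) = (\<Sum>y<d + n. \<Sum>i<n. lift x i * (\<Sum>j<n. W i j * (f y * lift y j)))"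
      unfolding entry_def sum_distrib_right sum_distrib_left
      by (intro sum.cong refl) (simp add: algebra_simps)
    also have "\<dots> = (\<Sum>i<n. \<Sum>y<d + n. lift x i * (\<Sum>j<n. W i j * (f y * lift y j)))"
      by (rule sum.swap)
    also have "\<dots> = (\<Sum>i<n. lift x i * (\<Sum>j<n. W i j * (\<Sum>y<d + n. f y * lift y j)))"
    proof (rule sum.cong[OF refl])
      fix i
      have "(\<Sum>y<d + n. lift x i * (\<Sum>j<n. W i j * (f y * lift y j))) =
          lift x i * (\<Sum>y<d + n. \<Sum>j<n. W i j * (f y * lift y j))" by (simp only: sum_distrib_left)
      also have "(\<Sum>y<d + n. \<Sum>j<n. W i j * (f y * lift y j)) = (\<Sum>j<n. \<Sum>y<d + n. W i j * (f y * lift y j))"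
        by (rule sum.swap)
      finally show "(\<Sum>y<d + n. lift x i * (\<Sum>j<n. W i j * (f y * lift y j))) =
          lift x i * (\<Sum>j<n. W i j * (\<Sum>y<d + n. f y * lift y j))" by (simp only: sum_distrib_left)
    qed
    finally show ?thesis .
  qed
  have "(\<Sum>x<d + n. \<Sum>y<d + n. f x * entry x y * f y) = (\<Sum>x<d + n. f x * (\<Sum>y<d + n. entry x y * f y))"
    by (simp only: sum_distrib_left mult.assoc)
  also have "\<dots> = (\<Sum>x<d + n. \<Sum>i<n. f x * lift x i * (\<Sum>j<n. W i j * (\<Sum>y<d + n. f y * lift y j)))"
    unfolding 1 by (simp only: sum_distrib_left mult.assoc)
  also have "\<dots> = (\<Sum>i<n. \<Sum>x<d + n. f x * lift x i * (\<Sum>j<n. W i j * (\<Sum>y<d + n. f y * lift y j)))"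
    by (rule sum.swap)
  also have "\<dots> = (\<Sum>i<n. \<Sum>j<n. (\<Sum>x<d + n. f x * lift x i) * W i j * (\<Sum>x<d + n. f x * lift x j))"
    by (simp only: sum_distrib_right[symmetric]) (simp only: sum_distrib_left mult.assoc)
  finally show ?thesis .
qed

lemma quadratic_form:
  fixes A :: "real mat" and x :: "real vec"
  assumes A: "A \<in> carrier_mat K K" and x: "x \<in> carrier_vec K"
  shows "x \<bullet> (A *\<^sub>v x) = (\<Sum>i<K. \<Sum>j<K. x $ i * A $$ (i, j) * x $ j)"
  using assms
  by (auto simp: scalar_prod_def atLeast0LessThan sum_distrib_left mult.assoc intro!: sum.cong)

lemma stress_mat_carrier: "stress_mat \<in> carrier_mat (d + n) (d + n)"
  by (simp add: stress_mat_def)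

lemma stress_mat_index: "x < d + n \<Longrightarrow> y < d + n \<Longrightarrow> stress_mat $$ (x, y) = entry x y"
  by (simp add: stress_mat_def)

lemma stress_mat_quadratic:
  assumes x: "x \<in> carrier_vec (d + n)"
  shows "x \<bullet> (stress_mat *\<^sub>v x) =
     (\<Sum>i<n. \<Sum>j<n. (\<Sum>k<d + n. x $ k * lift k i) * W i j * (\<Sum>k<d + n. x $ k * lift k j))"
  unfolding quadratic_form[OF stress_mat_carrier x] entry_form[symmetric]
  by (intro sum.cong refl) (simp add: stress_mat_index)

lemma stress_mat_psd: "psd stress_mat"
  unfolding psd_def
proof (intro conjI ballI)
  show "square_mat stress_mat" by (simp add: stress_mat_def)
  show "transpose_mat stress_mat = stress_mat"
    by (intro eq_matI) (auto simp: stress_mat_def entry_sym)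
  fix x :: "real vec" assume "x \<in> carrier_vec (dim_row stress_mat)"
  then have "x \<in> carrier_vec (d + n)" by (simp add: stress_mat_def)
  then show "0 \<le> x \<bullet> (stress_mat *\<^sub>v x)"
    by (simp only: stress_mat_quadratic W_nonneg)
qed

text \<open>The rows of \<open>[I P]\<close>, of which \<open>Z\<close> is the Gram matrix.\<close>

definition conf :: "nat \<Rightarrow> nat \<Rightarrow> real" where
  "conf a x = (if x < d then of_bool (x = a) else P a (x - d))"

lemma sum_conf: "a < d \<Longrightarrow> (\<Sum>x<d + n. conf a x * f x) = f a + (\<Sum>j<n. P a j * f (d + j))"
proof -
  assume a: "a < d"
  have "(\<Sum>x<d. conf a x * f x) = (\<Sum>x<d. if x = a then f x else 0)"
    by (intro sum.cong refl) (auto simp: conf_def)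
  then show ?thesis using a by (simp add: sum_lessThan_add conf_def)
qed

lemma conf_lift: "a < d \<Longrightarrow> i < n \<Longrightarrow> (\<Sum>x<d + n. conf a x * lift x i) = 0"
  by (simp add: sum_conf lift_def sum_delta_left)

lemma conf_entry: "a < d \<Longrightarrow> (\<Sum>x<d + n. conf a x * entry x y) = 0"
proof -
  assume a: "a < d"
  have "(\<Sum>x<d + n. conf a x * entry x y) =
      (\<Sum>x<d + n. \<Sum>i<n. conf a x * lift x i * (\<Sum>j<n. W i j * lift y j))"
    unfolding entry_def by (simp only: sum_distrib_left mult.assoc)
  also have "\<dots> = (\<Sum>i<n. \<Sum>x<d + n. conf a x * lift x i * (\<Sum>j<n. W i j * lift y j))"
    by (rule sum.swap)
  also have "\<dots> = 0"
    unfolding sum_distrib_right[symmetric] by (rule sum.neutral) (use conf_lift a in auto)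
  finally show ?thesis .
qed

lemma gram_carrier: "position_gram N \<in> carrier_mat (d + n) (d + n)"
  using dims unfolding position_gram_def Let_def by auto

lemma gram_index:
  assumes "x < d + n" "y < d + n"
  shows "position_gram N $$ (x, y) = (\<Sum>a<d. conf a x * conf a y)"
proof -
  have delta: "(\<Sum>a<d. of_bool (x = a) * f a) = (f x :: real)" if "x < d" for x f
  proof -
    have "(\<Sum>a<d. of_bool (x = a) * f a) = (\<Sum>a<d. if a = x then f a else 0)"
      by (intro sum.cong refl) auto
    then show ?thesis using that by simp
  qed
  have c: "dim_row (sensor_pos N) = d" "dim_col (sensor_pos N) = n" using dims(5) by auto
  show ?thesis
    using assms c dims(5)
    by (auto simp: position_gram_def Let_def conf_def delta mult.commute[of _ "of_bool _"]
        scalar_prod_def atLeast0LessThan index_mat_four_block intro!: sum.cong)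
qed

lemma gram_stress: "position_gram N * stress_mat = 0\<^sub>m (d + n) (d + n)"
proof (rule eq_matI)
  fix x y assume "x < dim_row (0\<^sub>m (d + n) (d + n) :: real mat)" "y < dim_col (0\<^sub>m (d + n) (d + n) :: real mat)"
  then have xy: "x < d + n" "y < d + n" by simp_all
  have "(position_gram N * stress_mat) $$ (x, y) =
      (\<Sum>z<d + n. position_gram N $$ (x, z) * stress_mat $$ (z, y))"
    using xy gram_carrier stress_mat_carrier by (auto simp: scalar_prod_def atLeast0LessThan intro!: sum.cong)
  also have "\<dots> = (\<Sum>z<d + n. \<Sum>a<d. conf a x * (conf a z * entry z y))"
    using xy by (intro sum.cong refl) (simp add: gram_index stress_mat_index sum_distrib_right mult.assoc)
  also have "\<dots> = (\<Sum>a<d. \<Sum>z<d + n. conf a x * (conf a z * entry z y))" by (rule sum.swap)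
  also have "\<dots> = 0"
    unfolding sum_distrib_left[symmetric] by (rule sum.neutral) (use conf_entry in auto)
  finally show "(position_gram N * stress_mat) $$ (x, y) = 0\<^sub>m (d + n) (d + n) $$ (x, y)"
    using xy by simp
qed (use gram_carrier stress_mat_carrier in auto)

text \<open>
  The rank is at most \<open>n\<close> because the matrix is a sum of \<open>n\<close> products. For the converse, add the
  identity on the first \<open>d\<close> coordinates, a matrix of rank \<open>d\<close>. The sum is nonsingular: both summands
  are positive semidefinite, so a kernel vector vanishes on the first \<open>d\<close> coordinates and its
  remaining part is annihilated by the definite form \<open>W\<close>. By subadditivity the rank is at least
  \<open>(d + n) - d\<close>.
\<close>

lemma stress_mat_rank: "stress_rank N stress_mat = n"
proof (rule antisym)
  show "stress_rank N stress_mat \<le> n"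
    unfolding stress_mat_def entry_def by (rule rank_sum_products)
  define D0 :: "real mat" where "D0 = mat (d + n) (d + n) (\<lambda>(x, y). \<Sum>a<d. of_bool (x = a) * of_bool (y = a))"
  have D: "D0 \<in> carrier_mat (d + n) (d + n)" by (simp add: D0_def)
  then have sum: "stress_mat + D0 \<in> carrier_mat (d + n) (d + n)" by simp
  have "det (stress_mat + D0) \<noteq> 0"
  proof
    assume "det (stress_mat + D0) = 0"
    then have "\<exists>v. v \<in> carrier_vec (d + n) \<and> v \<noteq> 0\<^sub>v (d + n) \<and> (stress_mat + D0) *\<^sub>v v = 0\<^sub>v (d + n)"
      unfolding det_0_iff_vec_prod_zero[OF sum] .
    then obtain x where x: "x \<in> carrier_vec (d + n)" "x \<noteq> 0\<^sub>v (d + n)"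
      and z: "(stress_mat + D0) *\<^sub>v x = 0\<^sub>v (d + n)"
      by (elim exE conjE)
    let ?z = "\<lambda>i. \<Sum>k<d + n. x $ k * lift k i"
    have Dx: "x \<bullet> (D0 *\<^sub>v x) = (\<Sum>a<d. (x $ a)\<^sup>2)"
    proof -
      have "x \<bullet> (D0 *\<^sub>v x) = (\<Sum>i<d + n. \<Sum>j<d + n. \<Sum>a<d.
          x $ i * (of_bool (i = a) * of_bool (j = a)) * x $ j)"
        unfolding quadratic_form[OF D x(1)] unfolding D0_def
        by (intro sum.cong refl)
          (simp only: lessThan_iff index_mat(1) prod.case sum_distrib_left sum_distrib_right)
      also have "\<dots> = (\<Sum>i<d + n. \<Sum>a<d. \<Sum>j<d + n. x $ i * (of_bool (i = a) * of_bool (j = a)) * x $ j)"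
        by (rule sum.cong[OF refl], rule sum.swap)
      also have "\<dots> = (\<Sum>a<d. \<Sum>i<d + n. \<Sum>j<d + n. x $ i * (of_bool (i = a) * of_bool (j = a)) * x $ j)"
        by (rule sum.swap)
      also have "\<dots> = (\<Sum>a<d. (x $ a)\<^sup>2)"
      proof (rule sum.cong[OF refl])
        fix a assume a: "a \<in> {..<d}"
        have "(\<Sum>i<d + n. x $ i * of_bool (i = a)) = (\<Sum>i<d + n. if i = a then x $ i else 0)"
          by (intro sum.cong refl) auto
        also have "\<dots> = x $ a" using a by simp
        finally show "(\<Sum>i<d + n. \<Sum>j<d + n. x $ i * (of_bool (i = a) * of_bool (j = a)) * x $ j) = (x $ a)\<^sup>2"
          unfolding outer_form by simp
      qed
      finally show ?thesis .
    qed
    have "(stress_mat + D0) *\<^sub>v x = stress_mat *\<^sub>v x + D0 *\<^sub>v x"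
      by (rule add_mult_distrib_mat_vec[OF stress_mat_carrier D x(1)])
    then have "x \<bullet> (stress_mat *\<^sub>v x) + x \<bullet> (D0 *\<^sub>v x) = x \<bullet> ((stress_mat + D0) *\<^sub>v x)"
      using scalar_prod_add_distrib[OF x(1), of "stress_mat *\<^sub>v x" "D0 *\<^sub>v x"]
        mult_mat_vec_carrier[OF stress_mat_carrier x(1)] mult_mat_vec_carrier[OF D x(1)] by simp
    also have "\<dots> = 0" unfolding z using x(1) by simp
    finally have s: "x \<bullet> (stress_mat *\<^sub>v x) + (\<Sum>a<d. (x $ a)\<^sup>2) = 0" unfolding Dx .
    have nn: "0 \<le> x \<bullet> (stress_mat *\<^sub>v x)" "0 \<le> (\<Sum>a<d. (x $ a)\<^sup>2)"
      unfolding stress_mat_quadratic[OF x(1)] by (rule W_nonneg) (rule sum_nonneg, simp)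
    have "(\<Sum>a<d. (x $ a)\<^sup>2) = 0" using s nn by linarith
    then have x0: "x $ a = 0" if "a < d" for a
      using that by (subst (asm) sum_nonneg_eq_0_iff) auto
    have q: "(\<Sum>i<n. \<Sum>j<n. ?z i * W i j * ?z j) = 0"
      using s nn unfolding stress_mat_quadratic[OF x(1)] by linarith
    have "x $ (d + i) = 0" if i: "i < n" for i
    proof -
      have "(\<Sum>k<d. x $ k * lift k i) = 0" by (rule sum.neutral) (use x0 in auto)
      then have "?z i = x $ (d + i)"
        unfolding sum_lessThan_add lift_sensor sum_delta_left[OF i] by simp
      then show ?thesis using W_definite[of ?z, OF q i] by simp
    qed
    then have "x $ k = 0" if "k < d + n" for k
      using x0[of k] that by (cases "k < d") (auto dest: le_Suc_ex simp: not_less)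
    then have "x = 0\<^sub>v (d + n)" using x(1) by (intro eq_vecI) auto
    then show False using x(2) by blast
  qed
  then have "vec_space.rank (d + n) (stress_mat + D0) = d + n"
    by (rule vec_space.low_rank_det_zero[OF sum])
  moreover have "vec_space.rank (d + n) (stress_mat + D0) \<le> stress_rank N stress_mat + vec_space.rank (d + n) D0"
    by (rule vec_space.rank_subadditive[OF stress_mat_carrier D])
  moreover have "vec_space.rank (d + n) D0 \<le> d" unfolding D0_def by (rule rank_sum_products)
  ultimately show "n \<le> stress_rank N stress_mat" by simp
qed

lemma sensor_edge_index: "x < d + n \<Longrightarrow> sensor_edge_vec N i j $ x =
    (if x < d then 0 else of_bool (x - d = i) - of_bool (x - d = j))"
  by (auto simp: sensor_edge_vec_def unit_vec_def)

lemma anchor_edge_index: "x < d + n \<Longrightarrow> k < m \<Longrightarrow> anchor_edge_vec N k j $ x =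
    (if x < d then - Q x k else of_bool (x - d = j))"
  using dims(4) by (auto simp: anchor_edge_vec_def unit_vec_def)

lemma edge_dims: "dim_vec (sensor_edge_vec N i j) = d + n" "dim_vec (anchor_edge_vec N k j) = d + n"
  using dims(4) by (simp_all add: sensor_edge_vec_def anchor_edge_vec_def)

lemma dual_matrix_index:
  assumes V: "V \<in> carrier_mat d d" and xy: "x < d + n" "y < d + n"
  shows "dual_matrix N V w w' $$ (x, y) =
    (if x < d \<and> y < d then V $$ (x, y) else 0) +
    (\<Sum>(i, j)\<in>sensor_pairs N. w i j * (sensor_edge_vec N i j $ x * sensor_edge_vec N i j $ y)) +
    (\<Sum>(k, j)\<in>anchor_sensor_pairs N. w' k j * (anchor_edge_vec N k j $ x * anchor_edge_vec N k j $ y))"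
  using V xy by (auto simp: dual_matrix_def Let_def outer_self_def edge_dims index_mat_four_block)

lemma conf_sensor_edge:
  assumes a: "a < d" and ij: "i < n" "j < n"
  shows "(\<Sum>x<d + n. conf a x * sensor_edge_vec N i j $ x) = P a i - P a j"
proof -
  have "(\<Sum>x<d + n. conf a x * sensor_edge_vec N i j $ x) =
      (\<Sum>k<n. P a k * (of_bool (k = i) - of_bool (k = j)))"
    using a by (simp add: sum_conf sensor_edge_index)
  also have "\<dots> = P a i - P a j"
    unfolding right_diff_distrib sum_subtractf sum_delta_left[OF ij(1)] sum_delta_left[OF ij(2)] ..
  finally show ?thesis .
qed

lemma conf_anchor_edge:
  assumes a: "a < d" and kj: "k < m" "j < n"
  shows "(\<Sum>x<d + n. conf a x * anchor_edge_vec N k j $ x) = P a j - Q a k"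
  using assms by (simp add: sum_conf anchor_edge_index sum_delta_left)

lemma sensor_distance:
  assumes ij: "(i, j) \<in> sensor_pairs N"
  shows "(sensor_dist N i j)\<^sup>2 = (\<Sum>a<d. (P a i - P a j)\<^sup>2)"
proof -
  have "\<forall>(i, j)\<in>sensor_pairs N.
          eucl_norm (col (sensor_pos N) i - col (sensor_pos N) j) = sensor_dist N i j"
    using net unfolding sensor_network_def Let_def by (elim conjE)
  then have e: "sensor_dist N i j = eucl_norm (col (sensor_pos N) i - col (sensor_pos N) j)"
    using ij by auto
  have "i < n" "j < n" using ij dims(1) by auto
  then have "(col (sensor_pos N) i - col (sensor_pos N) j) \<bullet> (col (sensor_pos N) i - col (sensor_pos N) j) =
      (\<Sum>a<d. (P a i - P a j)\<^sup>2)"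
    using dims(5) by (auto simp: scalar_prod_def atLeast0LessThan power2_eq_square intro!: sum.cong)
  moreover have "0 \<le> (\<Sum>a<d. (P a i - P a j)\<^sup>2)" by (rule sum_nonneg) simp
  ultimately show ?thesis unfolding e eucl_norm_def by simp
qed

lemma anchor_distance:
  assumes kj: "(k, j) \<in> anchor_sensor_pairs N"
  shows "(anchor_dist N k j)\<^sup>2 = (\<Sum>a<d. (P a j - Q a k)\<^sup>2)"
proof -
  have "\<forall>(k, j)\<in>anchor_sensor_pairs N.
          eucl_norm (col (anchor_pos N) k - col (sensor_pos N) j) = anchor_dist N k j"
    using net unfolding sensor_network_def Let_def by (elim conjE)
  then have e: "anchor_dist N k j = eucl_norm (col (anchor_pos N) k - col (sensor_pos N) j)"
    using kj by auto
  have "k < m" "j < n" using kj dims(2) by auto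
  then have "(col (anchor_pos N) k - col (sensor_pos N) j) \<bullet> (col (anchor_pos N) k - col (sensor_pos N) j) =
      (\<Sum>a<d. (P a j - Q a k)\<^sup>2)"
    using dims(4,5)
    by (auto simp: scalar_prod_def atLeast0LessThan power2_eq_square algebra_simps intro!: sum.cong)
  moreover have "0 \<le> (\<Sum>a<d. (P a j - Q a k)\<^sup>2)" by (rule sum_nonneg) simp
  ultimately show ?thesis unfolding e eucl_norm_def by simp
qed

text \<open>
  The product of an edge vector with row \<open>a\<close> of \<open>[I P]\<close> is the difference of the coordinates \<open>a\<close> of
  the end points.
\<close>

lemma conf_dual_matrix:
  assumes V: "V \<in> carrier_mat d d" and a: "a < d"
  shows "(\<Sum>x<d + n. \<Sum>y<d + n. conf a x * dual_matrix N V w w' $$ (x, y) * conf a y) =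
    V $$ (a, a) + (\<Sum>(i, j)\<in>sensor_pairs N. w i j * (P a i - P a j)\<^sup>2) +
    (\<Sum>(k, j)\<in>anchor_sensor_pairs N. w' k j * (P a j - Q a k)\<^sup>2)"
proof -
  let ?s = "\<lambda>p x. sensor_edge_vec N (fst p) (snd p) $ x"
  let ?t = "\<lambda>p x. anchor_edge_vec N (fst p) (snd p) $ x"
  have quad: "(\<Sum>x<d + n. \<Sum>y<d + n. conf a x * (\<Sum>p\<in>F. u p * (v p x * v p y)) * conf a y) =
      (\<Sum>p\<in>F. u p * (\<Sum>x<d + n. conf a x * v p x)\<^sup>2)" for F :: "(nat \<times> nat) set" and u v
  proof -
    have "(\<Sum>x<d + n. \<Sum>y<d + n. conf a x * (\<Sum>p\<in>F. u p * (v p x * v p y)) * conf a y) =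
        (\<Sum>x<d + n. \<Sum>y<d + n. \<Sum>p\<in>F. u p * (conf a x * (v p x * v p y) * conf a y))"
      unfolding sum_distrib_left sum_distrib_right by (intro sum.cong refl) (simp add: algebra_simps)
    also have "\<dots> = (\<Sum>x<d + n. \<Sum>p\<in>F. \<Sum>y<d + n. u p * (conf a x * (v p x * v p y) * conf a y))"
      by (rule sum.cong[OF refl], rule sum.swap)
    also have "\<dots> = (\<Sum>p\<in>F. \<Sum>x<d + n. \<Sum>y<d + n. u p * (conf a x * (v p x * v p y) * conf a y))"
      by (rule sum.swap)
    also have "\<dots> = (\<Sum>p\<in>F. u p * (\<Sum>x<d + n. conf a x * v p x)\<^sup>2)"
      unfolding sum_distrib_left[symmetric] outer_form ..
    finally show ?thesis .
  qed
  have Vq: "(\<Sum>x<d + n. \<Sum>y<d + n. conf a x * (if x < d \<and> y < d then V $$ (x, y) else 0) * conf a y) = V $$ (a, a)"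
  proof -
    have "(\<Sum>x<d + n. \<Sum>y<d + n. conf a x * (if x < d \<and> y < d then V $$ (x, y) else 0) * conf a y) =
        (\<Sum>x<d + n. conf a x * (\<Sum>y<d + n. conf a y * (if x < d \<and> y < d then V $$ (x, y) else 0)))"
      unfolding sum_distrib_left by (intro sum.cong refl) (simp add: algebra_simps)
    then show ?thesis using a by (simp add: sum_conf)
  qed
  have "(\<Sum>x<d + n. \<Sum>y<d + n. conf a x * dual_matrix N V w w' $$ (x, y) * conf a y) =
    (\<Sum>x<d + n. \<Sum>y<d + n. conf a x * (if x < d \<and> y < d then V $$ (x, y) else 0) * conf a y) +
    (\<Sum>x<d + n. \<Sum>y<d + n. conf a x *
      (\<Sum>p\<in>sensor_pairs N. w (fst p) (snd p) * (?s p x * ?s p y)) * conf a y) +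
    (\<Sum>x<d + n. \<Sum>y<d + n. conf a x *
      (\<Sum>p\<in>anchor_sensor_pairs N. w' (fst p) (snd p) * (?t p x * ?t p y)) * conf a y)"
    unfolding sum.distrib[symmetric]
    by (intro sum.cong refl) (simp add: dual_matrix_index[OF V] case_prod_beta algebra_simps)
  also have "\<dots> = V $$ (a, a) + (\<Sum>p\<in>sensor_pairs N. w (fst p) (snd p) * (\<Sum>x<d + n. conf a x * ?s p x)\<^sup>2) +
    (\<Sum>p\<in>anchor_sensor_pairs N. w' (fst p) (snd p) * (\<Sum>x<d + n. conf a x * ?t p x)\<^sup>2)"
    unfolding quad Vq ..
  also have "(\<Sum>p\<in>sensor_pairs N. w (fst p) (snd p) * (\<Sum>x<d + n. conf a x * ?s p x)\<^sup>2) =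
      (\<Sum>(i, j)\<in>sensor_pairs N. w i j * (P a i - P a j)\<^sup>2)"
    by (intro sum.cong refl) (auto simp: conf_sensor_edge[OF a] pair_less)
  also have "(\<Sum>p\<in>anchor_sensor_pairs N. w' (fst p) (snd p) * (\<Sum>x<d + n. conf a x * ?t p x)\<^sup>2) =
      (\<Sum>(k, j)\<in>anchor_sensor_pairs N. w' k j * (P a j - Q a k)\<^sup>2)"
    by (intro sum.cong refl) (auto simp: conf_anchor_edge[OF a] pair_less)
  finally show ?thesis .
qed

text \<open>
  Summed over all coordinates, the squared differences become the squared distances of the
  objective.
\<close>

lemma dual_objective_conf:
  assumes V: "V \<in> carrier_mat d d"
  shows "dual_objective N V w w' =
    (\<Sum>a<d. \<Sum>x<d + n. \<Sum>y<d + n. conf a x * dual_matrix N V w w' $$ (x, y) * conf a y)"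
proof -
  have "inner_mat (1\<^sub>m d) V = (\<Sum>a<d. V $$ (a, a))"
    using V by (simp add: inner_mat_def trace_mat_def)
  moreover have "(\<Sum>(i, j)\<in>sensor_pairs N. w i j * (sensor_dist N i j)\<^sup>2) =
      (\<Sum>a<d. \<Sum>(i, j)\<in>sensor_pairs N. w i j * (P a i - P a j)\<^sup>2)"
    by (subst sum.swap) (auto simp: sensor_distance sum_distrib_left intro!: sum.cong)
  moreover have "(\<Sum>(k, j)\<in>anchor_sensor_pairs N. w' k j * (anchor_dist N k j)\<^sup>2) =
      (\<Sum>a<d. \<Sum>(k, j)\<in>anchor_sensor_pairs N. w' k j * (P a j - Q a k)\<^sup>2)"
    by (subst sum.swap) (auto simp: anchor_distance sum_distrib_left intro!: sum.cong)
  ultimately show ?thesis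
    unfolding dual_objective_def sum.distrib[symmetric]
    by (simp add: conf_dual_matrix[OF V] sum.distrib)
qed

lemma weak_duality:
  assumes "dual_feasible N V w w'"
  shows "0 \<le> dual_objective N V w w'"
proof -
  have V: "V \<in> carrier_mat d d" and p: "psd (dual_matrix N V w w')"
    using assms by (auto simp: dual_feasible_def)
  have D: "dual_matrix N V w w' \<in> carrier_mat (d + n) (d + n)"
    by (simp add: dual_matrix_def Let_def)
  have nonneg: "0 \<le> (\<Sum>x<d + n. \<Sum>y<d + n. conf a x * dual_matrix N V w w' $$ (x, y) * conf a y)" for a
  proof -
    have v: "vec (d + n) (conf a) \<in> carrier_vec (d + n)" by simp
    then have "0 \<le> vec (d + n) (conf a) \<bullet> (dual_matrix N V w w' *\<^sub>v vec (d + n) (conf a))"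
      using p D unfolding psd_def by auto
    then show ?thesis unfolding quadratic_form[OF D v] by simp
  qed
  show ?thesis unfolding dual_objective_conf[OF V] by (rule sum_nonneg) (rule nonneg)
qed

lemma sensor_edge_iff: "i < n \<Longrightarrow> j < n \<Longrightarrow> {m + i, m + j} \<in> edges N \<longleftrightarrow>
    (i, j) \<in> sensor_pairs N \<or> (j, i) \<in> sensor_pairs N"
  using dims(2,3) unfolding edges_def by (auto simp: doubleton_eq_iff)

lemma anchor_edge_iff: "u < m \<Longrightarrow> {u, m + j} \<in> edges N \<longleftrightarrow> (u, j) \<in> anchor_sensor_pairs N"
  using dims(3) unfolding edges_def by (auto simp: doubleton_eq_iff)

lemma sum_pairs:
  fixes K L :: nat and f :: "nat \<Rightarrow> nat \<Rightarrow> real"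
  assumes F: "F \<subseteq> {..<K} \<times> {..<L}"
  shows "(\<Sum>(i, j)\<in>F. f i j) = (\<Sum>i<K. \<Sum>j<L. if (i, j) \<in> F then f i j else 0)"
proof -
  have "(\<Sum>i<K. \<Sum>j<L. if (i, j) \<in> F then f i j else 0) =
      (\<Sum>p\<in>{..<K} \<times> {..<L}. if p \<in> F then f (fst p) (snd p) else 0)"
    by (simp add: sum.cartesian_product case_prod_beta)
  also have "\<dots> = (\<Sum>p\<in>({..<K} \<times> {..<L}) \<inter> F. f (fst p) (snd p))"
    by (rule sum.inter_restrict[symmetric]) simp
  also have "({..<K} \<times> {..<L}) \<inter> F = F" using F by blast
  finally show ?thesis by (simp add: case_prod_beta)
qed

text \<open>
  A sensor edge gets the weight \<open>- W i j\<close>, an anchor edge its balancing weight, and \<open>V\<close> is the rest of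
  the upper left block, on which the dual problem imposes symmetry alone. The mixed blocks agree by
  the balance of the coordinates. In the lower right block, the entries off the diagonal agree
  because \<open>W\<close> vanishes at non-adjacent sensors, and the diagonal ones by the balance of the extra
  coordinate 1.
\<close>

lemma stress_mat_dual:
  "\<exists>V w w'. V \<in> carrier_mat d d \<and> transpose_mat V = V \<and> stress_mat = dual_matrix N V w w'"
proof -
  have "\<forall>j. \<exists>w. j < n \<longrightarrow> (\<forall>u. w u \<noteq> 0 \<longrightarrow> {u, m + j} \<in> edges N) \<and>
      (\<forall>a<Suc d. (\<Sum>i<n. W i j * homogeneous N (m + i) a) = (\<Sum>u<m. w u * homogeneous N u a))"
    using W_anchored by blast
  from choice[OF this] obtain \<omega> where
    \<omega>: "\<forall>j. j < n \<longrightarrow> (\<forall>u. \<omega> j u \<noteq> 0 \<longrightarrow> {u, m + j} \<in> edges N) \<and>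
      (\<forall>a<Suc d. (\<Sum>i<n. W i j * homogeneous N (m + i) a) = (\<Sum>u<m. \<omega> j u * homogeneous N u a))" ..
  have off: "\<omega> j u = 0" if "j < n" "u < m" "(u, j) \<notin> anchor_sensor_pairs N" for j u
    using \<omega> that anchor_edge_iff[of u j] by blast
  have pos: "(\<Sum>i<n. W i j * P a i) = (\<Sum>u<m. \<omega> j u * Q a u)" if "j < n" "a < d" for j a
    using \<omega>[rule_format, OF that(1), THEN conjunct2, rule_format, of a] that(2)
    by (simp add: homogeneous_def)
  have one: "(\<Sum>i<n. W i j) = (\<Sum>u<m. \<omega> j u)" if "j < n" for j
    using \<omega>[rule_format, OF that, THEN conjunct2, rule_format, of d]
    by (simp add: homogeneous_def)
  let ?w = "\<lambda>i j. - W i j" and ?w' = "\<lambda>k j. \<omega> j k"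
  define V where "V = mat d d (\<lambda>(x, y). entry x y -
      (\<Sum>(k, j)\<in>anchor_sensor_pairs N. ?w' k j * (Q x k * Q y k)))"
  have V: "V \<in> carrier_mat d d" by (simp add: V_def)
  have V_sym: "transpose_mat V = V"
    by (intro eq_matI) (auto simp: V_def entry_sym mult.commute)
  have anchor_sum: "(\<Sum>(k, j)\<in>anchor_sensor_pairs N. ?w' k j * (f k * (of_bool (i = j) * g j))) =
      (\<Sum>k<m. \<omega> i k * f k) * g i" if i: "i < n" for f g :: "nat \<Rightarrow> real" and i
  proof -
    have "(\<Sum>(k, j)\<in>anchor_sensor_pairs N. ?w' k j * (f k * (of_bool (i = j) * g j))) =
        (\<Sum>k<m. \<Sum>j<n. if (k, j) \<in> anchor_sensor_pairs N then ?w' k j * (f k * (of_bool (i = j) * g j)) else 0)"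
      by (rule sum_pairs[OF dims(2)])
    also have "\<dots> = (\<Sum>k<m. \<Sum>j<n. (\<omega> j k * f k * g j) * of_bool (i = j))"
      by (intro sum.cong refl) (use off in auto)
    also have "\<dots> = (\<Sum>k<m. \<omega> i k * f k * g i)" using i by (simp add: sum_delta_right)
    finally show ?thesis by (simp add: sum_distrib_right)
  qed
  have "stress_mat $$ (x, y) = dual_matrix N V ?w ?w' $$ (x, y)" if xy: "x < d + n" "y < d + n" "x \<le> y" for x y
  proof -
    note index = dual_matrix_index[OF V xy(1,2), of ?w ?w'] stress_mat_index[OF xy(1,2)]
    have anchor: "(\<Sum>(k, j)\<in>anchor_sensor_pairs N. ?w' k j * (anchor_edge_vec N k j $ x * anchor_edge_vec N k j $ y)) =
        (\<Sum>(k, j)\<in>anchor_sensor_pairs N. ?w' k j *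
           ((if x < d then - Q x k else of_bool (x - d = j)) * (if y < d then - Q y k else of_bool (y - d = j))))"
    proof (intro sum.cong refl, clarify)
      fix k j assume "(k, j) \<in> anchor_sensor_pairs N"
      then have k: "k < m" using dims(2) by auto
      show "?w' k j * (anchor_edge_vec N k j $ x * anchor_edge_vec N k j $ y) = ?w' k j *
           ((if x < d then - Q x k else of_bool (x - d = j)) * (if y < d then - Q y k else of_bool (y - d = j)))"
        unfolding anchor_edge_index[OF xy(1) k] anchor_edge_index[OF xy(2) k] ..
    qed
    have sensor: "(\<Sum>(i, j)\<in>sensor_pairs N. ?w i j * (sensor_edge_vec N i j $ x * sensor_edge_vec N i j $ y)) =
        (\<Sum>(i, j)\<in>sensor_pairs N. ?w i j *
          ((if x < d then 0 else of_bool (x - d = i) - of_bool (x - d = j)) *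
           (if y < d then 0 else of_bool (y - d = i) - of_bool (y - d = j))))"
      unfolding sensor_edge_index[OF xy(1)] sensor_edge_index[OF xy(2)] ..
    consider (dd) "x < d" "y < d" | (ds) "x < d" "d \<le> y" | (ss) "d \<le> x" "d \<le> y"
      using xy(3) by linarith
    then show ?thesis
    proof cases
      case dd
      then show ?thesis unfolding index anchor sensor by (simp add: V_def)
    next
      case ds
      obtain j0 where j0: "y = d + j0" "j0 < n" using ds(2) xy(2) by (auto dest: le_Suc_ex)
      have "(\<Sum>(k, j)\<in>anchor_sensor_pairs N. ?w' k j * (- Q x k * (of_bool (j0 = j) * 1))) =
         (\<Sum>k<m. \<omega> j0 k * - Q x k) * 1" by (rule anchor_sum[OF j0(2)])
      then show ?thesis unfolding index anchor sensor using ds(1) j0 pos[OF j0(2) ds(1)]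
        by (simp add: entry_mixed sum_negf mult.commute)
    next
      case ss
      obtain i0 where i0: "x = d + i0" "i0 < n" using ss(1) xy(1) by (auto dest: le_Suc_ex)
      obtain j0 where j0: "y = d + j0" "j0 < n" using ss(2) xy(2) by (auto dest: le_Suc_ex)
      (* Each edge occurs in one orientation only; G carries it in that orientation, and the
         sum of G and its transpose is W off the diagonal. *)
      define G where "G i j = (if (i, j) \<in> sensor_pairs N then W i j else 0)" for i j
      have G0: "G i i = 0" for i using dims(1) by (auto simp: G_def)
      have GW: "G i j + G j i = W i j" if "i < n" "j < n" "i \<noteq> j" for i j
        using W_zero[OF that] sensor_edge_iff[OF that(1,2)] W_sym[of i j] pair_asym[of i j]
        unfolding G_def by auto
      have sub: "sensor_pairs N \<subseteq> {..<n} \<times> {..<n}" using dims(1) by auto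
      have a: "(\<Sum>(k, j)\<in>anchor_sensor_pairs N. ?w' k j * (of_bool (i0 = j) * of_bool (j0 = j))) =
          (\<Sum>k<m. \<omega> i0 k) * of_bool (j0 = i0)"
        using anchor_sum[OF i0(2), of "\<lambda>_. 1" "\<lambda>j. of_bool (j0 = j)"] by simp
      have "(\<Sum>(i, j)\<in>sensor_pairs N. ?w i j * ((of_bool (i0 = i) - of_bool (i0 = j)) * (of_bool (j0 = i) - of_bool (j0 = j)))) =
          (\<Sum>i<n. \<Sum>j<n. if (i, j) \<in> sensor_pairs N then
             ?w i j * ((of_bool (i0 = i) - of_bool (i0 = j)) * (of_bool (j0 = i) - of_bool (j0 = j))) else 0)"
        by (rule sum_pairs[OF sub])
      also have "\<dots> = (\<Sum>i<n. \<Sum>j<n.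
          G i j * of_bool (i0 = i) * of_bool (j0 = j) + G i j * of_bool (j0 = i) * of_bool (i0 = j)
          - (G i j * of_bool (i0 = i) * of_bool (j0 = i) + G i j * of_bool (i0 = j) * of_bool (j0 = j)))"
        by (intro sum.cong refl) (auto simp: G_def)
      also have "\<dots> = (\<Sum>i<n. \<Sum>j<n. G i j * of_bool (i0 = i) * of_bool (j0 = j)) +
          (\<Sum>i<n. \<Sum>j<n. G i j * of_bool (j0 = i) * of_bool (i0 = j))
          - ((\<Sum>i<n. \<Sum>j<n. G i j * of_bool (i0 = i) * of_bool (j0 = i)) +
             (\<Sum>i<n. \<Sum>j<n. G i j * of_bool (i0 = j) * of_bool (j0 = j)))"
        by (simp only: sum.distrib sum_subtractf)
      also have "(\<Sum>i<n. \<Sum>j<n. G i j * of_bool (i0 = i) * of_bool (j0 = j)) = G i0 j0"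
        using i0 j0 by (simp add: sum_delta_right)
      also have "(\<Sum>i<n. \<Sum>j<n. G i j * of_bool (j0 = i) * of_bool (i0 = j)) = G j0 i0"
        using i0 j0 by (simp add: sum_delta_right)
      also have "(\<Sum>i<n. \<Sum>j<n. G i j * of_bool (i0 = i) * of_bool (j0 = i)) =
          (\<Sum>j<n. G i0 j) * of_bool (j0 = i0)"
      proof -
        have "(\<Sum>i<n. \<Sum>j<n. G i j * of_bool (i0 = i) * of_bool (j0 = i)) =
            (\<Sum>i<n. (\<Sum>j<n. G i j) * of_bool (j0 = i) * of_bool (i0 = i))"
          by (intro sum.cong refl) (simp add: sum_distrib_right algebra_simps)
        then show ?thesis using i0 by (simp add: sum_delta_right)
      qed
      also have "(\<Sum>i<n. \<Sum>j<n. G i j * of_bool (i0 = j) * of_bool (j0 = j)) =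
          (\<Sum>i<n. G i i0) * of_bool (j0 = i0)"
      proof -
        have "(\<Sum>i<n. \<Sum>j<n. G i j * of_bool (i0 = j) * of_bool (j0 = j)) =
            (\<Sum>i<n. \<Sum>j<n. G i j * of_bool (j0 = j) * of_bool (i0 = j))"
          by (simp add: algebra_simps)
        then show ?thesis using i0 by (simp add: sum_delta_right sum_distrib_right)
      qed
      finally have s: "(\<Sum>(i, j)\<in>sensor_pairs N. ?w i j *
            ((of_bool (i0 = i) - of_bool (i0 = j)) * (of_bool (j0 = i) - of_bool (j0 = j)))) =
          G i0 j0 + G j0 i0 - ((\<Sum>j<n. G i0 j) * of_bool (j0 = i0) + (\<Sum>i<n. G i i0) * of_bool (j0 = i0))" .
      have "W i0 j0 = G i0 j0 + G j0 i0 - ((\<Sum>j<n. G i0 j) * of_bool (j0 = i0) +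
          (\<Sum>i<n. G i i0) * of_bool (j0 = i0)) + (\<Sum>k<m. \<omega> i0 k) * of_bool (j0 = i0)"
      proof (cases "i0 = j0")
        case False
        then show ?thesis using GW[OF i0(2) j0(2)] by simp
      next
        case True
        have "(\<Sum>j<n. G i0 j) + (\<Sum>i<n. G i i0) = (\<Sum>j<n. W j i0 - of_bool (j = i0) * W i0 i0)"
          unfolding sum.distrib[symmetric]
        proof (intro sum.cong refl)
          fix j assume "j \<in> {..<n}"
          then show "G i0 j + G j i0 = W j i0 - of_bool (j = i0) * W i0 i0"
            using GW[OF i0(2), of j] W_sym[of j i0] by (cases "j = i0") (auto simp: G0)
        qed
        also have "\<dots> = (\<Sum>k<m. \<omega> i0 k) - W i0 i0"
          using sum_delta_left[OF i0(2), of "\<lambda>_. W i0 i0"] one[OF i0(2)]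
          by (simp add: sum_subtractf mult.commute)
        finally show ?thesis using True G0 by simp
      qed
      then show ?thesis unfolding index anchor sensor using i0 j0 s a
        by (simp add: entry_sensor)
    qed
  qed
  note upper = this
  have D: "dual_matrix N V ?w ?w' \<in> carrier_mat (d + n) (d + n)" by (simp add: dual_matrix_def Let_def)
  have swap: "dual_matrix N V ?w ?w' $$ (x, y) = dual_matrix N V ?w ?w' $$ (y, x)"
    if xy: "x < d + n" "y < d + n" for x y
  proof -
    have "V $$ (x, y) = V $$ (y, x)" if "x < d" "y < d"
      using that V arg_cong[OF V_sym, of "\<lambda>A. A $$ (y, x)"] by simp
    then show ?thesis unfolding dual_matrix_index[OF V xy] dual_matrix_index[OF V xy(2,1)]
      by (simp add: mult.commute)
  qed
  have "stress_mat = dual_matrix N V ?w ?w'"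
  proof (rule eq_matI)
    fix x y assume "x < dim_row (dual_matrix N V ?w ?w')" "y < dim_col (dual_matrix N V ?w ?w')"
    then have xy: "x < d + n" "y < d + n" using D by auto
    show "stress_mat $$ (x, y) = dual_matrix N V ?w ?w' $$ (x, y)"
    proof (cases "x \<le> y")
      case True
      then show ?thesis using upper xy by blast
    next
      case False
      then have "stress_mat $$ (y, x) = dual_matrix N V ?w ?w' $$ (y, x)" using upper xy by simp
      then show ?thesis using swap[OF xy] xy entry_sym[of x y] by (simp add: stress_mat_index)
    qed
  qed (use D stress_mat_carrier in auto)
  then show ?thesis using V V_sym by blast
qed

text \<open>The objective is 0 because \<open>[I P] L = 0\<close>, and no feasible solution has a smaller one.\<close>

lemma stress_mat_optimal: "optimal_dual_stress N stress_mat"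
proof -
  obtain V w w' where V: "V \<in> carrier_mat d d" "transpose_mat V = V"
    and S: "stress_mat = dual_matrix N V w w'"
    using stress_mat_dual by blast
  have f: "dual_feasible N V w w'"
    using V stress_mat_psd unfolding dual_feasible_def S by blast
  have "dual_objective N V w w' = 0"
    unfolding dual_objective_conf[OF V(1)]
  proof (rule sum.neutral, rule ballI)
    fix a assume "a \<in> {..<d}"
    then have a: "a < d" by simp
    have "(\<Sum>x<d + n. \<Sum>y<d + n. conf a x * dual_matrix N V w w' $$ (x, y) * conf a y) =
        (\<Sum>x<d + n. \<Sum>y<d + n. conf a x * entry x y * conf a y)"
      unfolding S[symmetric] by (intro sum.cong refl) (simp add: stress_mat_index)
    also have "\<dots> = (\<Sum>y<d + n. \<Sum>x<d + n. conf a x * entry x y * conf a y)" by (rule sum.swap)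
    also have "\<dots> = 0"
      unfolding sum_distrib_right[symmetric] by (simp add: conf_entry[OF a])
    finally show "(\<Sum>x<d + n. \<Sum>y<d + n. conf a x * dual_matrix N V w w' $$ (x, y) * conf a y) = 0" .
  qed
  then have "dual_optimal N V w w'"
    unfolding dual_optimal_def using f weak_duality by simp
  then show ?thesis unfolding optimal_dual_stress_def using S by blast
qed

end

declare sum_of_bool_eq [simp] sum_mult_of_bool_eq [simp] sum_of_bool_mult_eq [simp]

section \<open>Stress vectors of a lateration ordering\<close>

(* Keeps the bounds Suc d and n + Suc d of sums and index sets in one form. *)
declare add_Suc_right [simp del] sum.lessThan_Suc [simp del]

text \<open>
  If \<open>z\<close> is carried along \<open>f\<close> from \<open>C\<close> to \<open>D\<close>, then sums over \<open>D\<close> can be computed on \<open>C\<close>, apart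
  from what falls outside \<open>D\<close>.
\<close>

lemma sum_pushforward:
  fixes z :: "'c \<Rightarrow> real"
  assumes C: "finite C" and D: "finite D"
  shows "(\<Sum>u\<in>D. (\<Sum>c\<in>C. if Q c \<and> f c = u then z c else 0) * F u) =
     (\<Sum>c\<in>C. if Q c \<and> f c \<in> D then z c * F (f c) else 0)"
proof -
  have "(\<Sum>u\<in>D. (\<Sum>c\<in>C. if Q c \<and> f c = u then z c else 0) * F u) =
     (\<Sum>u\<in>D. \<Sum>c\<in>C. if f c = u then (if Q c then z c * F u else 0) else 0)"
    unfolding sum_distrib_right by (intro sum.cong refl) auto
  also have "\<dots> = (\<Sum>c\<in>C. \<Sum>u\<in>D. if f c = u then (if Q c then z c * F u else 0) else 0)"
    by (rule sum.swap)
  also have "\<dots> = (\<Sum>c\<in>C. if Q c \<and> f c \<in> D then z c * F (f c) else 0)"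
  proof (rule sum.cong[OF refl])
    fix c
    show "(\<Sum>u\<in>D. if f c = u then (if Q c then z c * F u else 0) else 0) =
        (if Q c \<and> f c \<in> D then z c * F (f c) else 0)"
      using sum.delta'[OF D, of "f c" "\<lambda>u. if Q c then z c * F u else 0"] by auto
  qed
  finally show ?thesis .
qed

text \<open>
  The active vertices \<open>act 0, ..., act (n + d)\<close>, at the positions \<open>pos\<close> of the ordering \<open>\<pi>\<close>, are the
  sensors and the \<open>d + 1\<close> basis anchors \<open>bas\<close>. An anchor that is not active comes after the whole
  basis. The row \<open>X v\<close> is to be thought of as the extended position of vertex \<open>v\<close>.
\<close>

locale lateration_tables =
  fixes d m n :: nat and \<pi> :: "nat \<Rightarrow> nat" and adj :: "nat \<Rightarrow> nat \<Rightarrow> bool"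
    and X :: "nat \<Rightarrow> nat \<Rightarrow> real" and act pos bas :: "nat \<Rightarrow> nat"
  assumes order_inj: "inj_on \<pi> {..<m + n}"
    and order_range: "\<pi> ` {..<m + n} = {..<m + n}"
    and clique: "\<And>i j. i < Suc d \<Longrightarrow> j < Suc d \<Longrightarrow> i \<noteq> j \<Longrightarrow> adj (\<pi> i) (\<pi> j)"
    and adj_sym: "\<And>u v. adj u v \<Longrightarrow> adj v u"
    and position: "\<And>g. inj_on g {..<Suc d} \<Longrightarrow> g ` {..<Suc d} \<subseteq> {..<m + n} \<Longrightarrow>
        independent (Suc d) (\<lambda>c. X (g c))"
    and bas_inj: "inj_on bas {..<Suc d}"
    and bas_anchor: "bas ` {..<Suc d} \<subseteq> {..<m}"
    and act_image: "act ` {..<n + Suc d} = {m..<m + n} \<union> bas ` {..<Suc d}"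
    and act_pos: "\<And>i. i < n + Suc d \<Longrightarrow> pos i < m + n \<and> act i = \<pi> (pos i)"
    and pos_mono: "\<And>i j. j < i \<Longrightarrow> i < n + Suc d \<Longrightarrow> pos j < pos i"
    and inactive_late: "\<And>q. q < m + n \<Longrightarrow> \<pi> q \<notin> act ` {..<n + Suc d} \<Longrightarrow>
        bas ` {..<Suc d} \<subseteq> \<pi> ` {..<q}"
    and many_neighbours: "\<And>p. Suc d \<le> p \<Longrightarrow> p < m + n \<Longrightarrow>
        Suc d \<le> card {q. q < p \<and> adj (\<pi> q) (\<pi> p)}"
begin

abbreviation "active \<equiv> act ` {..<n + Suc d}"

lemma act_inj: "inj_on act {..<n + Suc d}"
proof (rule inj_onI)
  fix i j assume ij: "i \<in> {..<n + Suc d}" "j \<in> {..<n + Suc d}" "act i = act j"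
  then have "pos i = pos j" using act_pos inj_onD[OF order_inj, of "pos i" "pos j"] by simp
  then show "i = j" using pos_mono[of i j] pos_mono[of j i] ij by (cases i j rule: linorder_cases) auto
qed

lemma act_eq_iff: "i < n + Suc d \<Longrightarrow> j < n + Suc d \<Longrightarrow> act i = act j \<longleftrightarrow> i = j"
  using inj_on_eq_iff[OF act_inj] by simp

lemma act_less: "i < n + Suc d \<Longrightarrow> act i < m + n"
  using act_pos[of i] order_range by auto

lemma bas_active: "c < Suc d \<Longrightarrow> bas c \<in> active"
  unfolding act_image by simp

lemma sensor_active: "m \<le> u \<Longrightarrow> u < m + n \<Longrightarrow> u \<in> active"
  unfolding act_image by simp

lemma earlier_active:
  assumes p: "p < pos i" "i < n + Suc d" and a: "\<pi> p \<in> active"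
  shows "\<pi> p \<in> act ` {..<i}"
proof -
  obtain j where j: "j < n + Suc d" "\<pi> p = act j" using a by auto
  have "p = pos j" using j p act_pos[of i] act_pos[of j] inj_onD[OF order_inj, of p "pos j"] by simp
  then have "\<not> i \<le> j" using pos_mono[of i j] j p by (cases "i = j") auto
  then show ?thesis using j by simp
qed

lemma pos_ge: "i < n + Suc d \<Longrightarrow> i \<le> pos i"
proof (induction i)
  case (Suc i)
  then show ?case using pos_mono[of i "Suc i"] by simp
qed simp

text \<open>
  An inactive vertex is preceded by the \<open>d + 1\<close> basis anchors, so it cannot be among the first
  \<open>d + 1\<close> vertices.
\<close>

lemma first_active: "q < Suc d \<Longrightarrow> q < m + n \<Longrightarrow> \<pi> q \<in> active"
proof (rule ccontr)
  assume q: "q < Suc d" "q < m + n" and "\<pi> q \<notin> active"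
  then have "bas ` {..<Suc d} \<subseteq> \<pi> ` {..<q}" using inactive_late by blast
  then have "card (bas ` {..<Suc d}) \<le> card (\<pi> ` {..<q})" by (intro card_mono) auto
  also have "\<dots> \<le> q" using card_image_le[of "{..<q}" \<pi>] by simp
  finally show False using q card_image[OF bas_inj] by simp
qed

lemma enough_points: "Suc d \<le> m"
  using card_mono[OF _ bas_anchor] card_image[OF bas_inj] by simp

text \<open>
  The first \<open>d + 1\<close> vertices of the ordering are active, hence they are the first \<open>d + 1\<close> active
  vertices, and these form a clique.
\<close>

lemma pos_clique: "j < Suc d \<Longrightarrow> pos j < Suc d"
proof -
  assume j: "j < Suc d"
  have "\<exists>i<n + Suc d. q = pos i" if q: "q < Suc d" for q
  proof -
    have "q < m + n" using q enough_points by simp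
    then obtain i where i: "i < n + Suc d" "\<pi> q = act i" using first_active[OF q] by auto
    then have "q = pos i"
      using act_pos[OF i(1)] inj_onD[OF order_inj, of q "pos i"] \<open>q < m + n\<close> by simp
    then show ?thesis using i by blast
  qed
  then have "{..<Suc d} \<subseteq> pos ` {i. i < n + Suc d \<and> pos i < Suc d}" by auto
  moreover have fin: "finite {i. i < n + Suc d \<and> pos i < Suc d}" by simp
  ultimately have "card {..<Suc d} \<le> card {i. i < n + Suc d \<and> pos i < Suc d}"
    by (meson card_image_le card_mono finite_imageI order_trans)
  moreover have sub: "{i. i < n + Suc d \<and> pos i < Suc d} \<subseteq> {..<Suc d}"
    using pos_ge by (auto intro: le_less_trans)
  ultimately have "{i. i < n + Suc d \<and> pos i < Suc d} = {..<Suc d}"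
    by (intro card_seteq) simp_all
  then show "pos j < Suc d" using j by blast
qed

lemma clique_active: "i < Suc d \<Longrightarrow> j < Suc d \<Longrightarrow> i \<noteq> j \<Longrightarrow> adj (act i) (act j)"
proof -
  assume ij: "i < Suc d" "j < Suc d" "i \<noteq> j"
  have "pos i \<noteq> pos j" using pos_mono[of i j] pos_mono[of j i] ij by (cases i j rule: linorder_cases) auto
  then have "adj (\<pi> (pos i)) (\<pi> (pos j))" using ij by (intro clique pos_clique)
  then show ?thesis using ij act_pos[of i] act_pos[of j] by simp
qed

definition base :: "(nat \<Rightarrow> nat \<Rightarrow> real) \<Rightarrow> nat \<Rightarrow> nat \<Rightarrow> real" where
  "base Om i j = (if j = i then 1
     else if j < i \<and> \<not> adj (act j) (act i) then - Om (act j) (act i) else 0)"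

text \<open>
  How the vector \<open>\<sigma>\<close> for \<open>act i\<close> is composed: \<open>\<xi>\<close> are the weights solved for at the chosen earlier
  neighbours \<open>nb\<close>, and the basis weights \<open>y\<close> replace those at the inactive neighbours.
\<close>

definition step_data :: "(nat \<Rightarrow> nat \<Rightarrow> real) \<Rightarrow> nat \<Rightarrow> (nat \<Rightarrow> real) \<Rightarrow>
    (nat \<Rightarrow> nat) \<Rightarrow> (nat \<Rightarrow> real) \<Rightarrow> (nat \<Rightarrow> real) \<Rightarrow> bool" where
  "step_data Om i \<sigma> nb \<xi> y \<longleftrightarrow>
     nb ` {..<Suc d} \<subseteq> \<pi> ` {p. p < pos i \<and> adj (\<pi> p) (act i)} \<and>
     (\<forall>a<Suc d. (\<Sum>c<Suc d. \<xi> c * X (nb c) a) = - (\<Sum>j<n + Suc d. base Om i j * X (act j) a)) \<and>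
     (\<forall>a<Suc d. (\<Sum>c<Suc d. y c * X (bas c) a) =
        (\<Sum>c<Suc d. (if nb c \<in> active then 0 else \<xi> c) * X (nb c) a)) \<and>
     (\<forall>j<n + Suc d. \<sigma> (act j) = base Om i j +
        (\<Sum>c<Suc d. if nb c \<in> active \<and> nb c = act j then \<xi> c else 0) +
        (\<Sum>c<Suc d. if bas c = act j then y c else 0))"

text \<open>
  What is needed of the vector \<open>\<sigma>\<close> for \<open>act i\<close>, given the matrix \<open>Om\<close> accumulated so far: a pivot 1
  followed by zeros, affine dependence, cancellation at earlier non-adjacent sensors, and, if
  \<open>act i\<close> is a sensor, the guarantee that the anchors before it, with the weights from the new
  column, act like anchors adjacent to it.
\<close>

definition stress_step :: "(nat \<Rightarrow> nat \<Rightarrow> real) \<Rightarrow> nat \<Rightarrow> (nat \<Rightarrow> real) \<Rightarrow> bool" where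
  "stress_step Om i \<sigma> \<longleftrightarrow>
     \<sigma> (act i) = 1 \<and> (\<forall>j. i < j \<longrightarrow> j < n + Suc d \<longrightarrow> \<sigma> (act j) = 0) \<and>
     (\<forall>a<Suc d. (\<Sum>u\<in>active. \<sigma> u * X u a) = 0) \<and>
     (\<forall>j<i. m \<le> act j \<longrightarrow> \<not> adj (act j) (act i) \<longrightarrow> \<sigma> (act j) = - Om (act j) (act i)) \<and>
     (m \<le> act i \<longrightarrow> (\<exists>w. (\<forall>u. w u \<noteq> 0 \<longrightarrow> adj u (act i)) \<and>
        (\<forall>a<Suc d. (\<Sum>u\<in>act ` {..<i} \<inter> {..<m}. (Om u (act i) + \<sigma> u) * X u a) =
           (\<Sum>u<m. w u * X u a))))"

lemma step_dataD:
  assumes "step_data Om i \<sigma> nb \<xi> y"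
  shows "nb ` {..<Suc d} \<subseteq> \<pi> ` {p. p < pos i \<and> adj (\<pi> p) (act i)}"
    and "\<forall>a<Suc d. (\<Sum>c<Suc d. \<xi> c * X (nb c) a) = - (\<Sum>j<n + Suc d. base Om i j * X (act j) a)"
    and "\<forall>a<Suc d. (\<Sum>c<Suc d. y c * X (bas c) a) =
        (\<Sum>c<Suc d. (if nb c \<in> active then 0 else \<xi> c) * X (nb c) a)"
    and "\<forall>j<n + Suc d. \<sigma> (act j) = base Om i j +
        (\<Sum>c<Suc d. if nb c \<in> active \<and> nb c = act j then \<xi> c else 0) +
        (\<Sum>c<Suc d. if bas c = act j then y c else 0)"
  using assms unfolding step_data_def by - (elim conjE, assumption)+

lemma stress_stepD:
  assumes "stress_step Om i \<sigma>"
  shows "\<sigma> (act i) = 1" and "\<forall>j. i < j \<longrightarrow> j < n + Suc d \<longrightarrow> \<sigma> (act j) = 0"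
    and "\<forall>a<Suc d. (\<Sum>u\<in>active. \<sigma> u * X u a) = 0"
    and "\<forall>j<i. m \<le> act j \<longrightarrow> \<not> adj (act j) (act i) \<longrightarrow> \<sigma> (act j) = - Om (act j) (act i)"
    and "m \<le> act i \<longrightarrow> (\<exists>w. (\<forall>u. w u \<noteq> 0 \<longrightarrow> adj u (act i)) \<and>
        (\<forall>a<Suc d. (\<Sum>u\<in>act ` {..<i} \<inter> {..<m}. (Om u (act i) + \<sigma> u) * X u a) =
           (\<Sum>u<m. w u * X u a)))"
  using assms unfolding stress_step_def by - (elim conjE, assumption)+

context
  fixes Om i \<sigma> nb \<xi> y
  assumes i: "i < n + Suc d" and data: "step_data Om i \<sigma> nb \<xi> y"
begin

lemma nb_order:
  assumes "c < Suc d"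
  shows "\<exists>p. p < pos i \<and> nb c = \<pi> p \<and> adj (nb c) (act i)"
proof -
  have "nb ` {..<Suc d} \<subseteq> \<pi> ` {p. p < pos i \<and> adj (\<pi> p) (act i)}"
    by (rule step_dataD(1)[OF data])
  then have "nb c \<in> \<pi> ` {p. p < pos i \<and> adj (\<pi> p) (act i)}" using assms by blast
  then show ?thesis by auto
qed

lemma nb_adj: "c < Suc d \<Longrightarrow> adj (nb c) (act i)"
  using nb_order by blast

lemma nb_active: "c < Suc d \<Longrightarrow> nb c \<in> active \<Longrightarrow> nb c \<in> act ` {..<i}"
  using nb_order[of c] earlier_active[of _ i] i by metis

lemma nb_inactive: "c < Suc d \<Longrightarrow> nb c \<notin> active \<Longrightarrow> nb c < m"
proof -
  assume c: "c < Suc d" "nb c \<notin> active"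
  obtain p where p: "p < pos i" "nb c = \<pi> p" using nb_order[OF c(1)] by blast
  then have "nb c < m + n" using act_pos[OF i] order_range by auto
  then show "nb c < m" using c(2) sensor_active[of "nb c"] by (meson not_le)
qed

lemma basis_earlier: "c < Suc d \<Longrightarrow> nb c \<notin> active \<Longrightarrow> c' < Suc d \<Longrightarrow> bas c' \<in> act ` {..<i}"
proof -
  assume c: "c < Suc d" "nb c \<notin> active" "c' < Suc d"
  obtain p where p: "p < pos i" "nb c = \<pi> p" using nb_order[OF c(1)] by blast
  have pmn: "p < m + n" using p act_pos[OF i] by simp
  have "\<pi> p \<notin> active" using c(2) p(2) by simp
  from inactive_late[OF pmn this] have "bas c' \<in> \<pi> ` {..<p}" using c(3) by blast
  then obtain q where q: "q < p" "bas c' = \<pi> q" by auto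
  have "\<pi> q \<in> active" using bas_active[OF c(3)] unfolding q(2) .
  then show ?thesis using earlier_active[of q i] q p i by simp
qed

text \<open>
  If all chosen neighbours are active, then the weights \<open>y\<close> solve a homogeneous nonsingular system
  and are zero. Otherwise the whole basis comes before \<open>act i\<close>. In both cases the vector does not
  reach beyond \<open>act i\<close>.
\<close>

lemma basis_weight: "c < Suc d \<Longrightarrow> y c \<noteq> 0 \<Longrightarrow> bas c \<in> act ` {..<i}"
proof -
  assume c: "c < Suc d" "y c \<noteq> 0"
  have ind: "independent (Suc d) (\<lambda>c. X (bas c))"
    using position[OF bas_inj] bas_anchor by fastforce
  show ?thesis
  proof (cases "\<exists>c'<Suc d. nb c' \<notin> active")
    case True
    then obtain c' where "c' < Suc d" "nb c' \<notin> active" by blast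
    then show ?thesis using basis_earlier[of c' c] c by blast
  next
    case False
    have "(\<Sum>c<Suc d. y c * X (bas c) a) = 0" if "a < Suc d" for a
    proof -
      have "(\<Sum>c<Suc d. y c * X (bas c) a) =
          (\<Sum>c<Suc d. (if nb c \<in> active then 0 else \<xi> c) * X (nb c) a)"
        by (rule step_dataD(3)[OF data, rule_format, OF that])
      also have "\<dots> = 0" by (rule sum.neutral) (use False in auto)
      finally show ?thesis .
    qed
    then have "y c = 0" by (rule independentD[OF ind _ c(1)])
    then show ?thesis using c by blast
  qed
qed

lemma step_value:
  assumes "u \<in> active"
  shows "\<sigma> u = (\<Sum>j<n + Suc d. if act j = u then base Om i j else 0) +
        (\<Sum>c<Suc d. if nb c \<in> active \<and> nb c = u then \<xi> c else 0) +
        (\<Sum>c<Suc d. if True \<and> bas c = u then y c else 0)"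
proof -
  obtain j where j: "j < n + Suc d" "u = act j" using assms by auto
  have "(\<Sum>k<n + Suc d. if act k = u then base Om i k else 0) =
      (\<Sum>k<n + Suc d. if k = j then base Om i k else 0)"
    unfolding j(2) by (intro sum.cong refl) (use act_eq_iff j in auto)
  also have "\<dots> = base Om i j" using j by simp
  finally show ?thesis using step_dataD(4)[OF data, rule_format, OF j(1)] j(2) by simp
qed

lemma nb_zero:
  assumes "u \<notin> act ` {..<i}"
  shows "(\<Sum>c<Suc d. if nb c \<in> active \<and> nb c = u then \<xi> c else 0) = 0"
  by (rule sum.neutral) (use nb_active assms in auto)

lemma bas_zero:
  assumes "u \<notin> act ` {..<i}"
  shows "(\<Sum>c<Suc d. if bas c = u then y c else 0) = 0"
  by (rule sum.neutral) (use basis_weight assms in auto)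

lemmas step_data_value = step_dataD(4)[OF data, rule_format]

lemma act_not_earlier:
  assumes j: "j < n + Suc d" "i \<le> j"
  shows "act j \<notin> act ` {..<i}"
proof
  assume "act j \<in> act ` {..<i}"
  then obtain k where "k < i" "act j = act k" by auto
  then show False using act_eq_iff[of j k] j by simp
qed

lemma step_equilibrium:
  assumes a: "a < Suc d"
  shows "(\<Sum>u\<in>active. \<sigma> u * X u a) = 0"
proof -
  have fin: "finite active" by simp
  have "(\<Sum>u\<in>active. \<sigma> u * X u a) =
      (\<Sum>u\<in>active. (\<Sum>j<n + Suc d. if True \<and> act j = u then base Om i j else 0) * X u a) +
      (\<Sum>u\<in>active. (\<Sum>c<Suc d. if nb c \<in> active \<and> nb c = u then \<xi> c else 0) * X u a) +
      (\<Sum>u\<in>active. (\<Sum>c<Suc d. if True \<and> bas c = u then y c else 0) * X u a)"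
    unfolding sum.distrib[symmetric]
    by (intro sum.cong refl) (simp only: step_value distrib_right simp_thms)
  also have "\<dots> = (\<Sum>j<n + Suc d. base Om i j * X (act j) a) +
      (\<Sum>c<Suc d. if nb c \<in> active then \<xi> c * X (nb c) a else 0) +
      (\<Sum>c<Suc d. y c * X (bas c) a)"
  proof -
    have 1: "(\<Sum>u\<in>active. (\<Sum>j<n + Suc d. if True \<and> act j = u then base Om i j else 0) * X u a) =
        (\<Sum>j<n + Suc d. base Om i j * X (act j) a)"
      unfolding sum_pushforward[OF finite_lessThan fin] by (intro sum.cong refl) simp
    have 2: "(\<Sum>u\<in>active. (\<Sum>c<Suc d. if nb c \<in> active \<and> nb c = u then \<xi> c else 0) * X u a) =
        (\<Sum>c<Suc d. if nb c \<in> active then \<xi> c * X (nb c) a else 0)"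
      unfolding sum_pushforward[OF finite_lessThan fin] by simp
    have 3: "(\<Sum>u\<in>active. (\<Sum>c<Suc d. if True \<and> bas c = u then y c else 0) * X u a) =
        (\<Sum>c<Suc d. y c * X (bas c) a)"
      unfolding sum_pushforward[OF finite_lessThan fin] by (intro sum.cong refl) (simp add: bas_active)
    show ?thesis unfolding 1 2 3 ..
  qed
  also have "(\<Sum>c<Suc d. y c * X (bas c) a) =
      (\<Sum>c<Suc d. (if nb c \<in> active then 0 else \<xi> c) * X (nb c) a)"
    by (rule step_dataD(3)[OF data, rule_format, OF a])
  also have "(\<Sum>j<n + Suc d. base Om i j * X (act j) a) = - (\<Sum>c<Suc d. \<xi> c * X (nb c) a)"
    using step_dataD(2)[OF data, rule_format, OF a] by simp
  also have "- (\<Sum>c<Suc d. \<xi> c * X (nb c) a) +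
      (\<Sum>c<Suc d. if nb c \<in> active then \<xi> c * X (nb c) a else 0) +
      (\<Sum>c<Suc d. (if nb c \<in> active then 0 else \<xi> c) * X (nb c) a) = 0"
    unfolding sum_negf[symmetric] sum.distrib[symmetric] by (rule sum.neutral) auto
  finally show ?thesis .
qed

text \<open>
  After the update, the entry at an earlier anchor consists of its basis weight and, if the anchor
  is adjacent, of further terms. The basis weights together represent the inactive neighbours, which
  are adjacent anchors, and can be traded for the weights of these.
\<close>

lemma step_anchor_weights:
  "\<exists>w. (\<forall>u. w u \<noteq> 0 \<longrightarrow> adj u (act i)) \<and>
     (\<forall>a<Suc d. (\<Sum>u\<in>act ` {..<i} \<inter> {..<m}. (Om u (act i) + \<sigma> u) * X u a) = (\<Sum>u<m. w u * X u a))"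
proof -
  let ?E = "act ` {..<i} \<inter> {..<m}"
  let ?nb = "\<lambda>u. \<Sum>c<Suc d. if nb c \<in> active \<and> nb c = u then \<xi> c else 0"
  let ?bas = "\<lambda>u. \<Sum>c<Suc d. if bas c = u then y c else 0"
  let ?off = "\<lambda>u. \<Sum>c<Suc d. if nb c \<notin> active \<and> nb c = u then \<xi> c else 0"
  define g where "g u = (if adj u (act i) then Om u (act i) + ?nb u else 0)" for u
  define w where "w u = (if u \<in> ?E then g u else 0) + ?off u" for u
  have nb0: "?nb u = 0" if "\<not> adj u (act i)" for u
    by (rule sum.neutral) (use nb_adj that in auto)
  have off0: "?off u = 0" if "\<not> adj u (act i)" for u
    by (rule sum.neutral) (use nb_adj that in auto)
  have val: "Om u (act i) + \<sigma> u = g u + ?bas u" if u: "u \<in> ?E" for u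
  proof -
    obtain j where j: "j < i" "u = act j" using u by auto
    have "\<sigma> u = base Om i j + ?nb u + ?bas u" using step_data_value[of j] j i by simp
    then show ?thesis using j nb0[of u] by (cases "adj u (act i)") (simp_all add: g_def base_def)
  qed
  have sup: "w u \<noteq> 0 \<longrightarrow> adj u (act i)" for u
    unfolding w_def g_def using off0[of u] by auto
  have "(\<Sum>u\<in>?E. (Om u (act i) + \<sigma> u) * X u a) = (\<Sum>u<m. w u * X u a)" if a: "a < Suc d" for a
  proof -
    have fE: "finite ?E" by simp
    have "(\<Sum>u\<in>?E. (Om u (act i) + \<sigma> u) * X u a) =
        (\<Sum>u\<in>?E. g u * X u a) + (\<Sum>u\<in>?E. (\<Sum>c<Suc d. if True \<and> bas c = u then y c else 0) * X u a)"
      unfolding sum.distrib[symmetric]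
      by (intro sum.cong refl) (simp only: val distrib_right simp_thms)
    also have "(\<Sum>u\<in>?E. (\<Sum>c<Suc d. if True \<and> bas c = u then y c else 0) * X u a) =
        (\<Sum>c<Suc d. y c * X (bas c) a)"
      unfolding sum_pushforward[OF finite_lessThan fE]
    proof (rule sum.cong[OF refl])
      fix c assume c: "c \<in> {..<Suc d}"
      have "bas c < m" using bas_anchor c by blast
      then show "(if True \<and> bas c \<in> ?E then y c * X (bas c) a else 0) = y c * X (bas c) a"
        using basis_weight[of c] c by auto
    qed
    also have "\<dots> = (\<Sum>c<Suc d. (if nb c \<in> active then 0 else \<xi> c) * X (nb c) a)"
      by (rule step_dataD(3)[OF data, rule_format, OF a])
    also have "\<dots> = (\<Sum>u\<in>{..<m}. ?off u * X u a)"
      unfolding sum_pushforward[OF finite_lessThan finite_lessThan]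
      by (intro sum.cong refl) (use nb_inactive in auto)
    also have "(\<Sum>u\<in>?E. g u * X u a) = (\<Sum>u<m. (if u \<in> ?E then g u else 0) * X u a)"
    proof -
      have "(\<Sum>u<m. (if u \<in> ?E then g u else 0) * X u a) =
          (\<Sum>u\<in>?E. (if u \<in> ?E then g u else 0) * X u a)"
        by (rule sum.mono_neutral_right) auto
      also have "\<dots> = (\<Sum>u\<in>?E. g u * X u a)" by (intro sum.cong refl) simp
      finally show ?thesis by simp
    qed
    also have "(\<Sum>u<m. (if u \<in> ?E then g u else 0) * X u a) + (\<Sum>u<m. ?off u * X u a) =
        (\<Sum>u<m. w u * X u a)"
      unfolding sum.distrib[symmetric] w_def distrib_right ..
    finally show ?thesis .
  qed
  then show ?thesis using sup by (intro exI[of _ w] conjI) blast+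
qed

lemma step_data_stress_step: "stress_step Om i \<sigma>"
  unfolding stress_step_def
proof (intro conjI allI impI)
  show "\<sigma> (act i) = 1"
    using step_data_value[OF i] nb_zero[OF act_not_earlier[OF i]] bas_zero[OF act_not_earlier[OF i]]
    by (simp add: base_def)
next
  fix j assume "i < j" "j < n + Suc d"
  then show "\<sigma> (act j) = 0"
    using step_data_value[of j] nb_zero[OF act_not_earlier[of j]] bas_zero[OF act_not_earlier[of j]]
    by (simp add: base_def)
next
  fix j assume j: "j < i" "m \<le> act j" "\<not> adj (act j) (act i)"
  have "(\<Sum>c<Suc d. if nb c \<in> active \<and> nb c = act j then \<xi> c else 0) = 0"
  proof (rule sum.neutral, rule ballI)
    fix c assume "c \<in> {..<Suc d}"
    then have "nb c \<noteq> act j" using nb_adj[of c] j by auto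
    then show "(if nb c \<in> active \<and> nb c = act j then \<xi> c else 0) = 0" by simp
  qed
  moreover have "(\<Sum>c<Suc d. if bas c = act j then y c else 0) = 0"
  proof (rule sum.neutral, rule ballI)
    fix c assume "c \<in> {..<Suc d}"
    then have "bas c < m" using bas_anchor by blast
    then show "(if bas c = act j then y c else 0) = 0" using j by auto
  qed
  ultimately show "\<sigma> (act j) = - Om (act j) (act i)"
    using step_data_value[of j] j i by (simp add: base_def)
qed (use step_equilibrium step_anchor_weights in blast)+

end

text \<open>
  The vectors are computed from the last one down, so this is the matrix that the vector \<open>k - 1\<close>
  finds.
\<close>

definition later :: "(nat \<Rightarrow> nat \<Rightarrow> real) \<Rightarrow> nat \<Rightarrow> nat \<Rightarrow> nat \<Rightarrow> real" where
  "later s k u v = (\<Sum>l\<in>{k..<n + Suc d}. s l u * s l v)"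

lemma later_sym: "later s k u v = later s k v u"
  unfolding later_def by (intro sum.cong refl) (rule mult.commute)

context
  fixes s :: "nat \<Rightarrow> nat \<Rightarrow> real"
  assumes steps: "\<And>l. Suc d \<le> l \<Longrightarrow> l < n + Suc d \<Longrightarrow> stress_step (later s (Suc l)) l (s l)"
begin

abbreviation "stress \<equiv> later s (Suc d)"

lemma vector_pivot: "Suc d \<le> l \<Longrightarrow> l < n + Suc d \<Longrightarrow> s l (act l) = 1"
  by (rule stress_stepD(1)[OF steps])

lemma vector_zero: "Suc d \<le> l \<Longrightarrow> l < j \<Longrightarrow> j < n + Suc d \<Longrightarrow> s l (act j) = 0"
  using stress_stepD(2)[OF steps[of l]] by simp

lemma vector_equilibrium:
  "Suc d \<le> l \<Longrightarrow> l < n + Suc d \<Longrightarrow> a < Suc d \<Longrightarrow> (\<Sum>u\<in>active. s l u * X u a) = 0"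
  using stress_stepD(3)[OF steps[of l]] by blast

text \<open>Vectors with smaller indices vanish at \<open>act k\<close>, so the vector \<open>k\<close> completes this column.\<close>

lemma stress_column:
  assumes k: "Suc d \<le> k" "k < n + Suc d"
  shows "stress u (act k) = later s (Suc k) u (act k) + s k u"
proof -
  have "stress u (act k) = (\<Sum>l\<in>{k..<n + Suc d}. s l u * s l (act k))"
    unfolding later_def using k vector_zero by (intro sum.mono_neutral_right) auto
  also have "{k..<n + Suc d} = insert k {Suc k..<n + Suc d}" using k by auto
  finally show ?thesis using vector_pivot[OF k] by (simp add: later_def)
qed

lemma stress_nonadjacent:
  assumes jk: "j < k" "k < n + Suc d" and s: "m \<le> act j" and a: "\<not> adj (act j) (act k)"
  shows "stress (act j) (act k) = 0"
proof -
  have k: "Suc d \<le> k" using clique_active[of j k] jk a by (cases "k < Suc d") auto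
  have "s k (act j) = - later s (Suc k) (act j) (act k)"
    using stress_stepD(4)[OF steps[OF k jk(2)]] jk s a by blast
  then show ?thesis using stress_column[OF k jk(2)] by simp
qed

lemma stress_nonadjacent_sensors:
  assumes uv: "m \<le> u" "u < m + n" "m \<le> v" "v < m + n" "u \<noteq> v" "\<not> adj u v"
  shows "stress u v = 0"
proof -
  obtain j where j: "j < n + Suc d" "u = act j" using sensor_active[OF uv(1,2)] by auto
  obtain k where k: "k < n + Suc d" "v = act k" using sensor_active[OF uv(3,4)] by auto
  show ?thesis
  proof (cases j k rule: linorder_cases)
    case less
    then show ?thesis using stress_nonadjacent[of j k] j k uv by simp
  next
    case greater
    then show ?thesis using stress_nonadjacent[of k j] j k uv adj_sym[of v u] later_sym[of s _ u v] by auto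
  qed (use j k uv in simp)
qed

lemma stress_equilibrium:
  assumes a: "a < Suc d"
  shows "(\<Sum>u\<in>active. stress u v * X u a) = 0"
proof -
  have "(\<Sum>u\<in>active. stress u v * X u a) =
      (\<Sum>u\<in>active. \<Sum>l\<in>{Suc d..<n + Suc d}. s l v * (s l u * X u a))"
    unfolding later_def sum_distrib_right by (intro sum.cong refl) (simp add: algebra_simps)
  also have "\<dots> = (\<Sum>l\<in>{Suc d..<n + Suc d}. \<Sum>u\<in>active. s l v * (s l u * X u a))"
    by (rule sum.swap)
  also have "\<dots> = 0"
    unfolding sum_distrib_left[symmetric]
    by (rule sum.neutral) (use vector_equilibrium a in auto)
  finally show ?thesis .
qed

text \<open>
  At a basis anchor after the sensor \<open>v\<close>, a non-adjacent entry was cancelled when the vector of that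
  anchor was computed. The anchors before \<open>v\<close> are taken care of by the vector of \<open>v\<close>. If \<open>v\<close> is one
  of the first \<open>d + 1\<close> active vertices, it has no vector, but then all earlier ones are adjacent to
  it.
\<close>

lemma stress_anchor_weights:
  assumes v: "m \<le> v" "v < m + n"
  shows "\<exists>w. (\<forall>u. w u \<noteq> 0 \<longrightarrow> adj u v) \<and>
    (\<forall>a<Suc d. (\<Sum>u\<in>active \<inter> {..<m}. stress u v * X u a) = (\<Sum>u<m. w u * X u a))"
proof -
  obtain k where k: "k < n + Suc d" "v = act k" using sensor_active[OF v] by auto
  define E where "E = (if k < Suc d then {} else act ` {..<k} \<inter> {..<m})"
  have E_sub: "E \<subseteq> active \<inter> {..<m}" using k unfolding E_def by auto
  have fin: "finite (active \<inter> {..<m})" by simp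
  obtain w0 where w0: "\<And>u. w0 u \<noteq> 0 \<Longrightarrow> adj u v"
    and eq0: "\<And>a. a < Suc d \<Longrightarrow> (\<Sum>u\<in>E. stress u v * X u a) = (\<Sum>u<m. w0 u * X u a)"
  proof (cases "k < Suc d")
    case True
    then show ?thesis using that[of "\<lambda>_. 0"] by (simp add: E_def)
  next
    case False
    then have kd: "Suc d \<le> k" by simp
    obtain w where w: "\<forall>u. w u \<noteq> 0 \<longrightarrow> adj u (act k)"
      "\<forall>a<Suc d. (\<Sum>u\<in>act ` {..<k} \<inter> {..<m}. (later s (Suc k) u (act k) + s k u) * X u a) =
           (\<Sum>u<m. w u * X u a)"
      using stress_stepD(5)[OF steps[OF kd k(1)]] v k by blast
    show ?thesis
    proof (rule that[of w])
      fix u assume "w u \<noteq> 0"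
      then show "adj u v" using w k by blast
    next
      fix a assume "a < Suc d"
      then show "(\<Sum>u\<in>E. stress u v * X u a) = (\<Sum>u<m. w u * X u a)"
        using w(2) False unfolding k(2) stress_column[OF kd k(1)] E_def by simp
    qed
  qed
  (* Weights for the anchors that the vector of v does not account for. *)
  define w1 where "w1 u = (if u \<in> active \<inter> {..<m} - E \<and> adj u v then stress u v else 0)" for u
  have z: "stress u v = 0" if u: "u \<in> active \<inter> {..<m} - E" "\<not> adj u v" for u
  proof -
    obtain j where j: "j < n + Suc d" "u = act j" using u by auto
    have "j \<noteq> k" using j k u v by auto
    have "\<not> j < k"
    proof
      assume "j < k"
      then have "k < Suc d" using u j unfolding E_def by (auto split: if_splits)
      then show False using clique_active[of j k] \<open>j < k\<close> u j k by simp
    qed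
    then have "k < j" using \<open>j \<noteq> k\<close> by simp
    then have "stress (act k) (act j) = 0"
      using stress_nonadjacent[of k j] j k u v adj_sym[of v u] by auto
    then show ?thesis using later_sym[of s _ u v] j k by simp
  qed
  have "(\<Sum>u\<in>active \<inter> {..<m}. stress u v * X u a) = (\<Sum>u<m. (w0 u + w1 u) * X u a)"
    if a: "a < Suc d" for a
  proof -
    have "(\<Sum>u\<in>active \<inter> {..<m}. stress u v * X u a) =
        (\<Sum>u\<in>active \<inter> {..<m} - E. stress u v * X u a) + (\<Sum>u\<in>E. stress u v * X u a)"
      by (rule sum.subset_diff[OF E_sub fin])
    also have "(\<Sum>u\<in>active \<inter> {..<m} - E. stress u v * X u a) =
        (\<Sum>u\<in>active \<inter> {..<m} - E. w1 u * X u a)"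
      by (intro sum.cong refl) (use z in \<open>auto simp: w1_def\<close>)
    also have "\<dots> = (\<Sum>u<m. w1 u * X u a)"
      by (rule sum.mono_neutral_left) (auto simp: w1_def)
    finally show ?thesis using eq0[OF a] by (simp add: distrib_right sum.distrib)
  qed
  moreover have "adj u v" if "w0 u + w1 u \<noteq> 0" for u
    using that w0[of u] by (auto simp: w1_def split: if_splits)
  ultimately show ?thesis by (intro exI[of _ "\<lambda>u. w0 u + w1 u"] conjI) blast+
qed

lemma sum_active:
  fixes F :: "nat \<Rightarrow> real"
  shows "(\<Sum>u\<in>active. F u) = (\<Sum>i<n. F (m + i)) + (\<Sum>u\<in>active \<inter> {..<m}. F u)"
proof -
  have "active = (+) m ` {..<n} \<union> (active \<inter> {..<m})"
  proof -
    have "(+) m ` {..<n} = {m..<m + n}"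
      using image_add_atLeastLessThan[of m 0 n] by (simp add: atLeast0LessThan add.commute)
    then show ?thesis using act_image bas_anchor by auto
  qed
  then have "(\<Sum>u\<in>active. F u) = (\<Sum>u\<in>(+) m ` {..<n} \<union> (active \<inter> {..<m}). F u)" by metis
  also have "\<dots> = (\<Sum>u\<in>(+) m ` {..<n}. F u) + (\<Sum>u\<in>active \<inter> {..<m}. F u)"
    by (rule sum.union_disjoint) auto
  also have "(\<Sum>u\<in>(+) m ` {..<n}. F u) = (\<Sum>i<n. F (m + i))"
    by (subst sum.reindex) auto
  finally show ?thesis .
qed

definition sensor_stress :: "nat \<Rightarrow> nat \<Rightarrow> real" where
  "sensor_stress i j = stress (m + i) (m + j)"

lemma sensor_stress_sym: "sensor_stress i j = sensor_stress j i"
  unfolding sensor_stress_def by (rule later_sym)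

lemma sensor_stress_nonadjacent:
  "i < n \<Longrightarrow> j < n \<Longrightarrow> i \<noteq> j \<Longrightarrow> \<not> adj (m + i) (m + j) \<Longrightarrow> sensor_stress i j = 0"
  unfolding sensor_stress_def by (rule stress_nonadjacent_sensors) auto

lemma sensor_stress_anchored:
  assumes j: "j < n"
  shows "\<exists>w. (\<forall>u. w u \<noteq> 0 \<longrightarrow> adj u (m + j)) \<and>
    (\<forall>a<Suc d. (\<Sum>i<n. sensor_stress i j * X (m + i) a) = (\<Sum>u<m. w u * X u a))"
proof -
  obtain w where w: "\<forall>u. w u \<noteq> 0 \<longrightarrow> adj u (m + j)"
    "\<forall>a<Suc d. (\<Sum>u\<in>active \<inter> {..<m}. stress u (m + j) * X u a) = (\<Sum>u<m. w u * X u a)"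
    using stress_anchor_weights[of "m + j"] j by auto
  have "(\<Sum>i<n. sensor_stress i j * X (m + i) a) = (\<Sum>u<m. - w u * X u a)" if a: "a < Suc d" for a
    using stress_equilibrium[OF a, of "m + j"] w(2)[rule_format, OF a] unfolding sum_active sensor_stress_def
    by (simp add: sum_negf)
  then show ?thesis using w(1) by (intro exI[of _ "\<lambda>u. - w u"]) simp
qed

text \<open>
  Choose the affine function \<open>f\<close> that agrees with \<open>z\<close> on the first \<open>d + 1\<close> active vertices. It is
  orthogonal to all vectors too, and the vector of a further vertex determines the value there from
  the earlier ones; hence \<open>f\<close> and \<open>z\<close> agree on all active vertices. As \<open>f\<close> vanishes on the basis,
  which is in general position, it is zero.
\<close>

lemma affine_zero:
  assumes z: "\<And>c. c < Suc d \<Longrightarrow> z (bas c) = 0"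
    and s: "\<And>l. Suc d \<le> l \<Longrightarrow> l < n + Suc d \<Longrightarrow> (\<Sum>u\<in>active. s l u * z u) = 0"
    and u: "u \<in> active"
  shows "z u = 0"
proof -
  have ind: "independent (Suc d) (\<lambda>c. X (act c))"
  proof (rule position)
    show "inj_on act {..<Suc d}" using act_inj by (rule inj_on_subset) auto
    show "act ` {..<Suc d} \<subseteq> {..<m + n}" using act_less by fastforce
  qed
  obtain y where y: "\<And>j. j < Suc d \<Longrightarrow> (\<Sum>a<Suc d. X (act j) a * y a) = z (act j)"
    using independent_solvable[OF ind, of "\<lambda>j. z (act j)"] by blast
  define f where "f u = (\<Sum>a<Suc d. X u a * y a)" for u
  have f0: "(\<Sum>u\<in>active. s l u * f u) = 0" if l: "Suc d \<le> l" "l < n + Suc d" for l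
  proof -
    have "(\<Sum>u\<in>active. s l u * f u) = (\<Sum>u\<in>active. \<Sum>a<Suc d. y a * (s l u * X u a))"
      unfolding f_def sum_distrib_left by (intro sum.cong refl) (simp add: algebra_simps)
    also have "\<dots> = (\<Sum>a<Suc d. \<Sum>u\<in>active. y a * (s l u * X u a))" by (rule sum.swap)
    also have "\<dots> = 0"
      unfolding sum_distrib_left[symmetric]
      by (rule sum.neutral) (use vector_equilibrium[OF l] in auto)
    finally show ?thesis .
  qed
  have agree: "z (act j) = f (act j)" if "j < n + Suc d" for j
    using that
  proof (induction j rule: less_induct)
    case (less j)
    show ?case
    proof (cases "j < Suc d")
      case True
      then show ?thesis using y by (simp add: f_def)
    next
      case False
      then have j: "Suc d \<le> j" by simp
      have "(\<Sum>u\<in>active. s j u * (z u - f u)) = 0"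
        using s[OF j less.prems] f0[OF j less.prems] by (simp add: right_diff_distrib sum_subtractf)
      moreover have "(\<Sum>u\<in>active. s j u * (z u - f u)) =
          (\<Sum>k<n + Suc d. s j (act k) * (z (act k) - f (act k)))"
        by (subst sum.reindex[OF act_inj]) simp
      moreover have "\<dots> = (\<Sum>k\<in>{j}. s j (act k) * (z (act k) - f (act k)))"
      proof (rule sum.mono_neutral_right)
        show "\<forall>k\<in>{..<n + Suc d} - {j}. s j (act k) * (z (act k) - f (act k)) = 0"
        proof
          fix k assume k: "k \<in> {..<n + Suc d} - {j}"
          show "s j (act k) * (z (act k) - f (act k)) = 0"
          proof (cases "k < j")
            case True
            then show ?thesis using less.IH[of k] k by simp
          next
            case False
            then show ?thesis using vector_zero[OF j, of k] k by simp
          qed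
        qed
      qed (use less.prems in auto)
      ultimately show ?thesis using vector_pivot[OF j less.prems] by simp
    qed
  qed
  have ind': "independent (Suc d) (\<lambda>a c. X (bas c) a)"
    by (rule independent_transpose, rule position[OF bas_inj]) (use bas_anchor in fastforce)
  have fb: "(\<Sum>a<Suc d. y a * X (bas c) a) = 0" if c: "c < Suc d" for c
  proof -
    obtain j where "j < n + Suc d" "bas c = act j" using bas_active[OF c] by auto
    then have "f (bas c) = 0" using agree[of j] z[OF c] by simp
    then show ?thesis by (simp add: f_def mult.commute)
  qed
  have "y a = 0" if "a < Suc d" for a
    by (rule independentD[OF ind' _ that]) (rule fb)
  then have "f u = 0" by (simp add: f_def)
  then show ?thesis using agree u by auto
qed

lemma sensor_stress_quadratic:
  "(\<Sum>i<n. \<Sum>j<n. x i * sensor_stress i j * x j) =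
     (\<Sum>l\<in>{Suc d..<n + Suc d}. (\<Sum>i<n. s l (m + i) * x i)\<^sup>2)"
proof -
  have "(\<Sum>i<n. \<Sum>j<n. x i * sensor_stress i j * x j) =
      (\<Sum>i<n. \<Sum>j<n. \<Sum>l\<in>{Suc d..<n + Suc d}. (s l (m + i) * x i) * (s l (m + j) * x j))"
    unfolding sensor_stress_def later_def sum_distrib_left sum_distrib_right
    by (intro sum.cong refl) (simp add: algebra_simps)
  also have "\<dots> = (\<Sum>i<n. \<Sum>l\<in>{Suc d..<n + Suc d}. \<Sum>j<n. (s l (m + i) * x i) * (s l (m + j) * x j))"
    by (rule sum.cong[OF refl], rule sum.swap)
  also have "\<dots> = (\<Sum>l\<in>{Suc d..<n + Suc d}. \<Sum>i<n. \<Sum>j<n. (s l (m + i) * x i) * (s l (m + j) * x j))"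
    by (rule sum.swap)
  also have "\<dots> = (\<Sum>l\<in>{Suc d..<n + Suc d}. (\<Sum>i<n. s l (m + i) * x i)\<^sup>2)"
    unfolding power2_eq_square sum_product ..
  finally show ?thesis .
qed

lemma sensor_stress_nonneg: "0 \<le> (\<Sum>i<n. \<Sum>j<n. x i * sensor_stress i j * x j)"
  unfolding sensor_stress_quadratic by (rule sum_nonneg) simp

text \<open>A zero of the quadratic form, extended by 0 to the basis, is orthogonal to all vectors.\<close>

lemma sensor_stress_definite:
  assumes q: "(\<Sum>i<n. \<Sum>j<n. x i * sensor_stress i j * x j) = 0" and i: "i < n"
  shows "x i = 0"
proof -
  define z where "z u = (if m \<le> u then x (u - m) else 0)" for u
  have "(\<Sum>i<n. s l (m + i) * x i)\<^sup>2 = 0" if "Suc d \<le> l" "l < n + Suc d" for l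
    using q that unfolding sensor_stress_quadratic by (subst (asm) sum_nonneg_eq_0_iff) auto
  then have l0: "(\<Sum>i<n. s l (m + i) * x i) = 0" if "Suc d \<le> l" "l < n + Suc d" for l
    using that by simp
  have "z (m + i) = 0"
  proof (rule affine_zero)
    fix c assume "c < Suc d"
    then have "bas c < m" using bas_anchor by blast
    then show "z (bas c) = 0" by (simp add: z_def)
  next
    fix l assume l: "Suc d \<le> l" "l < n + Suc d"
    have "(\<Sum>u\<in>active \<inter> {..<m}. s l u * z u) = 0" by (rule sum.neutral) (auto simp: z_def)
    then show "(\<Sum>u\<in>active. s l u * z u) = 0"
      unfolding sum_active using l0[OF l] by (simp add: z_def)
  next
    show "m + i \<in> active" using sensor_active[of "m + i"] i by simp
  qed
  then show ?thesis by (simp add: z_def)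
qed

end

end

declare add_Suc_right [simp] sum.lessThan_Suc [simp]

section \<open>The loop over the active vertices\<close>

definition step_body :: com where
  "step_body = Seq pick (Seq neighbours (Seq start (Seq defect (Seq (solve ''nb'')
     (Seq keep_active (Seq leftover (Seq (solve ''bas'') (Seq add_basis update))))))))"

definition program :: com where
  "program = Seq coordinates (Seq select (Seq (For ''t'' (nvar ''n'') step_body) write_output))"

lemma writes_step_body [simp]:
  "nat_writes step_body = {''i'', ''v'', ''cnt'', ''q'', ''nb'', ''j'', ''a'', ''c'', ''e'', ''k''}"
  "real_writes step_body = {''s'', ''b'', ''g'', ''del'', ''res'', ''tau'', ''x'', ''H'', ''Om''}"
  by (auto simp: step_body_def)

abbreviation "table_names \<equiv>
  {''d'', ''m'', ''n'', ''ord'', ''adj'', ''act'', ''pos'', ''bas'', ''isact''}"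

context lateration_tables
begin

definition tables :: "state \<Rightarrow> bool" where
  "tables s \<longleftrightarrow> nat_mem s ''d'' 0 0 = d \<and> nat_mem s ''m'' 0 0 = m \<and> nat_mem s ''n'' 0 0 = n \<and>
     (\<forall>p<m + n. nat_mem s ''ord'' p 0 = \<pi> p) \<and>
     (\<forall>u<m + n. \<forall>v<m + n. 0 < nat_mem s ''adj'' u v \<longleftrightarrow> adj u v) \<and>
     (\<forall>i. nat_mem s ''act'' i 0 = act i) \<and> (\<forall>i. nat_mem s ''pos'' i 0 = pos i) \<and>
     (\<forall>i. nat_mem s ''bas'' i 0 = bas i) \<and> (\<forall>v. nat_mem s ''isact'' v 0 = of_bool (v \<in> active)) \<and>
     real_mem s ''X'' = X"

lemma tables_cong:
  assumes "tables s" "\<And>y. y \<in> table_names \<Longrightarrow> nat_mem t y = nat_mem s y"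
    "real_mem t ''X'' = real_mem s ''X''"
  shows "tables t"
  using assms(1) unfolding tables_def by (simp add: assms(2,3))

lemma tablesD:
  assumes "tables s"
  shows "nat_mem s ''d'' 0 0 = d" "nat_mem s ''m'' 0 0 = m" "nat_mem s ''n'' 0 0 = n"
    "\<And>p. p < m + n \<Longrightarrow> nat_mem s ''ord'' p 0 = \<pi> p"
    "\<And>u v. u < m + n \<Longrightarrow> v < m + n \<Longrightarrow> 0 < nat_mem s ''adj'' u v \<longleftrightarrow> adj u v"
    "\<And>i. nat_mem s ''act'' i 0 = act i" "\<And>i. nat_mem s ''pos'' i 0 = pos i"
    "\<And>i. nat_mem s ''bas'' i 0 = bas i" "\<And>v. nat_mem s ''isact'' v 0 = of_bool (v \<in> active)"
    "real_mem s ''X'' = X"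
  using assms unfolding tables_def by simp_all

lemma exec_step_body:
  assumes t: "tables t" and k: "nat_mem t ''t'' 0 0 = k" "k < n"
  defines "l \<equiv> n + d - k" and "\<sigma> \<equiv> \<lambda>u. real_mem (exec step_body t) ''s'' u 0"
  shows "stress_step (real_mem t ''Om'') l \<sigma> \<and> (\<forall>i<n + Suc d. \<forall>j<n + Suc d.
     real_mem (exec step_body t) ''Om'' (act i) (act j) =
       real_mem t ''Om'' (act i) (act j) + \<sigma> (act i) * \<sigma> (act j))"
proof -
  have l: "l < n + Suc d" "Suc d \<le> l" using k(2) unfolding l_def by simp_all
  define s1 where "s1 = exec pick t"
  define s2 where "s2 = exec neighbours s1"
  define s3 where "s3 = exec start s2"
  define s4 where "s4 = exec defect s3"
  define s5 where "s5 = exec (solve ''nb'') s4"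
  define s6 where "s6 = exec keep_active s5"
  define s7 where "s7 = exec leftover s6"
  define s8 where "s8 = exec (solve ''bas'') s7"
  define s9 where "s9 = exec add_basis s8"
  have body: "exec step_body t = exec update s9"
    by (simp add: step_body_def s1_def s2_def s3_def s4_def s5_def s6_def s7_def s8_def s9_def)
  have t1: "tables s1" by (rule tables_cong[OF t]) (auto simp: s1_def)
  have t2: "tables s2" by (rule tables_cong[OF t1]) (auto simp: s2_def)
  have t3: "tables s3" by (rule tables_cong[OF t2]) (auto simp: s3_def)
  have t4: "tables s4" by (rule tables_cong[OF t3]) (auto simp: s4_def)
  have t5: "tables s5" by (rule tables_cong[OF t4]) (auto simp: s5_def)
  have t6: "tables s6" by (rule tables_cong[OF t5]) (auto simp: s6_def)
  have t7: "tables s7" by (rule tables_cong[OF t6]) (auto simp: s7_def)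
  have t8: "tables s8" by (rule tables_cong[OF t7]) (auto simp: s8_def)
  have t9: "tables s9" by (rule tables_cong[OF t8]) (auto simp: s9_def)
  have s1: "nat_mem s1 ''i'' 0 0 = l" "nat_mem s1 ''v'' 0 0 = act l" "nat_mem s1 ''cnt'' 0 0 = 0"
    using tablesD(1,3,6)[OF t] k by (simp_all add: s1_def pick_def l_def)
  have s2: "nat_mem s2 ''i'' 0 0 = l" "nat_mem s2 ''v'' 0 0 = act l"
    using s1 by (simp_all add: s2_def)
  define nb where "nb c = nat_mem s2 ''nb'' c 0" for c
  have nb: "inj_on nb {..<Suc d} \<and> nb ` {..<Suc d} \<subseteq> \<pi> ` {p. p < pos l \<and> adj (\<pi> p) (act l)}"
    unfolding nb_def s2_def
  proof (rule exec_neighbours)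
    show "nat_mem s1 ''d'' 0 0 = d" "nat_mem s1 ''m'' 0 0 = m" "nat_mem s1 ''n'' 0 0 = n"
      using tablesD(1-3)[OF t1] by simp_all
    show "\<And>p. p < m + n \<Longrightarrow> nat_mem s1 ''ord'' p 0 = \<pi> p" by (rule tablesD(4)[OF t1])
    show "inj_on \<pi> {..<m + n}" by (rule order_inj)
    show "(0 < nat_mem s1 ''adj'' (\<pi> p) (nat_mem s1 ''v'' 0 0)) = adj (\<pi> p) (act l)"
      if p: "p < m + n" for p
    proof -
      have "\<pi> p < m + n" using order_range p by auto
      then show ?thesis unfolding s1(2) by (rule tablesD(5)[OF t1 _ act_less[OF l(1)]])
    qed
    show "nat_mem s1 ''cnt'' 0 0 = 0" by (rule s1)
    show "nat_mem s1 ''pos'' (nat_mem s1 ''i'' 0 0) 0 = pos l"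
      unfolding s1(1) by (rule tablesD(7)[OF t1])
    have pl: "pos l < m + n" "act l = \<pi> (pos l)" using act_pos[OF l(1)] by simp_all
    then show "pos l \<le> m + n" by simp
    show "Suc d \<le> card {p. p < pos l \<and> adj (\<pi> p) (act l)}"
      unfolding pl(2) using many_neighbours[OF _ pl(1)] pos_ge[OF l(1)] l(2) by simp
  qed
  have nb_range: "nb ` {..<Suc d} \<subseteq> {..<m + n}"
  proof -
    have "\<pi> ` {p. p < pos l \<and> adj (\<pi> p) (act l)} \<subseteq> \<pi> ` {..<m + n}"
      using act_pos[OF l(1)] by auto
    then show ?thesis using nb unfolding order_range by blast
  qed
  let ?Om = "real_mem t ''Om''"
  have om2: "real_mem s2 ''Om'' = ?Om" by (simp add: s2_def s1_def)
  have base: "real_mem s3 ''s'' (act j) 0 = base ?Om l j" if j: "j < n + Suc d" for j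
  proof -
    have "real_mem s3 ''s'' (act j) 0 = (if j = l then 1
      else if j < l \<and> nat_mem s2 ''adj'' (act j) (act l) = 0 then - real_mem s2 ''Om'' (act j) (act l)
      else 0)"
      unfolding s3_def
      by (rule exec_start[OF tablesD(1,3,6)[OF t2] act_inj s2 l(1) j])
    moreover have "nat_mem s2 ''adj'' (act j) (act l) = 0 \<longleftrightarrow> \<not> adj (act j) (act l)"
      using tablesD(5)[OF t2 act_less[OF j] act_less[OF l(1)]] by auto
    ultimately show ?thesis by (simp add: base_def om2)
  qed
  have b4: "real_mem s4 ''b'' a 0 = - (\<Sum>j<n + Suc d. base ?Om l j * X (act j) a)" if "a < Suc d" for a
  proof -
    have "real_mem s4 ''b'' a 0 = - (\<Sum>j<n + Suc d. real_mem s3 ''s'' (act j) 0 * X (act j) a)"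
      using exec_defect[OF tablesD(1,3)[OF t3]] that unfolding s4_def
      by (simp add: tablesD(6,10)[OF t3])
    then show ?thesis by (simp add: base)
  qed
  define \<xi> where "\<xi> c = real_mem s5 ''x'' c 0" for c
  have nb4: "nat_mem s4 ''nb'' c 0 = nb c" "nat_mem s5 ''nb'' c 0 = nb c" "nat_mem s6 ''nb'' c 0 = nb c" for c
    by (simp_all add: s6_def s5_def s4_def s3_def nb_def)
  have \<xi>: "(\<Sum>c<Suc d. \<xi> c * X (nb c) a) = - (\<Sum>j<n + Suc d. base ?Om l j * X (act j) a)"
    if a: "a < Suc d" for a
  proof -
    have ind: "independent (Suc d) (\<lambda>c. X (nb c))" using position nb nb_range by blast
    have "(\<Sum>c<Suc d. real_mem (exec (solve ''nb'') s4) ''x'' c 0 *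
        real_mem s4 ''X'' (nat_mem s4 ''nb'' c 0) a) = real_mem s4 ''b'' a 0"
      by (rule exec_solve[OF tablesD(1)[OF t4] _ _ a]) (simp_all add: nb4 tablesD(10)[OF t4] ind)
    then show ?thesis unfolding b4[OF a] by (simp add: \<xi>_def s5_def[symmetric] nb4 tablesD(10)[OF t4])
  qed
  have A: "0 < nat_mem s5 ''isact'' (nat_mem s5 ''nb'' c 0) 0 \<longleftrightarrow> nb c \<in> active" for c
    by (simp add: nb4 tablesD(9)[OF t5])
  have keep: "(\<forall>u. real_mem s6 ''s'' u 0 = real_mem s5 ''s'' u 0 +
      (\<Sum>c<Suc d. if nb c \<in> active \<and> nb c = u then \<xi> c else 0)) \<and>
     (\<forall>c<Suc d. real_mem s6 ''x'' c 0 = (if nb c \<in> active then 0 else \<xi> c))"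
    using exec_keep_active[OF tablesD(1)[OF t5]] unfolding s6_def[symmetric] A unfolding nb4 \<xi>_def .
  have b7: "real_mem s7 ''b'' a 0 = (\<Sum>c<Suc d. (if nb c \<in> active then 0 else \<xi> c) * X (nb c) a)"
    if "a < Suc d" for a
  proof -
    have "real_mem s7 ''b'' a 0 = (\<Sum>c<Suc d. real_mem s6 ''x'' c 0 * X (nb c) a)"
      using exec_leftover[OF tablesD(1)[OF t6]] that unfolding s7_def
      by (simp add: nb4 tablesD(10)[OF t6])
    also have "\<dots> = (\<Sum>c<Suc d. (if nb c \<in> active then 0 else \<xi> c) * X (nb c) a)"
      by (rule sum.cong[OF refl]) (simp add: keep)
    finally show ?thesis .
  qed
  define y where "y c = real_mem s8 ''x'' c 0" for c
  have y: "(\<Sum>c<Suc d. y c * X (bas c) a) =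
      (\<Sum>c<Suc d. (if nb c \<in> active then 0 else \<xi> c) * X (nb c) a)" if a: "a < Suc d" for a
  proof -
    have "bas ` {..<Suc d} \<subseteq> {..<m + n}" using bas_anchor by auto
    then have ind: "independent (Suc d) (\<lambda>c. X (bas c))" by (rule position[OF bas_inj])
    have "(\<Sum>c<Suc d. real_mem (exec (solve ''bas'') s7) ''x'' c 0 *
        real_mem s7 ''X'' (nat_mem s7 ''bas'' c 0) a) = real_mem s7 ''b'' a 0"
      by (rule exec_solve[OF tablesD(1)[OF t7] _ _ a]) (simp_all add: tablesD(8,10)[OF t7] ind)
    then show ?thesis unfolding b7[OF a] by (simp add: y_def s8_def[symmetric] tablesD(8,10)[OF t7])
  qed
  have s9: "real_mem s9 ''s'' u 0 = real_mem s8 ''s'' u 0 + (\<Sum>c<Suc d. if bas c = u then y c else 0)" for u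
    using exec_add_basis[OF tablesD(1)[OF t8], of u] unfolding s9_def[symmetric] y_def
    by (simp add: tablesD(8)[OF t8])
  have \<sigma>9: "\<sigma> u = real_mem s9 ''s'' u 0" for u by (simp add: \<sigma>_def body)
  have fr: "real_mem s8 ''s'' = real_mem s6 ''s''" "real_mem s5 ''s'' = real_mem s3 ''s''"
    by (simp_all add: s8_def s7_def s5_def s4_def)
  have "step_data ?Om l \<sigma> nb \<xi> y"
    unfolding step_data_def
  proof (intro conjI allI impI)
    show "nb ` {..<Suc d} \<subseteq> \<pi> ` {p. p < pos l \<and> adj (\<pi> p) (act l)}" using nb by (rule conjunct2)
  next
    fix j assume j: "j < n + Suc d"
    show "\<sigma> (act j) = base ?Om l j +
        (\<Sum>c<Suc d. if nb c \<in> active \<and> nb c = act j then \<xi> c else 0) +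
        (\<Sum>c<Suc d. if bas c = act j then y c else 0)"
      unfolding \<sigma>9 s9 fr keep[THEN conjunct1, rule_format] base[OF j] ..
  qed (fact \<xi> y)+
  then have "stress_step ?Om l \<sigma>" by (rule step_data_stress_step[OF l(1)])
  moreover have "real_mem (exec step_body t) ''Om'' (act i) (act j) =
       ?Om (act i) (act j) + \<sigma> (act i) * \<sigma> (act j)" if "i < n + Suc d" "j < n + Suc d" for i j
  proof -
    have "real_mem s9 ''Om'' = ?Om"
      by (simp add: s1_def s2_def s3_def s4_def s5_def s6_def s7_def s8_def s9_def)
    then show ?thesis
      unfolding body \<sigma>9 using exec_update[OF tablesD(1,3,6)[OF t9] act_inj that] by simp
  qed
  ultimately show ?thesis by blast
qed

lemma stress_step_cong:
  assumes "stress_step Om i \<sigma>" and eq: "\<And>j. j < i \<Longrightarrow> Om' (act j) (act i) = Om (act j) (act i)"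
  shows "stress_step Om' i \<sigma>"
proof -
  have 1: "(\<Sum>u\<in>act ` {..<i} \<inter> {..<m}. (Om' u (act i) + \<sigma> u) * X u a) =
      (\<Sum>u\<in>act ` {..<i} \<inter> {..<m}. (Om u (act i) + \<sigma> u) * X u a)" for a
    by (rule sum.cong[OF refl]) (use eq in auto)
  have 2: "\<forall>j<i. m \<le> act j \<longrightarrow> \<not> adj (act j) (act i) \<longrightarrow> \<sigma> (act j) = - Om' (act j) (act i)"
    using stress_stepD(4)[OF assms(1)] eq by simp
  show ?thesis unfolding stress_step_def 1
    using stress_stepD(1-3,5)[OF assms(1)] 2 by (intro conjI)
qed

lemma later_upd: "l < k \<Longrightarrow> later (s(l := \<sigma>)) k = later s k"
  unfolding later_def by (intro ext sum.cong refl) simp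

text \<open>
  Replacing the vector \<open>l\<close> does not affect the matrix \<open>later s k\<close> for \<open>k > l\<close>, so the vectors found
  before remain valid.
\<close>

lemma exec_steps:
  assumes t: "tables t" and z: "\<And>u v. real_mem t ''Om'' u v = 0"
  shows "\<exists>s. (\<forall>l. Suc d \<le> l \<longrightarrow> l < n + Suc d \<longrightarrow> stress_step (later s (Suc l)) l (s l)) \<and>
    (\<forall>i<n + Suc d. \<forall>j<n + Suc d. real_mem (exec (For ''t'' (nvar ''n'') step_body) t) ''Om'' (act i) (act j) =
       later s (Suc d) (act i) (act j))"
proof -
  let ?K = "n + Suc d"
  let ?I = "\<lambda>k R. \<exists>s. (\<forall>l. ?K - k \<le> l \<longrightarrow> l < ?K \<longrightarrow> stress_step (later s (Suc l)) l (s l)) \<and>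
    (\<forall>i<?K. \<forall>j<?K. R ''Om'' (act i) (act j) = later s (?K - k) (act i) (act j))"
  have "?I (nval (nvar ''n'') t) (real_mem (exec (For ''t'' (nvar ''n'') step_body) t))"
  proof (rule For_rule_real[where I = ?I], goal_cases)
    case 1
    show ?case by (simp add: z later_def)
  next
    case (2 k u)
    have kn: "k < n" using 2(1) tablesD(3)[OF t] by simp
    have u: "tables u"
    proof (rule tables_cong[OF t])
      fix y assume "y \<in> table_names"
      then have "y \<notin> nat_writes (For ''t'' (nvar ''n'') step_body)" by auto
      then show "nat_mem u y = nat_mem t y" using 2(4) by blast
    next
      have "''X'' \<notin> real_writes step_body" by simp
      then show "real_mem u ''X'' = real_mem t ''X''" using 2(4) by blast
    qed
    define l where "l = n + d - k"
    have l: "?K - Suc k = l" "?K - k = Suc l" "l < ?K" using kn unfolding l_def by auto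
    define \<sigma> where "\<sigma> v = real_mem (exec step_body u) ''s'' v 0" for v
    obtain s where s: "\<forall>l. ?K - k \<le> l \<longrightarrow> l < ?K \<longrightarrow> stress_step (later s (Suc l)) l (s l)"
      and om: "\<forall>i<?K. \<forall>j<?K. real_mem u ''Om'' (act i) (act j) = later s (?K - k) (act i) (act j)"
      using 2(2) by (elim exE conjE)
    have step: "stress_step (real_mem u ''Om'') l \<sigma>"
      and upd: "\<forall>i<?K. \<forall>j<?K. real_mem (exec step_body u) ''Om'' (act i) (act j) =
        real_mem u ''Om'' (act i) (act j) + \<sigma> (act i) * \<sigma> (act j)"
      using exec_step_body[OF u 2(3) kn] unfolding l_def \<sigma>_def by - (elim conjE, assumption)+
    let ?s = "s(l := \<sigma>)"
    have "stress_step (later ?s (Suc l')) l' (?s l')" if l': "l \<le> l'" "l' < ?K" for l'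
    proof (cases "l' = l")
      case True
      have "stress_step (later s (Suc l)) l \<sigma>"
        by (rule stress_step_cong[OF step]) (use om l in simp)
      then show ?thesis using True by (simp add: later_upd)
    next
      case False
      then have "stress_step (later s (Suc l')) l' (s l')" using s l l' by simp
      then show ?thesis using False l' by (simp add: later_upd)
    qed
    moreover have "real_mem (exec step_body u) ''Om'' (act i) (act j) = later ?s l (act i) (act j)"
      if ij: "i < ?K" "j < ?K" for i j
    proof -
      have "later ?s l (act i) (act j) = later ?s (Suc l) (act i) (act j) + \<sigma> (act i) * \<sigma> (act j)"
        unfolding later_def using l(3) by (simp add: sum.atLeast_Suc_lessThan)
      then show ?thesis using upd om ij l by (simp add: later_upd)
    qed
    ultimately show ?case unfolding l(1) by (intro exI[of _ ?s] conjI allI impI)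
  qed
  moreover have "?K - nval (nvar ''n'') t = Suc d" using tablesD(3)[OF t] by simp
  ultimately show ?thesis by simp
qed

end

text \<open>
  With fewer than \<open>d + 1\<close> basis anchors no anchor would have been dropped, although there are at
  least \<open>d + 1\<close> of them.
\<close>

lemma selected_all:
  assumes S: "selected d m \<pi> (m + n) ca na bas act pos isact"
    and inj: "inj_on \<pi> {..<m + n}" and range: "\<pi> ` {..<m + n} = {..<m + n}" and m: "Suc d \<le> m"
  shows "ca = Suc d \<and> na = n + Suc d"
proof -
  note D = selectedD[OF S]
  have ca: "ca = Suc d"
  proof (rule ccontr)
    assume "ca \<noteq> Suc d"
    have "{..<m} \<subseteq> bas ` {..<ca}"
    proof
      fix v assume v: "v \<in> {..<m}"
      then have "v \<in> \<pi> ` {..<m + n}" unfolding range by simp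
      then obtain q where q: "q < m + n" "v = \<pi> q" by auto
      then have "\<pi> q \<in> act ` {..<na}" using D(8) \<open>ca \<noteq> Suc d\<close> by blast
      then show "v \<in> bas ` {..<ca}" unfolding D(4) using v q by auto
    qed
    then have "card {..<m} \<le> card (bas ` {..<ca})" by (intro card_mono) auto
    also have "\<dots> = ca" using card_image[OF D(2)] by simp
    finally show False using D(1) \<open>ca \<noteq> Suc d\<close> m by simp
  qed
  have act_inj: "inj_on act {..<na}"
  proof (rule inj_onI)
    fix i j assume ij: "i \<in> {..<na}" "j \<in> {..<na}" "act i = act j"
    then have "pos i = pos j" using D(5) inj_onD[OF inj, of "pos i" "pos j"] by simp
    then show "i = j" using D(6)[rule_format, of i j] D(6)[rule_format, of j i] ij
      by (cases i j rule: linorder_cases) auto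
  qed
  have "na = card (act ` {..<na})" using card_image[OF act_inj] by simp
  also have "act ` {..<na} = {m..<m + n} \<union> bas ` {..<ca}"
    unfolding D(4) range by auto
  also have "card \<dots> = card {m..<m + n} + card (bas ` {..<ca})"
    by (rule card_Un_disjoint) (use D(3) in auto)
  also have "\<dots> = n + Suc d" using card_image[OF D(2)] ca by simp
  finally show ?thesis using ca by simp
qed

section \<open>Operation count\<close>

lemma static_program: "static program"
  by (simp add: program_def coordinates_def select_def select_body_def activate_def step_body_def
      pick_def neighbours_def visit_def start_def defect_def solve_def reset_def eliminate_def project_def
      keep_active_def leftover_def add_basis_def update_def update_cell_def write_output_def sensor_row_def mixed_sum_def mixed_entry_def corner_entry_def)

lemma ops_components:
  assumes "nval basis_exp s = r" "nval active_exp s = q"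
  shows "ops_bound coordinates s = 0" "ops_bound select s = 0" "ops_bound pick s = 0"
    "ops_bound neighbours s = 0" "ops_bound start s = q" "ops_bound defect s = r * (q * 3)"
    "ops_bound (solve ix) s = r * (r * (r * 2) + r * 2 + r * 2 + 2 + r * 2 + r * (r * 3))"
    "ops_bound keep_active s = r" "ops_bound leftover s = r * (r * 2)"
    "ops_bound add_basis s = r" "ops_bound update s = q * (q * 2)"
  using assms
  by (simp_all add: coordinates_def select_def select_body_def activate_def pick_def neighbours_def visit_def
      start_def defect_def solve_def reset_def eliminate_def project_def keep_active_def
      leftover_def add_basis_def update_def update_cell_def algebra_simps del: nval.simps)

lemma ops_write_output:
  assumes "nval dim_exp s = d" "nval (nvar ''n'') s = n"
  shows "ops_bound write_output s = d * (n * (n * 3)) + d * (d * (n * 3))"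
  using assms by (simp add: write_output_def sensor_row_def mixed_sum_def mixed_entry_def corner_entry_def algebra_simps del: nval.simps)

text \<open>
  The only mixed case is \<open>n\<^sup>2 d\<close>, which is at most \<open>n\<^sup>3\<close> or at most \<open>n d\<^sup>2\<close>, depending on which of \<open>n\<close>
  and \<open>d\<close> is larger.
\<close>

lemma monomials_bounded:
  fixes n d :: nat
  defines "T \<equiv> n ^ 3 + n * d ^ 3"
  shows "n \<le> T" "n * d \<le> T" "n * d ^ 2 \<le> T" "n ^ 2 \<le> T" "n ^ 2 * d \<le> T"
    "n ^ 3 \<le> T" "n * d ^ 3 \<le> T"
proof -
  have pow: "k \<le> k ^ 3" "k ^ 2 \<le> k ^ 3" for k :: nat
    using power_increasing[of 1 3 k] power_increasing[of 2 3 k] by (cases "k = 0", auto)+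
  note n = pow[of n] and d = pow[of d]
  show "n \<le> T" "n ^ 2 \<le> T" "n ^ 3 \<le> T" "n * d ^ 3 \<le> T" using n unfolding T_def by simp_all
  have "n * d \<le> n * d ^ 3" "n * d ^ 2 \<le> n * d ^ 3" by (rule mult_le_mono2[OF d(1)], rule mult_le_mono2[OF d(2)])
  then show "n * d \<le> T" and nd2: "n * d ^ 2 \<le> T" unfolding T_def by linarith+
  show "n ^ 2 * d \<le> T"
  proof (cases "d \<le> n")
    case True
    then have "n ^ 2 * d \<le> n ^ 2 * n" by (rule mult_le_mono2)
    also have "n ^ 2 * n = n ^ 3" by (simp add: power2_eq_square power3_eq_cube)
    finally show ?thesis unfolding T_def by linarith
  next
    case False
    then have "n * d * n \<le> n * d * d" by (intro mult_le_mono2) simp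
    moreover have "n ^ 2 * d = n * d * n" "n * d ^ 2 = n * d * d" by (simp_all add: power2_eq_square)
    ultimately show ?thesis using nd2 by linarith
  qed
qed

section \<open>Correctness of the program\<close>

lemma initial_cells:
  "nat_mem (initial_state N \<pi>) ''d'' 0 0 = space_dim N"
  "nat_mem (initial_state N \<pi>) ''m'' 0 0 = num_anchors N"
  "nat_mem (initial_state N \<pi>) ''n'' 0 0 = num_sensors N"
  "p < num_points N \<Longrightarrow> nat_mem (initial_state N \<pi>) ''ord'' p 0 = \<pi> p"
  "u < num_points N \<Longrightarrow> v < num_points N \<Longrightarrow>
     nat_mem (initial_state N \<pi>) ''adj'' u v = of_bool ({u, v} \<in> edges N)"
  "nat_mem (initial_state N \<pi>) ''ca'' 0 0 = 0" "nat_mem (initial_state N \<pi>) ''na'' 0 0 = 0"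
  "nat_mem (initial_state N \<pi>) ''isact'' v 0 = 0"
  "real_mem (initial_state N \<pi>) ''Om'' i j = 0"
  "a < space_dim N \<Longrightarrow> v < num_anchors N \<Longrightarrow> real_mem (initial_state N \<pi>) ''Pbar'' a v = anchor_pos N $$ (a, v)"
  "a < space_dim N \<Longrightarrow> i < num_sensors N \<Longrightarrow> real_mem (initial_state N \<pi>) ''P'' a i = sensor_pos N $$ (a, i)"
  by (simp_all add: initial_state_def Let_def)

lemma initial_counters: "arith_ops (initial_state N \<pi>) = 0" "steps (initial_state N \<pi>) = 0"
  by (simp_all add: initial_state_def Let_def)

text \<open>The last coordinate makes the coefficients of a linear dependence add up to zero.\<close>

lemma homogeneous_independent:
  assumes net: "sensor_network N" and gp: "general_position N"
    and inj: "inj_on g {..<Suc (space_dim N)}" and range: "g ` {..<Suc (space_dim N)} \<subseteq> {..<num_points N}"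
    and X: "\<And>v a. v < num_points N \<Longrightarrow> a < Suc (space_dim N) \<Longrightarrow> X v a = homogeneous N v a"
  shows "independent (Suc (space_dim N)) (\<lambda>c. X (g c))"
  unfolding independent_def
proof (intro allI impI, rule ccontr)
  let ?d = "space_dim N"
  fix x :: "nat \<Rightarrow> real" and c
  assume x: "\<forall>a<Suc ?d. (\<Sum>c<Suc ?d. x c * X (g c) a) = 0" and c: "c < Suc ?d" "x c \<noteq> 0"
  let ?I = "g ` {..<Suc ?d}"
  define y where "y v = x (the_inv_into {..<Suc ?d} g v)" for v
  have y: "y (g c) = x c" if "c < Suc ?d" for c
    unfolding y_def using the_inv_into_f_f[OF inj] that by simp
  have reindex: "(\<Sum>v\<in>?I. y v * f v) = (\<Sum>c<Suc ?d. x c * f (g c))" for f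
    unfolding sum.reindex[OF inj] comp_def by (rule sum.cong[OF refl]) (simp add: y)
  have sum: "(\<Sum>v\<in>?I. y v * homogeneous N v a) = 0" if a: "a < Suc ?d" for a
  proof -
    have "(\<Sum>v\<in>?I. y v * homogeneous N v a) = (\<Sum>v\<in>?I. y v * X v a)"
      by (rule sum.cong[OF refl]) (use range X a in auto)
    then show ?thesis unfolding reindex using x a by simp
  qed
  have dims: "anchor_pos N \<in> carrier_mat ?d (num_anchors N)" "sensor_pos N \<in> carrier_mat ?d (num_sensors N)"
    using net unfolding sensor_network_def Let_def by - (elim conjE, assumption)+
  have pt: "point N v $ a = homogeneous N v a" if "v < num_points N" "a < ?d" for v a
    using that dims by (auto simp: point_def homogeneous_def)
  have "affinely_dependent ?d (point N) ?I"
    unfolding affinely_dependent_def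
  proof (intro exI[of _ y] conjI allI impI)
    show "\<exists>i\<in>?I. y i \<noteq> 0" using c y by auto
    show "(\<Sum>i\<in>?I. y i) = 0" using sum[of ?d] by (simp add: homogeneous_def)
    fix a assume a: "a < ?d"
    have "(\<Sum>i\<in>?I. y i * point N i $ a) = (\<Sum>i\<in>?I. y i * homogeneous N i a)"
      by (rule sum.cong[OF refl]) (use range pt a in auto)
    then show "(\<Sum>i\<in>?I. y i * point N i $ a) = 0" using sum[of a] a by simp
  qed
  moreover have "card ?I = ?d + 1" using card_image[OF inj] by simp
  ultimately show False using gp range unfolding general_position_def by blast
qed

lemma program_output:
  assumes net: "sensor_network N" and m: "space_dim N + 1 \<le> num_anchors N"
    and lat: "lateration_ordering (space_dim N + 1) (num_points N) (edges N) \<pi>"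
    and gp: "general_position N"
  defines "S \<equiv> output_matrix N (exec program (initial_state N \<pi>))"
  shows "optimal_dual_stress N S" "stress_rank N S = num_sensors N" "psd S"
    "position_gram N * S = 0\<^sub>m (space_dim N + num_sensors N) (space_dim N + num_sensors N)"
proof -
  let ?d = "space_dim N" and ?m = "num_anchors N" and ?n = "num_sensors N"
  have bij: "bij_betw \<pi> {..<?m + ?n} {..<?m + ?n}"
    and clique: "\<forall>i<Suc ?d. \<forall>j<Suc ?d. i \<noteq> j \<longrightarrow> {\<pi> i, \<pi> j} \<in> edges N"
    and many: "\<forall>j\<in>{Suc ?d..<?m + ?n}. Suc ?d \<le> card {i. i < j \<and> {\<pi> i, \<pi> j} \<in> edges N}"
    using lat unfolding lateration_ordering_def by simp_all
  have inj: "inj_on \<pi> {..<?m + ?n}" and range: "\<pi> ` {..<?m + ?n} = {..<?m + ?n}"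
    using bij unfolding bij_betw_def by blast+
  let ?s0 = "initial_state N \<pi>"
  define s1 where "s1 = exec coordinates ?s0"
  define s2 where "s2 = exec select s1"
  define s3 where "s3 = exec (For ''t'' (nvar ''n'') step_body) s2"
  have run: "exec program ?s0 = exec write_output s3"
    by (simp add: program_def s1_def s2_def s3_def)
  define X where "X = real_mem s1 ''X''"
  have X: "X v a = homogeneous N v a" if v: "v < num_points N" and a: "a < Suc ?d" for v a
  proof -
    have "X v a = (if a < ?d then if v < ?m then real_mem ?s0 ''Pbar'' a v else real_mem ?s0 ''P'' a (v - ?m) else 1)"
      unfolding X_def s1_def using exec_coordinates[OF initial_cells(1-3)] v a by blast
    then show ?thesis using v by (auto simp: homogeneous_def initial_cells)
  qed
  define act where "act i = nat_mem s2 ''act'' i 0" for i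
  define pos where "pos i = nat_mem s2 ''pos'' i 0" for i
  define bas where "bas i = nat_mem s2 ''bas'' i 0" for i
  have sel: "sel_state ?d ?m \<pi> (?m + ?n) (nat_mem s2)"
    unfolding s2_def
    by (rule exec_select[OF _ _ _ _ inj]) (simp_all add: s1_def initial_cells)
  have "Suc ?d \<le> ?m" using m by simp
  note all = selected_all[OF sel inj range this]
  note D = selectedD[OF sel[unfolded all[THEN conjunct1] all[THEN conjunct2]],
      folded act_def pos_def bas_def]
  interpret L: lateration_tables ?d ?m ?n \<pi> "\<lambda>u v. {u, v} \<in> edges N" X act pos bas
  proof
    show "inj_on \<pi> {..<?m + ?n}" "\<pi> ` {..<?m + ?n} = {..<?m + ?n}" by (fact inj range)+
    show "{\<pi> i, \<pi> j} \<in> edges N" if "i < Suc ?d" "j < Suc ?d" "i \<noteq> j" for i j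
      using clique that by blast
    show "{v, u} \<in> edges N" if "{u, v} \<in> edges N" for u v
      using that by (simp add: insert_commute)
    show "independent (Suc ?d) (\<lambda>c. X (g c))"
      if "inj_on g {..<Suc ?d}" "g ` {..<Suc ?d} \<subseteq> {..<?m + ?n}" for g
      by (rule homogeneous_independent[OF net gp that X])
    show "inj_on bas {..<Suc ?d}" by (rule D(2))
    show "bas ` {..<Suc ?d} \<subseteq> {..<?m}" using D(3) by blast
    show "act ` {..<?n + Suc ?d} = {?m..<?m + ?n} \<union> bas ` {..<Suc ?d}"
      unfolding D(4) range by auto
    show "pos i < ?m + ?n \<and> act i = \<pi> (pos i)" if "i < ?n + Suc ?d" for i using D(5) that by blast
    show "pos j < pos i" if "j < i" "i < ?n + Suc ?d" for i j using D(6) that by blast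
    show "bas ` {..<Suc ?d} \<subseteq> \<pi> ` {..<q}"
      if "q < ?m + ?n" "\<pi> q \<notin> act ` {..<?n + Suc ?d}" for q using D(8) that by blast
    show "Suc ?d \<le> card {q. q < p \<and> {\<pi> q, \<pi> p} \<in> edges N}" if "Suc ?d \<le> p" "p < ?m + ?n" for p
      using many that by simp
  qed
  have tab: "L.tables s2"
    unfolding L.tables_def
  proof (intro conjI allI impI)
    show "nat_mem s2 ''d'' 0 0 = ?d" "nat_mem s2 ''m'' 0 0 = ?m" "nat_mem s2 ''n'' 0 0 = ?n"
      by (simp_all add: s2_def s1_def initial_cells)
    show "nat_mem s2 ''ord'' p 0 = \<pi> p" if "p < ?m + ?n" for p
      using that by (simp add: s2_def s1_def initial_cells)
    show "(0 < nat_mem s2 ''adj'' u v) = ({u, v} \<in> edges N)" if "u < ?m + ?n" "v < ?m + ?n" for u v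
      using that by (simp add: s2_def s1_def initial_cells)
    show "nat_mem s2 ''isact'' v 0 = of_bool (v \<in> L.active)" for v using D(7) by blast
    show "real_mem s2 ''X'' = X" by (simp add: s2_def X_def)
  qed (simp_all add: act_def pos_def bas_def)
  have "real_mem s2 ''Om'' u v = 0" for u v by (simp add: s2_def s1_def initial_cells)
  from L.exec_steps[OF tab this] obtain s where
    steps: "\<And>l. Suc ?d \<le> l \<Longrightarrow> l < ?n + Suc ?d \<Longrightarrow> L.stress_step (L.later s (Suc l)) l (s l)"
    and om: "\<And>i j. i < ?n + Suc ?d \<Longrightarrow> j < ?n + Suc ?d \<Longrightarrow>
      real_mem s3 ''Om'' (act i) (act j) = L.later s (Suc ?d) (act i) (act j)"
    unfolding s3_def by (elim exE conjE) blast
  define W where "W = L.sensor_stress s"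
  have W: "real_mem s3 ''Om'' (?m + i) (?m + j) = W i j" if ij: "i < ?n" "j < ?n" for i j
  proof -
    obtain i' j' where "i' < ?n + Suc ?d" "?m + i = act i'" "j' < ?n + Suc ?d" "?m + j = act j'"
      using L.sensor_active[of "?m + i"] L.sensor_active[of "?m + j"] ij by auto
    then show ?thesis using om by (simp add: W_def L.sensor_stress_def[OF steps])
  qed
  interpret M: stressed_network N W
  proof
    show "sensor_network N" by (rule net)
    show "W i j = W j i" for i j unfolding W_def by (rule L.sensor_stress_sym[OF steps])
    show "W i j = 0" if "i < ?n" "j < ?n" "i \<noteq> j" "{?m + i, ?m + j} \<notin> edges N" for i j
      unfolding W_def by (rule L.sensor_stress_nonadjacent[OF steps that])
    show "\<exists>w. (\<forall>u. w u \<noteq> 0 \<longrightarrow> {u, ?m + j} \<in> edges N) \<and>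
          (\<forall>a<Suc ?d. (\<Sum>i<?n. W i j * homogeneous N (?m + i) a) = (\<Sum>u<?m. w u * homogeneous N u a))"
      if j: "j < ?n" for j
    proof -
      obtain w where w: "\<forall>u. w u \<noteq> 0 \<longrightarrow> {u, ?m + j} \<in> edges N"
        and eq: "\<forall>a<Suc ?d. (\<Sum>i<?n. W i j * X (?m + i) a) = (\<Sum>u<?m. w u * X u a)"
      proof -
        have "\<exists>w. (\<forall>u. w u \<noteq> 0 \<longrightarrow> {u, ?m + j} \<in> edges N) \<and>
            (\<forall>a<Suc ?d. (\<Sum>i<?n. W i j * X (?m + i) a) = (\<Sum>u<?m. w u * X u a))"
          unfolding W_def by (rule L.sensor_stress_anchored[OF steps j])
        then show ?thesis using that by (elim exE conjE)
      qed
      have "(\<Sum>i<?n. W i j * homogeneous N (?m + i) a) = (\<Sum>u<?m. w u * homogeneous N u a)"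
        if a: "a < Suc ?d" for a
      proof -
        have "(\<Sum>i<?n. W i j * homogeneous N (?m + i) a) = (\<Sum>i<?n. W i j * X (?m + i) a)"
          by (rule sum.cong[OF refl]) (simp add: X a)
        also have "\<dots> = (\<Sum>u<?m. w u * X u a)" using eq a by blast
        also have "\<dots> = (\<Sum>u<?m. w u * homogeneous N u a)"
          by (rule sum.cong[OF refl]) (simp add: X a)
        finally show ?thesis .
      qed
      then show ?thesis using w by blast
    qed
    show "0 \<le> (\<Sum>i<?n. \<Sum>j<?n. x i * W i j * x j)" for x
      unfolding W_def by (rule L.sensor_stress_nonneg[OF steps])
    show "x i = 0" if "(\<Sum>i<?n. \<Sum>j<?n. x i * W i j * x j) = 0" "i < ?n" for x i
      by (rule L.sensor_stress_definite[OF steps that[unfolded W_def]])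
  qed
  have sz: "nat_mem s3 ''d'' 0 0 = ?d" "nat_mem s3 ''m'' 0 0 = ?m" "nat_mem s3 ''n'' 0 0 = ?n"
    using L.tablesD(1-3)[OF tab] by (simp_all add: s3_def)
  have P: "real_mem s3 ''P'' a i = sensor_pos N $$ (a, i)" if "a < ?d" "i < ?n" for a i
    using that by (simp add: s3_def s2_def s1_def initial_cells)
  note out = exec_write_output[OF sz, THEN conjunct1, rule_format]
    exec_write_output[OF sz, THEN conjunct2, THEN conjunct1, rule_format, THEN conjunct1]
    exec_write_output[OF sz, THEN conjunct2, THEN conjunct1, rule_format, THEN conjunct2]
    exec_write_output[OF sz, THEN conjunct2, THEN conjunct2, rule_format]
  have T: "(\<Sum>i<?n. real_mem s3 ''P'' a i * real_mem s3 ''Om'' (?m + i) (?m + j)) =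
      (\<Sum>i<?n. sensor_pos N $$ (a, i) * W i j)" if "a < ?d" "j < ?n" for a j
    by (rule sum.cong[OF refl]) (simp add: P W that)
  have cell: "real_mem (exec write_output s3) ''S'' x y = M.entry x y" if xy: "x < ?d + ?n" "y < ?d + ?n" for x y
  proof -
    have split: "z < ?d \<or> (\<exists>i<?n. z = ?d + i)" if z: "z < ?d + ?n" for z
    proof (cases "z < ?d")
      case False
      then show ?thesis using z by (intro disjI2 exI[of _ "z - ?d"]) simp
    qed simp
    consider (dd) "x < ?d" "y < ?d" | (ds) "x < ?d" "\<exists>j<?n. y = ?d + j"
      | (sd) "\<exists>i<?n. x = ?d + i" "y < ?d" | (ss) "\<exists>i<?n. x = ?d + i" "\<exists>j<?n. y = ?d + j"
      using split[OF xy(1)] split[OF xy(2)] by argo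
    then show ?thesis
    proof cases
      case dd
      have "real_mem (exec write_output s3) ''S'' x y =
          - (\<Sum>j<?n. - (\<Sum>i<?n. real_mem s3 ''P'' x i * real_mem s3 ''Om'' (?m + i) (?m + j)) * real_mem s3 ''P'' y j)"
        by (rule out(4)[OF dd])
      also have "\<dots> = - (\<Sum>j<?n. - (\<Sum>i<?n. sensor_pos N $$ (x, i) * W i j) * sensor_pos N $$ (y, j))"
      proof (intro arg_cong[of _ _ uminus] sum.cong refl)
        fix j assume "j \<in> {..<?n}"
        then have j: "j < ?n" by simp
        show "- (\<Sum>i<?n. real_mem s3 ''P'' x i * real_mem s3 ''Om'' (?m + i) (?m + j)) * real_mem s3 ''P'' y j =
            - (\<Sum>i<?n. sensor_pos N $$ (x, i) * W i j) * sensor_pos N $$ (y, j)"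
          unfolding T[OF dd(1) j] P[OF dd(2) j] ..
      qed
      finally show ?thesis unfolding M.entry_dim[OF dd] .
    next
      case ds
      obtain j where j: "j < ?n" "y = ?d + j" using ds(2) by (elim exE conjE)
      have "real_mem (exec write_output s3) ''S'' x (?d + j) =
          - (\<Sum>i<?n. real_mem s3 ''P'' x i * real_mem s3 ''Om'' (?m + i) (?m + j))"
        by (rule out(2)[OF ds(1) j(1)])
      then show ?thesis using M.entry_mixed[OF j(1) ds(1)] T[OF ds(1) j(1)] j(2) by simp
    next
      case sd
      obtain j where j: "j < ?n" "x = ?d + j" using sd(1) by (elim exE conjE)
      have "real_mem (exec write_output s3) ''S'' (?d + j) y =
          - (\<Sum>i<?n. real_mem s3 ''P'' y i * real_mem s3 ''Om'' (?m + i) (?m + j))"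
        by (rule out(3)[OF sd(2) j(1)])
      then show ?thesis
        using M.entry_mixed[OF j(1) sd(2)] T[OF sd(2) j(1)] j(2) M.entry_sym[of x y] by simp
    next
      case ss
      obtain i j where ij: "i < ?n" "x = ?d + i" "j < ?n" "y = ?d + j" using ss by (elim exE conjE)
      have "real_mem (exec write_output s3) ''S'' (?d + i) (?d + j) =
          real_mem s3 ''Om'' (?m + i) (?m + j)"
        by (rule out(1)[OF ij(1,3)])
      then show ?thesis using M.entry_sensor[OF ij(1,3)] W[OF ij(1,3)] ij by simp
    qed
  qed
  have "S = M.stress_mat"
    unfolding S_def run output_matrix_def M.stress_mat_def by (rule cong_mat) (simp_all add: cell)
  then show "optimal_dual_stress N S" "stress_rank N S = num_sensors N" "psd S"
    "position_gram N * S = 0\<^sub>m (space_dim N + num_sensors N) (space_dim N + num_sensors N)"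
    using M.stress_mat_optimal M.stress_mat_rank M.stress_mat_psd M.gram_stress by simp_all
qed

text \<open>
  The bound 193 is the sum of the coefficients of the exact value, all of whose monomials are at most
  \<open>n\<^sup>3 + n d\<^sup>3\<close>.
\<close>

lemma ops_program:
  assumes d: "nat_mem s ''d'' 0 0 = d" and n: "nat_mem s ''n'' 0 0 = n"
  shows "ops_bound program s \<le> 193 * (n ^ 3 + n * d ^ 3)"
proof -
  let ?r = "d + 1" and ?q = "n + (d + 1)"
  have "nval basis_exp s = ?r" "nval active_exp s = ?q" using d n by simp_all
  note c = ops_components[OF this]
  have v: "nval dim_exp s = d" "nval (nvar ''n'') s = n" using d n by simp_all
  have body: "ops_bound step_body s = ?q + ?r * (?q * 3) +
      2 * (?r * (?r * (?r * 2) + ?r * 2 + ?r * 2 + 2 + ?r * 2 + ?r * (?r * 3))) +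
      ?r + ?r * (?r * 2) + ?r + ?q * (?q * 2)"
    unfolding step_body_def ops_bound.simps c by simp
  have "ops_bound program s = n * ops_bound step_body s + (d * (n * (n * 3)) + d * (d * (n * 3)))"
    unfolding program_def ops_bound.simps c ops_write_output[OF v] v by simp
  also have "\<dots> = 2 * n ^ 3 + 10 * (n ^ 2 * d) + 8 * n ^ 2 + 10 * (n * d ^ 3) + 52 * (n * d ^ 2) +
      75 * (n * d) + 36 * n"
    unfolding body by (simp add: algebra_simps power2_eq_square power3_eq_cube)
  also have "\<dots> \<le> 193 * (n ^ 3 + n * d ^ 3)"
  proof -
    define T where "T = n ^ 3 + n * d ^ 3"
    from monomials_bounded[of n d] show ?thesis unfolding T_def[symmetric] by linarith
  qed
  finally show ?thesis .
qed

theorem theorem4: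
  shows "(\<forall>N. sensor_network N \<and> space_dim N + 1 \<le> num_anchors N \<and>
            lateration_graph (space_dim N + 1) (num_points N) (edges N) \<and>
            general_position N
            \<longrightarrow> strongly_localizable N) \<and>
         (\<exists>prog C K c. \<forall>N \<pi>. sensor_network N \<and> space_dim N + 1 \<le> num_anchors N \<and>
            lateration_ordering (space_dim N + 1) (num_points N) (edges N) \<pi> \<and>
            general_position N
            \<longrightarrow> (let d = space_dim N; m = num_anchors N; n = num_sensors N;
                     s = exec prog (initial_state N \<pi>); S = output_matrix N s
                 in optimal_dual_stress N S \<and> stress_rank N S = n \<and>
                    arith_ops s \<le> C * (n ^ 3 + n * d ^ 3) \<and>
                    steps s \<le> K * (m + n + d + 1) ^ c))"
    (is "?localizable \<and> ?computable")
proof (rule conjI)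
  show ?localizable
  proof (intro allI impI, elim conjE)
    fix N
    assume N: "sensor_network N" "space_dim N + 1 \<le> num_anchors N"
      and "lateration_graph (space_dim N + 1) (num_points N) (edges N)" and gp: "general_position N"
    then obtain \<pi> where lat: "lateration_ordering (space_dim N + 1) (num_points N) (edges N) \<pi>"
      unfolding lateration_graph_def by (elim exE)
    show "strongly_localizable N"
      unfolding strongly_localizable_def
      by (intro exI conjI) (rule program_output[OF N lat gp])+
  qed
next
  obtain K c where steps: "\<forall>s. steps (exec program s) \<le> steps s + K * input_size s ^ c"
    using steps_polynomial[OF static_program] by (elim exE)
  have "let d = space_dim N; m = num_anchors N; n = num_sensors N;
            s = exec program (initial_state N \<pi>); S = output_matrix N s
        in optimal_dual_stress N S \<and> stress_rank N S = n \<and>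
           arith_ops s \<le> 193 * (n ^ 3 + n * d ^ 3) \<and> steps s \<le> K * (m + n + d + 1) ^ c"
    if "sensor_network N \<and> space_dim N + 1 \<le> num_anchors N \<and>
        lateration_ordering (space_dim N + 1) (num_points N) (edges N) \<pi> \<and> general_position N" for N \<pi>
  proof -
    have N: "sensor_network N" "space_dim N + 1 \<le> num_anchors N"
      and lat: "lateration_ordering (space_dim N + 1) (num_points N) (edges N) \<pi>"
      and gp: "general_position N" using that by simp_all
    let ?s = "initial_state N \<pi>"
    have "arith_ops (exec program ?s) \<le> arith_ops ?s + ops_bound program ?s"
      by (rule counters_bounded[OF static_program, THEN conjunct1])
    also have "\<dots> \<le> 193 * (num_sensors N ^ 3 + num_sensors N * space_dim N ^ 3)"
      unfolding initial_counters add_0 by (rule ops_program[OF initial_cells(1,3)])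
    finally have ops: "arith_ops (exec program ?s) \<le>
        193 * (num_sensors N ^ 3 + num_sensors N * space_dim N ^ 3)" .
    have "input_size ?s = num_anchors N + num_sensors N + space_dim N + 1"
      by (simp add: input_size_def initial_cells)
    then have "steps (exec program ?s) \<le> K * (num_anchors N + num_sensors N + space_dim N + 1) ^ c"
      using steps[rule_format, of ?s] by (simp add: initial_counters)
    then show ?thesis
      unfolding Let_def using program_output(1,2)[OF N lat gp] ops by (intro conjI)
  qed
  then show ?computable
    by (intro exI[of _ program] exI[of _ 193] exI[of _ K] exI[of _ c] allI impI)
qed

end
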